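(* Let $\alpha>4.453$ be a constant. Let $\varphi$ be a random 3-SAT formula on $n$ variables with $m=\lfloor \alpha n\rfloor$ clauses. Then with probability tending to $1$ as $n\to\infty$, $\varphi$ has no non-trivial core assignment, i.e. there is no satisfying assignment of $\varphi$ whose core has at least one variable assigned a value in $\{0,1\}$.
   Context: Random 3-SAT model: on Boolean variables $x_1,\dots,x_n$, a clause is a disjunction of 3 literals on 3 distinct variables; there are $8\binom{n}{3}$ such clauses. A random formula of density $\alpha$ consists of $m=\lfloor\alpha n\rfloor$ clauses chosen uniformly at random with replacement from all these clauses. For a clause $c$ and a variable $x_i$ occurring in it, the satisfying value of $x_i$ for $c$ is the value making its literal true, the unsatisfying value the other one. A partial assignment is $\sigma\in\{0,1,\ast\}^n$ ($\ast$ means unassigned). It is invalid for a clause $c$ if either all three variables of $c$ take their unsatisfying values, or two of them take their unsatisfying values and the third is $\ast$; otherwise it is valid for $c$. It is valid (for the formula) if it is valid for every clause. A variable $x_i$ with value in $\{0,1\}$ is constrained (by clause $c$) if $x_i$ takes its satisfying value for $c$ and the other two variables of $c$ take their unsatisfying values for $c$; a variable with value in $\{0,1\}$ that is constrained by no clause is unconstrained. Partial order: for valid partial assignments $\sigma,\tau$, put a directed edge $\sigma\to\tau$ if they agree except at one index $i$ with $\sigma_i\neq\ast$, $\tau_i=\ast$; write $\tau<\sigma$ if there is a directed path from $\sigma$ to $\tau$ in this graph on valid partial assignments. A valid partial assignment is minimal if it has no unconstrained variables. The core of a satisfying assignment $\sigma\in\{0,1\}^n$ is a minimal valid partial assignment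 $\tau$ with $\tau<\sigma$ (it is unique). A core is non-trivial if it assigns at least one variable a value in $\{0,1\}$. *)

theory Defs
  imports "HOL-Probability.Probability"
begin

text \<open>
  The variables are the numbers \<open>i < n\<close>. The literal \<open>(i, b)\<close> is made true by assigning \<open>b\<close> to
  variable \<open>i\<close>, so \<open>b\<close> is the satisfying value of \<open>i\<close> for every clause containing \<open>(i, b)\<close>.
  A formula is a list of clauses, since clauses are drawn with replacement.
\<close>

type_synonym literal = "nat \<times> bool"
type_synonym clause = "literal set"
type_synonym formula = "clause list"

definition clauses :: "nat \<Rightarrow> clause set" where
  "clauses n = {c. c \<subseteq> {..<n} \<times> UNIV \<and> card c = 3 \<and> inj_on fst c}"

text \<open>The distribution is meaningful for \<open>n \<ge> 3\<close>; otherwise there are no clauses to draw from.\<close>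

definition random_formula :: "nat \<Rightarrow> nat \<Rightarrow> formula pmf" where
  "random_formula n m = replicate_pmf m (pmf_of_set (clauses n))"

text \<open>Partial assignments in \<open>{0,1,*}\<^sup>n\<close> are maps with domain contained in \<open>{..<n}\<close>;
  \<open>None\<close> stands for \<open>*\<close>.\<close>

type_synonym passign = "nat \<Rightarrow> bool option"

definition lit_true :: "passign \<Rightarrow> literal \<Rightarrow> bool" where
  "lit_true \<sigma> l \<longleftrightarrow> \<sigma> (fst l) = Some (snd l)"

definition lit_false :: "passign \<Rightarrow> literal \<Rightarrow> bool" where
  "lit_false \<sigma> l \<longleftrightarrow> \<sigma> (fst l) = Some (\<not> snd l)"

definition invalid_for :: "passign \<Rightarrow> clause \<Rightarrow> bool" where
  "invalid_for \<sigma> c \<longleftrightarrow>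
     (\<forall>l\<in>c. lit_false \<sigma> l) \<or>
     (\<exists>l\<in>c. \<sigma> (fst l) = None \<and> (\<forall>l'\<in>c - {l}. lit_false \<sigma> l'))"

definition valid :: "nat \<Rightarrow> formula \<Rightarrow> passign \<Rightarrow> bool" where
  "valid n \<phi> \<sigma> \<longleftrightarrow> dom \<sigma> \<subseteq> {..<n} \<and> (\<forall>c\<in>set \<phi>. \<not> invalid_for \<sigma> c)"

definition satisfying :: "nat \<Rightarrow> formula \<Rightarrow> passign \<Rightarrow> bool" where
  "satisfying n \<phi> \<sigma> \<longleftrightarrow> dom \<sigma> = {..<n} \<and> (\<forall>c\<in>set \<phi>. \<exists>l\<in>c. lit_true \<sigma> l)"

definition constrained_by :: "passign \<Rightarrow> nat \<Rightarrow> clause \<Rightarrow> bool" where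
  "constrained_by \<sigma> i c \<longleftrightarrow>
     (\<exists>l\<in>c. fst l = i \<and> lit_true \<sigma> l \<and> (\<forall>l'\<in>c - {l}. lit_false \<sigma> l'))"

definition unconstrained :: "formula \<Rightarrow> passign \<Rightarrow> nat \<Rightarrow> bool" where
  "unconstrained \<phi> \<sigma> i \<longleftrightarrow> \<sigma> i \<noteq> None \<and> \<not> (\<exists>c\<in>set \<phi>. constrained_by \<sigma> i c)"

definition edge :: "nat \<Rightarrow> formula \<Rightarrow> passign \<Rightarrow> passign \<Rightarrow> bool" where
  "edge n \<phi> \<sigma> \<tau> \<longleftrightarrow> valid n \<phi> \<sigma> \<and> valid n \<phi> \<tau> \<and>
     (\<exists>i<n. \<sigma> i \<noteq> None \<and> \<tau> i = None \<and> (\<forall>j. j \<noteq> i \<longrightarrow> \<tau> j = \<sigma> j))"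

definition minimal :: "nat \<Rightarrow> formula \<Rightarrow> passign \<Rightarrow> bool" where
  "minimal n \<phi> \<sigma> \<longleftrightarrow> valid n \<phi> \<sigma> \<and> (\<forall>i<n. \<not> unconstrained \<phi> \<sigma> i)"

text \<open>The path from \<open>\<sigma>\<close> to \<open>\<tau>\<close> may have length \<open>0\<close>: a satisfying assignment without
  unconstrained variables is its own core.\<close>

definition core_of :: "nat \<Rightarrow> formula \<Rightarrow> passign \<Rightarrow> passign \<Rightarrow> bool" where
  "core_of n \<phi> \<sigma> \<tau> \<longleftrightarrow> satisfying n \<phi> \<sigma> \<and> minimal n \<phi> \<tau> \<and> (edge n \<phi>)\<^sup>*\<^sup>* \<sigma> \<tau>"

definition nontrivial :: "nat \<Rightarrow> passign \<Rightarrow> bool" where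
  "nontrivial n \<tau> \<longleftrightarrow> (\<exists>i<n. \<tau> i \<noteq> None)"

definition has_nontrivial_core :: "nat \<Rightarrow> formula \<Rightarrow> bool" where
  "has_nontrivial_core n \<phi> \<longleftrightarrow> (\<exists>\<sigma> \<tau>. core_of n \<phi> \<sigma> \<tau> \<and> nontrivial n \<tau>)"

end

theory Submission
  imports Defs "HOL-Real_Asymp.Real_Asymp"
begin

text \<open>
  If a satisfying assignment \<open>\<sigma>\<close> has the core \<open>\<tau>\<close>, then the weights
  \<open>\<rho>\<^bsup>u\<^esup> (1 - \<rho>)\<^bsup>z\<^esup>\<close> of the valid partial assignments \<open>\<tau>'\<close> between \<open>\<tau>\<close> and \<open>\<sigma>\<close> sum to at least \<open>1\<close>,
  where \<open>u\<close> counts the unconstrained variables of \<open>\<tau>'\<close> outside the domain of \<open>\<tau>\<close> and \<open>z\<close> the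
  unassigned ones. Hence the expected total weight of the pairs \<open>(\<tau>, \<tau>')\<close>, for any \<open>\<rho>\<close> that may depend
  on the size of \<open>\<tau>\<close>, bounds the probability that there is a core of this size. For a fixed pair the
  expectation is an occupancy problem, bounded through its exponential generating function. For
  densities up to \<open>4.75\<close> the resulting exponential rate is negative for cores of between one fifth and
  three quarters of the variables with a suitable \<open>\<rho>\<close>; for the other sizes it suffices to count the
  cores alone. At larger densities the formula is unsatisfiable with high probability, by the first
  moment of the satisfying assignments in which every variable set to \<open>False\<close> is constrained.
\<close>

section \<open>Occupancy of random lists\<close>

text \<open>Counting cores alone fails in the middle range: for cores of half the variables at
  density 4.453 the exponent of that count, taken with \<open>y = 4.453\<close>, is about +0.015.
  The count does not see that a core extends to a valid total assignment; the weighted pairs bring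
  this condition in. With \<open>\<rho> = 1\<close> they would count the valid total extensions of
  each core, with \<open>\<rho> = 0\<close> the extensions in which every variable is constrained;
  intermediate values balance the two.

  In the generating function \<open>y\<close> acts as the clause density of a model with independent
  occurrences, and every \<open>y > 0\<close> gives a valid bound. The value 19/4 serves all
  densities from 4.453 to 19/4: the only term containing the density decreases up to
  \<open>y\<close>, so a check at 4.453 covers the interval.

  Negativity of the exponent in two variables is reduced to finitely many integer inequalities:
  tangents replace the logarithms of \<open>d\<close> and of the unassigned fraction, which leaves a
  function that is convex in each coordinate up to a small correction, so that the corners of a cell
  decide.\<close>

definition samples :: "'a set \<Rightarrow> nat \<Rightarrow> 'a list set" where
  "samples A m = {xs. set xs \<subseteq> A \<and> length xs = m}"

lemma finite_samples: "finite A \<Longrightarrow> finite (samples A m)"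
  unfolding samples_def by (rule finite_lists_length_eq)

lemma samples_0: "samples A 0 = {[]}"
  by (auto simp: samples_def)

lemma samples_Suc: "samples A (Suc m) = (\<lambda>(x, xs). x # xs) ` (A \<times> samples A m)"
  by (auto simp: samples_def image_iff length_Suc_conv)

lemma replicate_pmf_of_set:
  assumes "finite A" "A \<noteq> {}"
  shows "replicate_pmf m (pmf_of_set A) = pmf_of_set (samples A m)"
proof (induction m)
  case 0
  then show ?case by (simp add: samples_0 pmf_of_set_singleton)
next
  case (Suc m)
  have ne: "samples A m \<noteq> {}"
    using assms by (auto simp: samples_def intro!: exI[of _ "replicate m (SOME x. x \<in> A)"] some_in_eq[THEN iffD2])
  have "replicate_pmf (Suc m) (pmf_of_set A)
      = map_pmf (\<lambda>(x, xs). x # xs) (pair_pmf (pmf_of_set A) (pmf_of_set (samples A m)))"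
    by (simp add: Suc.IH pair_pmf_def map_pmf_def bind_assoc_pmf bind_return_pmf)
  also have "pair_pmf (pmf_of_set A) (pmf_of_set (samples A m)) = pmf_of_set (A \<times> samples A m)"
  proof (rule pmf_eqI)
    fix z :: "'a \<times> 'a list"
    show "pmf (pair_pmf (pmf_of_set A) (pmf_of_set (samples A m))) z
        = pmf (pmf_of_set (A \<times> samples A m)) z"
      using assms ne finite_samples[of A m]
      by (cases z) (simp add: pmf_pair indicator_def card_cartesian_product)
  qed
  also have "map_pmf (\<lambda>(x, xs). x # xs) \<dots> = pmf_of_set (samples A (Suc m))"
    unfolding samples_Suc
    by (rule map_pmf_of_set_inj) (use assms ne finite_samples in \<open>auto simp: inj_on_def\<close>)
  finally show ?case .
qed

lemma prob_samples:
  assumes "finite A" "A \<noteq> {}"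
  shows "measure_pmf.prob (replicate_pmf m (pmf_of_set A)) E
       = real (card (samples A m \<inter> E)) / real (card A) ^ m"
proof -
  have ne: "samples A m \<noteq> {}"
    using assms by (auto simp: samples_def intro!: exI[of _ "replicate m (SOME x. x \<in> A)"] some_in_eq[THEN iffD2])
  show ?thesis
    using assms ne finite_samples[of A m] unfolding replicate_pmf_of_set[OF assms]
    by (subst measure_pmf_of_set) (auto simp: samples_def card_lists_length_eq)
qed

text \<open>Requirement \<open>i\<close> is met by a list that contains an element of \<open>H i\<close>; a list pays the factor
  \<open>\<rho> i\<close> for every requirement it misses.\<close>

definition occupancy_weight :: "'i set \<Rightarrow> ('i \<Rightarrow> 'a set) \<Rightarrow> ('i \<Rightarrow> real) \<Rightarrow> 'a list \<Rightarrow> real" where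
  "occupancy_weight I H \<rho> xs = (\<Prod>i\<in>I. if set xs \<inter> H i = {} then \<rho> i else 1)"

lemma occupancy_weight_nonneg:
  "(\<And>i. i \<in> I \<Longrightarrow> 0 \<le> \<rho> i) \<Longrightarrow> 0 \<le> occupancy_weight I H \<rho> xs"
  unfolding occupancy_weight_def by (intro prod_nonneg) auto

text \<open>The factor of requirement \<open>i\<close> is 1 minus \<open>1 - \<rho> i\<close> times
  the indicator that \<open>H i\<close> is missed, and the lists missing \<open>H i\<close> are the
  lists over \<open>A - H i\<close>. This is the recursion behind the generating function.\<close>

lemma occupancy_weight_sum_insert:
  assumes "finite A" "finite I" "i \<notin> I"
  shows "(\<Sum>xs\<in>samples A m. occupancy_weight (insert i I) H \<rho> xs)
       = (\<Sum>xs\<in>samples A m. occupancy_weight I H \<rho> xs)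
         - (1 - \<rho> i) * (\<Sum>xs\<in>samples (A - H i) m. occupancy_weight I H \<rho> xs)"
proof -
  have eq: "samples (A - H i) m = {xs \<in> samples A m. set xs \<inter> H i = {}}"
    by (auto simp: samples_def)
  have "(\<Sum>xs\<in>samples (A - H i) m. occupancy_weight I H \<rho> xs)
      = (\<Sum>xs\<in>samples A m. if set xs \<inter> H i = {} then occupancy_weight I H \<rho> xs else 0)"
    unfolding eq by (subst sum.inter_filter) (use assms finite_samples in auto)
  then show ?thesis
    using assms
    by (auto simp: sum_distrib_left simp flip: sum_subtractf intro!: sum.cong
        simp: occupancy_weight_def algebra_simps)
qed

text \<open>Weighting length \<open>m\<close> by \<open>y ^ m / fact m\<close> makes the occurrences
  of different elements independent, as in a Poisson model, so the series factors over the disjoint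
  sets \<open>H i\<close>. The induction varies \<open>A\<close> because the recursion shrinks it to
  \<open>A - H i\<close>; disjointness leaves the other intersections unchanged.\<close>

lemma occupancy_egf:
  fixes y :: real
  assumes "finite I" "finite A" "disjoint_family_on H I"
  shows "(\<lambda>m. (\<Sum>xs\<in>samples A m. occupancy_weight I H \<rho> xs) * y ^ m / fact m) sums
     (exp (y * card A) * (\<Prod>i\<in>I. 1 - (1 - \<rho> i) * exp (- y * card (A \<inter> H i))))"
  using assms
proof (induction I arbitrary: A rule: finite_induct)
  case empty
  have "(\<Sum>xs\<in>samples A m. occupancy_weight {} H \<rho> xs) = real (card A) ^ m" for m
    using empty by (simp add: occupancy_weight_def samples_def card_lists_length_eq)
  then show ?case
    using exp_converges[of "y * card A"]
    by (simp add: power_mult_distrib field_simps)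
next
  case (insert i I)
  have dis: "disjoint_family_on H I" and dis': "\<And>j. j \<in> I \<Longrightarrow> H i \<inter> H j = {}"
    using insert.prems insert.hyps unfolding disjoint_family_on_def by auto
  let ?p = "\<Prod>j\<in>I. 1 - (1 - \<rho> j) * exp (- y * card (A \<inter> H j))"
  have "(\<lambda>m. (\<Sum>xs\<in>samples A m. occupancy_weight I H \<rho> xs) * y ^ m / fact m) sums
     (exp (y * card A) * ?p)"
    using insert.IH insert.prems(1) dis by blast
  moreover have "(\<lambda>m. (\<Sum>xs\<in>samples (A - H i) m. occupancy_weight I H \<rho> xs) * y ^ m / fact m) sums
     (exp (y * card (A - H i)) * (\<Prod>j\<in>I. 1 - (1 - \<rho> j) * exp (- y * card ((A - H i) \<inter> H j))))"
    using insert.IH[of "A - H i"] insert.prems(1) dis by blast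
  moreover have "(A - H i) \<inter> H j = A \<inter> H j" if "j \<in> I" for j
    using dis'[OF that] by blast
  then have "(\<Prod>j\<in>I. 1 - (1 - \<rho> j) * exp (- y * card ((A - H i) \<inter> H j))) = ?p"
    by (intro prod.cong) auto
  ultimately have *: "(\<lambda>m. (\<Sum>xs\<in>samples A m. occupancy_weight I H \<rho> xs) * y ^ m / fact m
      - (1 - \<rho> i) * ((\<Sum>xs\<in>samples (A - H i) m. occupancy_weight I H \<rho> xs) * y ^ m / fact m)) sums
     (exp (y * card A) * ?p - (1 - \<rho> i) * (exp (y * card (A - H i)) * ?p))"
    by (intro sums_diff sums_mult) auto
  have "card (A - H i) = card A - card (A \<inter> H i)"
    using insert.prems(1) by (metis card_Diff_subset_Int finite_Int)
  then have "real (card (A - H i)) = real (card A) - real (card (A \<inter> H i))"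
    using card_mono[of A "A \<inter> H i"] insert.prems(1) by (simp add: of_nat_diff)
  then have e: "exp (y * card (A - H i)) = exp (y * card A) * exp (- y * card (A \<inter> H i))"
    by (simp add: right_diff_distrib flip: exp_add)
  have "(\<Sum>xs\<in>samples A m. occupancy_weight I H \<rho> xs) * y ^ m / fact m
      - (1 - \<rho> i) * ((\<Sum>xs\<in>samples (A - H i) m. occupancy_weight I H \<rho> xs) * y ^ m / fact m)
      = (\<Sum>xs\<in>samples A m. occupancy_weight (insert i I) H \<rho> xs) * y ^ m / fact m" for m
    using occupancy_weight_sum_insert[OF insert.prems(1) insert.hyps, of H \<rho> m]
    by (simp add: left_diff_distrib diff_divide_distrib)
  moreover have "exp (y * card A) * ?p - (1 - \<rho> i) * (exp (y * card (A - H i)) * ?p)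
      = exp (y * card A) * (\<Prod>j\<in>insert i I. 1 - (1 - \<rho> j) * exp (- y * card (A \<inter> H j)))"
    using insert.hyps unfolding e by (simp add: algebra_simps)
  ultimately show ?case using * by simp
qed

text \<open>All terms of the series are nonnegative, so a single one is at most the sum, and
  \<open>y\<close> becomes a free saddle-point parameter. The right-hand side increases with the
  cardinalities, so upper bounds on them may be inserted.\<close>

lemma occupancy_bound:
  fixes y :: real
  assumes "finite I" "finite A" "disjoint_family_on H I" "y > 0"
    and \<rho>: "\<And>i. i \<in> I \<Longrightarrow> 0 \<le> \<rho> i \<and> \<rho> i \<le> 1"
    and h: "\<And>i. i \<in> I \<Longrightarrow> real (card (A \<inter> H i)) \<le> h i"
    and N: "real (card A) \<le> N"
  shows "(\<Sum>xs\<in>samples A m. occupancy_weight I H \<rho> xs)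
     \<le> fact m / y ^ m * (exp (y * N) * (\<Prod>i\<in>I. 1 - (1 - \<rho> i) * exp (- y * h i)))"
proof -
  let ?t = "\<lambda>m. (\<Sum>xs\<in>samples A m. occupancy_weight I H \<rho> xs) * y ^ m / fact m"
  have "0 \<le> occupancy_weight I H \<rho> xs" for xs
    using \<rho> by (intro occupancy_weight_nonneg) auto
  then have "0 \<le> ?t k" for k
    using \<open>y > 0\<close> by (intro divide_nonneg_pos mult_nonneg_nonneg sum_nonneg) auto
  then have "?t m \<le> exp (y * card A) * (\<Prod>i\<in>I. 1 - (1 - \<rho> i) * exp (- y * card (A \<inter> H i)))"
    using sum_le_suminf[of ?t "{m}"] occupancy_egf[OF assms(1-3), of \<rho> y]
    by (auto simp: sums_iff)
  also have "\<dots> \<le> exp (y * N) * (\<Prod>i\<in>I. 1 - (1 - \<rho> i) * exp (- y * h i))"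
  proof (intro mult_mono prod_mono conjI)
    fix i assume i: "i \<in> I"
    have "exp (- y * card (A \<inter> H i)) \<le> 1" using \<open>y > 0\<close> by simp
    then have "(1 - \<rho> i) * exp (- y * card (A \<inter> H i)) \<le> 1 * 1"
      using \<rho>[OF i] by (intro mult_mono) auto
    then show "0 \<le> 1 - (1 - \<rho> i) * exp (- y * card (A \<inter> H i))" by simp
    show "1 - (1 - \<rho> i) * exp (- y * card (A \<inter> H i)) \<le> 1 - (1 - \<rho> i) * exp (- y * h i)"
      using \<rho>[OF i] h[OF i] \<open>y > 0\<close> by (intro diff_left_mono mult_left_mono) auto
  next
    show "0 \<le> (\<Prod>i\<in>I. 1 - (1 - \<rho> i) * exp (- y * card (A \<inter> H i)))"
    proof (intro prod_nonneg ballI)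
      fix i assume i: "i \<in> I"
      have "exp (- y * card (A \<inter> H i)) \<le> 1" using \<open>y > 0\<close> by simp
      then have "(1 - \<rho> i) * exp (- y * card (A \<inter> H i)) \<le> 1 * 1"
        using \<rho>[OF i] by (intro mult_mono) auto
      then show "0 \<le> 1 - (1 - \<rho> i) * exp (- y * card (A \<inter> H i))" by simp
    qed
  qed (use N \<open>y > 0\<close> in auto)
  finally show ?thesis
    using \<open>y > 0\<close> by (simp add: field_simps)
qed

section \<open>Peeling a satisfying assignment\<close>

lemma lit_true_mono: "\<tau> \<subseteq>\<^sub>m \<sigma> \<Longrightarrow> lit_true \<tau> l \<Longrightarrow> lit_true \<sigma> l"
  and lit_false_mono: "\<tau> \<subseteq>\<^sub>m \<sigma> \<Longrightarrow> lit_false \<tau> l \<Longrightarrow> lit_false \<sigma> l"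
  unfolding lit_true_def lit_false_def map_le_def by (metis domI)+

lemma constrained_by_mono: "\<tau> \<subseteq>\<^sub>m \<sigma> \<Longrightarrow> constrained_by \<tau> i c \<Longrightarrow> constrained_by \<sigma> i c"
  unfolding constrained_by_def using lit_true_mono lit_false_mono by blast

lemma unconstrained_mono:
  "\<tau> \<subseteq>\<^sub>m \<sigma> \<Longrightarrow> unconstrained \<phi> \<sigma> i \<Longrightarrow> i \<in> dom \<tau> \<Longrightarrow> unconstrained \<phi> \<tau> i"
  unfolding unconstrained_def using constrained_by_mono by (metis domIff)

text \<open>A clause that becomes invalid contains \<open>i\<close> and has its other two literals
  false. If its literal on \<open>i\<close> was true, the clause constrained \<open>i\<close>; if it
  was false, the clause was invalid before.\<close>

lemma valid_remove_unconstrained: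
  assumes "valid n \<phi> \<sigma>" "unconstrained \<phi> \<sigma> i"
  shows "valid n \<phi> (\<sigma>(i := None))"
proof -
  let ?\<tau> = "\<sigma>(i := None)"
  have le: "?\<tau> \<subseteq>\<^sub>m \<sigma>" by (auto simp: map_le_def)
  have "\<not> invalid_for ?\<tau> c" if c: "c \<in> set \<phi>" for c
  proof
    assume "invalid_for ?\<tau> c"
    moreover have v: "\<not> invalid_for \<sigma> c" using assms(1) c by (auto simp: valid_def)
    moreover have "\<not> (\<forall>l\<in>c. lit_false ?\<tau> l)"
      using v lit_false_mono[OF le] unfolding invalid_for_def by blast
    ultimately obtain l where l: "l \<in> c" "?\<tau> (fst l) = None" "\<And>l'. l' \<in> c - {l} \<Longrightarrow> lit_false \<sigma> l'"
      using lit_false_mono[OF le] unfolding invalid_for_def by blast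
    show False
    proof (cases "fst l = i")
      case True
      from assms(2) obtain b where b: "\<sigma> i = Some b" by (auto simp: unconstrained_def)
      show False
      proof (cases "b = snd l")
        case True
        then have "constrained_by \<sigma> i c"
          using l b \<open>fst l = i\<close> unfolding constrained_by_def lit_true_def by (intro bexI[of _ l]) auto
        then show False using assms(2) c by (auto simp: unconstrained_def)
      next
        case False
        then have "lit_false \<sigma> l" using b \<open>fst l = i\<close> by (auto simp: lit_false_def)
        then show False using v l unfolding invalid_for_def by blast
      qed
    next
      case False
      then show False using v l unfolding invalid_for_def by (metis fun_upd_other)
    qed
  qed
  moreover have "dom ?\<tau> \<subseteq> {..<n}" using assms(1) by (auto simp: valid_def)
  ultimately show ?thesis by (simp add: valid_def)
qed

lemma finite_submaps: "finite (dom \<sigma>) \<Longrightarrow> finite {\<tau>. \<tau> \<subseteq>\<^sub>m \<sigma>}"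
proof -
  assume "finite (dom \<sigma>)"
  moreover have "{\<tau>. \<tau> \<subseteq>\<^sub>m \<sigma>} \<subseteq> (\<lambda>A. \<sigma> |` A) ` Pow (dom \<sigma>)"
  proof clarify
    fix \<tau> assume *: "\<tau> \<subseteq>\<^sub>m \<sigma>"
    then have "\<tau> = \<sigma> |` dom \<tau>" by (auto simp: map_le_def restrict_map_def fun_eq_iff domIff)
    then show "\<tau> \<in> (\<lambda>A. \<sigma> |` A) ` Pow (dom \<sigma>)" using map_le_implies_dom_le[OF *] by blast
  qed
  ultimately show ?thesis by (meson finite_Pow_iff finite_imageI finite_subset)
qed

text \<open>Ask the variables outside \<open>K\<close>, whenever one is unconstrained, whether to keep it
  (probability \<open>\<rho>\<close>) or to unassign it. The weight of \<open>\<tau>\<close> is at least the probability that this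
  process ends in \<open>\<tau>\<close>.\<close>

lemma sum_peeling_weights_ge_1:
  assumes "valid n \<phi> \<sigma>" "K \<subseteq> dom \<sigma>" "0 \<le> \<rho>" "\<rho> \<le> 1"
  shows "1 \<le> (\<Sum>\<tau> | valid n \<phi> \<tau> \<and> \<tau> \<subseteq>\<^sub>m \<sigma> \<and> K \<subseteq> dom \<tau>.
                \<rho> ^ card ({i. unconstrained \<phi> \<tau> i} - K) * (1 - \<rho> :: real) ^ card (dom \<sigma> - dom \<tau>))"
  using assms(1,2)
proof (induction "card (dom \<sigma> - K)" arbitrary: \<sigma> K rule: less_induct)
  case less
  define V where "V = (\<lambda>K \<sigma>. {\<tau>. valid n \<phi> \<tau> \<and> \<tau> \<subseteq>\<^sub>m \<sigma> \<and> K \<subseteq> dom \<tau>})"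
  define w where "w = (\<lambda>K (\<sigma>::passign) \<tau>. \<rho> ^ card ({i. unconstrained \<phi> \<tau> i} - K) * (1 - \<rho>) ^ card (dom \<sigma> - dom \<tau>))"
  have fin: "finite (dom \<sigma>)" using less.prems(1) by (auto simp: valid_def dest: finite_subset)
  have finV: "finite (V K \<sigma>)" for K
    unfolding V_def by (rule finite_subset[OF _ finite_submaps[OF fin]]) auto
  have finu: "finite {i. unconstrained \<phi> \<tau> i}" if "\<tau> \<subseteq>\<^sub>m \<sigma>" for \<tau>
    by (rule finite_subset[OF _ finite_subset[OF map_le_implies_dom_le[OF that] fin]])
      (auto simp: unconstrained_def)
  have w0: "0 \<le> w K \<sigma> \<tau>" for K \<sigma> \<tau> unfolding w_def using assms(3,4) by simp
  have "1 \<le> sum (w K \<sigma>) (V K \<sigma>)"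
  proof (cases "\<exists>i. unconstrained \<phi> \<sigma> i \<and> i \<notin> K")
    case False
    \<comment> \<open>Nothing is left to ask, so both exponents of \<open>\<sigma>\<close> itself
      vanish.\<close>
    then have "w K \<sigma> \<sigma> = 1" by (simp add: w_def Diff_eq_empty_iff[THEN iffD2] subset_iff)
    moreover have "\<sigma> \<in> V K \<sigma>" using less.prems by (simp add: V_def)
    ultimately show ?thesis using member_le_sum[of \<sigma> "V K \<sigma>" "w K \<sigma>"] w0 finV by auto
  next
    case True
    then obtain i where i: "unconstrained \<phi> \<sigma> i" "i \<notin> K" by blast
    let ?\<sigma>' = "\<sigma>(i := None)" and ?K' = "insert i K"
    have idom: "i \<in> dom \<sigma>" using i by (auto simp: unconstrained_def)
    have le: "?\<sigma>' \<subseteq>\<^sub>m \<sigma>" by (auto simp: map_le_def)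
    have "card (dom \<sigma> - ?K') < card (dom \<sigma> - K)"
      using fin i idom by (intro psubset_card_mono) auto
    \<comment> \<open>The branch in which \<open>i\<close> is kept: \<open>i\<close> joins
      \<open>K\<close>. It stays unconstrained in every smaller assignment that still assigns it,
      which is where \<open>kept\<close> recovers the factor \<open>\<rho>\<close>.\<close>
    then have 1: "1 \<le> sum (w ?K' \<sigma>) (V ?K' \<sigma>)"
      using less.hyps[of \<sigma> ?K'] less.prems idom unfolding w_def V_def by simp
    have "card (dom ?\<sigma>' - K) < card (dom \<sigma> - K)"
      using fin i idom by (intro psubset_card_mono) auto
    moreover have "valid n \<phi> ?\<sigma>'"
      by (rule valid_remove_unconstrained) (use less.prems i in auto)
    moreover have "K \<subseteq> dom ?\<sigma>'" using less.prems i by auto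
    ultimately have 2: "1 \<le> sum (w K ?\<sigma>') (V K ?\<sigma>')"
      using less.hyps[of ?\<sigma>' K] unfolding w_def V_def by simp
    have kept: "w K \<sigma> \<tau> = \<rho> * w ?K' \<sigma> \<tau>" if "\<tau> \<in> V ?K' \<sigma>" for \<tau>
    proof -
      have le\<tau>: "\<tau> \<subseteq>\<^sub>m \<sigma>" and "i \<in> dom \<tau>" using that by (auto simp: V_def)
      then have "unconstrained \<phi> \<tau> i" using i unconstrained_mono by blast
      then have "{j. unconstrained \<phi> \<tau> j} - K = insert i ({j. unconstrained \<phi> \<tau> j} - ?K')"
        using i by auto
      then have "card ({j. unconstrained \<phi> \<tau> j} - K) = Suc (card ({j. unconstrained \<phi> \<tau> j} - ?K'))"
        using finu[OF le\<tau>] by (metis card_insert_disjoint finite_Diff Diff_iff insertI1)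
      then show ?thesis by (simp add: w_def)
    qed
    have removed: "w K \<sigma> \<tau> = (1 - \<rho>) * w K ?\<sigma>' \<tau>" if "\<tau> \<in> V K ?\<sigma>'" for \<tau>
    proof -
      have "\<tau> \<subseteq>\<^sub>m ?\<sigma>'" using that by (auto simp: V_def)
      then have "i \<notin> dom \<tau>" by (auto dest!: map_le_implies_dom_le)
      then have "dom \<sigma> - dom \<tau> = insert i (dom ?\<sigma>' - dom \<tau>)" using idom by auto
      moreover have "finite (dom ?\<sigma>' - dom \<tau>)" "i \<notin> dom ?\<sigma>' - dom \<tau>" using fin by auto
      ultimately have "card (dom \<sigma> - dom \<tau>) = Suc (card (dom ?\<sigma>' - dom \<tau>))"
        by (metis card_insert_disjoint)
      then show ?thesis by (simp add: w_def)
    qed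
    have sub: "V ?K' \<sigma> \<union> V K ?\<sigma>' \<subseteq> V K \<sigma>"
      using le by (auto simp: V_def intro: map_le_trans)
    have dis: "V ?K' \<sigma> \<inter> V K ?\<sigma>' = {}"
      by (auto simp: V_def dest!: map_le_implies_dom_le)
    have fin2: "finite (V ?K' \<sigma>)" "finite (V K ?\<sigma>')"
      using finite_subset[OF sub finV] by auto
    have "1 \<le> \<rho> * sum (w ?K' \<sigma>) (V ?K' \<sigma>) + (1 - \<rho>) * sum (w K ?\<sigma>') (V K ?\<sigma>')"
      using mult_left_mono[OF 1 assms(3)] mult_left_mono[OF 2, of "1 - \<rho>"] assms(4) by simp
    also have "\<dots> = sum (w K \<sigma>) (V ?K' \<sigma>) + sum (w K \<sigma>) (V K ?\<sigma>')"
      using kept removed by (simp add: sum_distrib_left)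
    also have "\<dots> = sum (w K \<sigma>) (V ?K' \<sigma> \<union> V K ?\<sigma>')"
      by (rule sum.union_disjoint[symmetric]) (use dis fin2 in auto)
    also have "\<dots> \<le> sum (w K \<sigma>) (V K \<sigma>)"
      by (rule sum_mono2) (use sub finV w0 in auto)
    finally show ?thesis .
  qed
  then show ?case by (simp add: w_def V_def)
qed

lemma satisfying_imp_valid: "satisfying n \<phi> \<sigma> \<Longrightarrow> valid n \<phi> \<sigma>"
proof -
  assume s: "satisfying n \<phi> \<sigma>"
  have "\<not> invalid_for \<sigma> c" if "c \<in> set \<phi>" for c
  proof -
    obtain l where "l \<in> c" "lit_true \<sigma> l" using s \<open>c \<in> set \<phi>\<close> unfolding satisfying_def by blast
    then show ?thesis unfolding invalid_for_def lit_true_def lit_false_def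
      by (metis Diff_iff option.distinct(1) option.inject singletonD)
  qed
  then show ?thesis using s by (auto simp: valid_def satisfying_def)
qed

lemma path_map_le: "(edge n \<phi>)\<^sup>*\<^sup>* \<sigma> \<tau> \<Longrightarrow> \<tau> \<subseteq>\<^sub>m \<sigma>"
proof (induction rule: rtranclp_induct)
  case (step \<tau> \<tau>')
  have "\<tau>' \<subseteq>\<^sub>m \<tau>" using step.hyps(2) unfolding edge_def map_le_def by (metis domIff)
  then show ?case using step.IH map_le_trans by blast
qed simp

text \<open>The path makes the core a restriction of the satisfying assignment, so the core is
  encoded by its domain \<open>S\<close>. All pairs are counted in this encoding.\<close>

lemma has_nontrivial_coreD:
  assumes "has_nontrivial_core n \<phi>"
  obtains \<sigma> S where "dom \<sigma> = {..<n}" "valid n \<phi> \<sigma>" "S \<subseteq> {..<n}" "S \<noteq> {}" "minimal n \<phi> (\<sigma> |` S)"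
proof -
  from assms obtain \<sigma> \<tau> where *: "satisfying n \<phi> \<sigma>" "minimal n \<phi> \<tau>" "\<tau> \<subseteq>\<^sub>m \<sigma>" "nontrivial n \<tau>"
    unfolding has_nontrivial_core_def core_of_def using path_map_le by blast
  have "\<tau> = \<sigma> |` dom \<tau>" using *(3) by (auto simp: map_le_def restrict_map_def fun_eq_iff domIff)
  moreover have "dom \<sigma> = {..<n}" using *(1) by (simp add: satisfying_def)
  moreover have "dom \<tau> \<subseteq> {..<n}" using *(3) \<open>dom \<sigma> = {..<n}\<close> map_le_implies_dom_le by metis
  moreover have "dom \<tau> \<noteq> {}" using *(4) by (auto simp: nontrivial_def)
  ultimately show thesis using that[of \<sigma> "dom \<tau>"] *(1,2) satisfying_imp_valid by metis
qed

section \<open>Counting clauses\<close>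

text \<open>A clause is coded by its set \<open>T\<close> of three variables and the subset
  \<open>U\<close> of those occurring positively.\<close>

lemma card_clauses: "card (clauses n) = 8 * (n choose 3)"
proof -
  let ?D = "Sigma {T. T \<subseteq> {..<n} \<and> card T = 3} Pow"
  let ?f = "\<lambda>(T, U). (\<lambda>i. (i, i \<in> U)) ` T"
  have "inj_on ?f ?D"
  proof (rule inj_onI)
    fix p q assume pq: "p \<in> ?D" "q \<in> ?D" "?f p = ?f q"
    obtain T U T' U' where p: "p = (T, U)" and q: "q = (T', U')" by (meson surj_pair)
    have *: "U \<in> Pow T" "U' \<in> Pow T'" "(\<lambda>i. (i, i \<in> U)) ` T = (\<lambda>i. (i, i \<in> U')) ` T'"
      using pq by (auto simp: p q)
    then have "fst ` (\<lambda>i. (i, i \<in> U)) ` T = fst ` (\<lambda>i. (i, i \<in> U')) ` T'" by simp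
    then have T: "T = T'" by (simp add: image_image)
    moreover have "U = U'"
    proof (rule set_eqI)
      fix i show "i \<in> U \<longleftrightarrow> i \<in> U'"
        using *(1,2) T arg_cong[OF *(3), of "\<lambda>c. (i, True) \<in> c"] by auto
    qed
    ultimately show "p = q" unfolding p q by blast
  qed
  then have "card (?f ` ?D) = card ?D" by (rule card_image)
  also have "?f ` ?D = clauses n"
  proof (intro equalityI subsetI)
    fix c assume "c \<in> ?f ` ?D"
    then show "c \<in> clauses n"
      by (auto simp: clauses_def card_image inj_on_def)
  next
    fix c assume "c \<in> clauses n"
    then have c: "c \<subseteq> {..<n} \<times> UNIV" "card c = 3" "inj_on fst c" by (auto simp: clauses_def)
    have eq: "c = (\<lambda>i. (i, i \<in> {i. (i, True) \<in> c})) ` fst ` c"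
    proof (rule set_eqI, clarify)
      fix i b
      have "\<not> ((i, True) \<in> c \<and> (i, False) \<in> c)"
        using c(3) by (metis fst_conv inj_onD prod.inject)
      moreover have "(i, b) \<in> (\<lambda>i. (i, i \<in> {i. (i, True) \<in> c})) ` fst ` c
          \<longleftrightarrow> (\<exists>b'. (i, b') \<in> c) \<and> b = ((i, True) \<in> c)"
        by (auto simp: image_iff Bex_def)
      ultimately show "(i, b) \<in> c \<longleftrightarrow> (i, b) \<in> (\<lambda>i. (i, i \<in> {i. (i, True) \<in> c})) ` fst ` c"
        unfolding ex_bool_eq by (cases b) auto
    qed
    have mem: "(fst ` c, {i. (i, True) \<in> c}) \<in> ?D"
      using c by (force simp: card_image)
    show "c \<in> ?f ` ?D"
      by (rule image_eqI[OF _ mem]) (unfold case_prod_conv, rule eq)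
  qed
  finally have "card (clauses n) = card ?D" .
  also have "\<dots> = (\<Sum>T | T \<subseteq> {..<n} \<and> card T = 3. card (Pow T))"
  proof (rule card_SigmaI)
    show "finite {T. T \<subseteq> {..<n} \<and> card T = 3}" by (rule finite_subset[of _ "Pow {..<n}"]) auto
  qed (auto dest: finite_subset[OF _ finite_lessThan])
  also have "\<dots> = (\<Sum>T | T \<subseteq> {..<n} \<and> card T = 3. 8)"
    by (intro sum.cong refl) (auto simp: card_Pow dest: finite_subset[OF _ finite_lessThan])
  also have "\<dots> = 8 * (n choose 3)"
    by (simp add: n_subsets)
  finally show ?thesis .
qed

lemma finite_clauses: "finite (clauses n)"
  by (rule finite_subset[of _ "Pow ({..<n} \<times> UNIV)"]) (auto simp: clauses_def)

definition pair_clauses :: "nat \<Rightarrow> nat set \<Rightarrow> passign \<Rightarrow> clause set" where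
  "pair_clauses n S \<sigma> = {c \<in> clauses n. \<not> invalid_for (\<sigma> |` S) c \<and> \<not> invalid_for \<sigma> c}"

text \<open>Core variables have to be constrained within the core, the others only within the larger
  assignment. These are the sets \<open>H i\<close> of the occupancy problem, whose alphabet is
  \<open>pair_clauses\<close>.\<close>

definition constraining :: "nat set \<Rightarrow> passign \<Rightarrow> nat \<Rightarrow> clause set" where
  "constraining S \<sigma> i = {c. constrained_by (if i \<in> S then \<sigma> |` S else \<sigma>) i c}"

lemma finite_pair_clauses: "finite (pair_clauses n S \<sigma>)"
  using finite_clauses by (simp add: pair_clauses_def)

lemma constrained_by_unique: "constrained_by \<sigma> i c \<Longrightarrow> constrained_by \<sigma> j c \<Longrightarrow> i = j"
  unfolding constrained_by_def lit_true_def lit_false_def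
  by (metis Diff_iff option.inject singletonD)

lemma restrict_map_le: "\<sigma> |` S \<subseteq>\<^sub>m \<sigma>"
  by (auto simp: map_le_def restrict_map_def)

text \<open>In a constraining clause the constrained variable carries the only true literal, so no
  clause constrains two variables; monotonicity moves the core case to
  \<open>\<sigma>\<close>.\<close>

lemma disjoint_constraining: "disjoint_family_on (constraining S \<sigma>) I"
proof -
  have "constrained_by \<sigma> i c" if "c \<in> constraining S \<sigma> i" for i c
    using that constrained_by_mono[OF restrict_map_le]
    by (auto simp: constraining_def split: if_splits)
  then show ?thesis using constrained_by_unique unfolding disjoint_family_on_def by blast
qed

definition false_lit :: "passign \<Rightarrow> nat \<Rightarrow> literal" where
  "false_lit \<sigma> i = (i, \<not> the (\<sigma> i))"

lemma inj_false_lit: "inj_on (false_lit \<sigma>) A"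
  by (auto simp: false_lit_def inj_on_def)

lemma lit_false_iff: "lit_false \<sigma> l \<longleftrightarrow> l \<in> false_lit \<sigma> ` dom \<sigma>"
  by (cases l) (auto simp: lit_false_def false_lit_def image_iff)

lemma lit_false_restrict: "lit_false (\<sigma> |` S) l \<longleftrightarrow> l \<in> false_lit \<sigma> ` (dom \<sigma> \<inter> S)"
  unfolding lit_false_iff by (auto simp: false_lit_def)

text \<open>Intersecting \<open>insert l K\<close> with \<open>F\<close> recovers \<open>K\<close>,
  and removing \<open>F\<close> recovers \<open>l\<close>.\<close>

lemma card_insert_image:
  assumes "finite P" "\<And>K l. (K, l) \<in> P \<Longrightarrow> K \<subseteq> F \<and> l \<notin> F"
  shows "card ((\<lambda>(K, l). insert l K) ` P) = card P"
proof (intro card_image inj_onI)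
  fix p q assume pq: "p \<in> P" "q \<in> P" "(\<lambda>(K, l). insert l K) p = (\<lambda>(K, l). insert l K) q"
  obtain K l K' l' where p: "p = (K, l)" and q: "q = (K', l')" by (meson surj_pair)
  have *: "(K, l) \<in> P" "(K', l') \<in> P" "insert l K = insert l' K'" using pq by (auto simp: p q)
  have **: "insert l K \<inter> F = K" "insert l' K' \<inter> F = K'" "insert l K - F = {l}" "insert l' K' - F = {l'}"
    using assms(2)[OF *(1)] assms(2)[OF *(2)] by auto
  have "K = K'" using **(1,2) by (simp add: *(3))
  moreover have "{l} = {l'}" using **(3,4) unfolding *(3) by (rule trans[OF sym])
  ultimately show "p = q" unfolding p q by blast
qed

text \<open>Three disjoint families of clauses are forbidden: three false literals
  (\<open>C1\<close>), two false literals and either literal on an unassigned variable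
  (\<open>P1\<close>), and two false core literals with a true literal on a variable outside the
  core (\<open>P2\<close>). The last is invalid for the restriction to \<open>S\<close>; with a
  false third literal the clause would already lie in \<open>C1\<close>.\<close>

lemma card_pair_clauses:
  assumes B: "dom \<sigma> \<subseteq> {..<n}" and S: "S \<subseteq> dom \<sigma>"
  defines "b \<equiv> card (dom \<sigma>)" and "s \<equiv> card S"
  shows "card (pair_clauses n S \<sigma>)
     + ((b choose 3) + (b choose 2) * (2 * (n - b)) + (s choose 2) * (b - s)) \<le> card (clauses n)"
proof -
  define F where "F = false_lit \<sigma> ` dom \<sigma>"
  define G where "G = false_lit \<sigma> ` S"
  define T where "T = (\<lambda>i. (i, the (\<sigma> i))) ` (dom \<sigma> - S)"
  define P1 where "P1 = {K. K \<subseteq> F \<and> card K = 2} \<times> (({..<n} - dom \<sigma>) \<times> (UNIV :: bool set))"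
  define P2 where "P2 = {K. K \<subseteq> G \<and> card K = 2} \<times> T"
  define C1 where "C1 = {c. c \<subseteq> F \<and> card c = 3}"
  define C2 where "C2 = (\<lambda>(K, l). insert l K) ` (P1 \<union> P2)"
  have fin: "finite (dom \<sigma>)" by (rule finite_subset[OF B]) simp
  have finS: "finite S" by (rule finite_subset[OF S fin])
  have finF: "finite F" "finite G" "finite T" using fin finS by (auto simp: F_def G_def T_def)
  have GF: "G \<subseteq> F" using S by (auto simp: F_def G_def)
  have cF: "card F = b" and cG: "card G = s" by (simp_all add: F_def G_def b_def s_def card_image inj_false_lit)
  have cT: "card T = b - s"
    using fin finS S by (simp add: T_def b_def s_def card_image inj_on_def card_Diff_subset)
  have finP: "finite P1" "finite P2"
    using finF by (auto simp: P1_def P2_def intro!: finite_cartesian_product finite_subset[of _ "Pow F"] finite_subset[of _ "Pow G"])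
  have notF: "l \<notin> F" if "fst l \<notin> dom \<sigma> \<or> l \<in> T" for l
    using that by (auto simp: F_def T_def false_lit_def)
  have P: "K \<subseteq> F \<and> l \<notin> F" if "(K, l) \<in> P1 \<union> P2" for K l
    using that GF notF[of l] unfolding P1_def P2_def by (cases l) auto
  have "card (P1 \<union> P2) = card P1 + card P2"
    using finP by (intro card_Un_disjoint) (auto simp: P1_def P2_def T_def)
  also have "card P1 = (b choose 2) * (2 * (n - b))"
    using finF B fin by (simp add: P1_def card_cartesian_product n_subsets cF card_Diff_subset b_def)
  also have "card P2 = (s choose 2) * (b - s)"
    using finF by (simp add: P2_def card_cartesian_product n_subsets cG cT)
  finally have cC2: "card C2 = (b choose 2) * (2 * (n - b)) + (s choose 2) * (b - s)"
    unfolding C2_def using card_insert_image[of "P1 \<union> P2" F] finP P by simp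
  have cC1: "card C1 = b choose 3" using finF by (simp add: C1_def n_subsets cF)
  have fC: "finite C1" "finite C2" using finF finP by (auto simp: C1_def C2_def)
  have C2E: thesis if "c \<in> C2" "\<And>K l. (K, l) \<in> P1 \<union> P2 \<Longrightarrow> c = insert l K \<Longrightarrow> thesis" for c thesis
    using that(1) unfolding C2_def
  proof (rule imageE)
    fix p assume p: "c = (\<lambda>(K, l). insert l K) p" "p \<in> P1 \<union> P2"
    show thesis by (rule that(2)[of "fst p" "snd p"]) (use p in \<open>simp_all add: case_prod_beta\<close>)
  qed
  have "\<not> c \<subseteq> F" if "c \<in> C2" for c
  proof -
    obtain K l where Kl: "(K, l) \<in> P1 \<union> P2" and c: "c = insert l K"
      using C2E[OF \<open>c \<in> C2\<close>] by metis
    show ?thesis using P[OF Kl] c by auto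
  qed
  then have "C1 \<inter> C2 = {}" by (auto simp: C1_def)
  then have cU: "card (C1 \<union> C2) = (b choose 3) + (b choose 2) * (2 * (n - b)) + (s choose 2) * (b - s)"
    using fC cC1 cC2 by (simp add: card_Un_disjoint)
  have Fn: "F \<subseteq> {..<n} \<times> UNIV" using B by (auto simp: F_def false_lit_def)
  have injF: "inj_on fst F" by (auto simp: F_def false_lit_def inj_on_def)
  have bad1: "c \<in> clauses n \<and> invalid_for \<sigma> c" if "c \<in> C1" for c
  proof -
    have c: "c \<subseteq> F" "card c = 3" using that by (auto simp: C1_def)
    have "c \<in> clauses n"
      using c inj_on_subset[OF injF c(1)] subset_trans[OF c(1) Fn] by (simp add: clauses_def)
    moreover have "\<forall>l\<in>c. lit_false \<sigma> l" using c(1) by (auto simp: lit_false_iff F_def)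
    ultimately show ?thesis by (simp add: invalid_for_def)
  qed
  have bad2: "c \<in> clauses n \<and> (invalid_for \<sigma> c \<or> invalid_for (\<sigma> |` S) c)" if "c \<in> C2" for c
  proof -
    obtain K l where Kl: "(K, l) \<in> P1 \<union> P2" and c: "c = insert l K"
      using C2E[OF \<open>c \<in> C2\<close>] by metis
    have KF: "K \<subseteq> F" "l \<notin> F" using P[OF Kl] by auto
    have "finite K" using KF finF finite_subset by blast
    moreover have "card K = 2" using Kl by (auto simp: P1_def P2_def)
    moreover have "l \<notin> K" using KF by blast
    ultimately have "card c = 3" by (simp add: c)
    moreover have "fst l < n" using Kl B by (auto simp: P1_def P2_def T_def)
    then have "c \<subseteq> {..<n} \<times> UNIV" using KF Fn c by (cases l) auto
    moreover have "fst l \<notin> fst ` K"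
      using Kl KF by (auto simp: P1_def P2_def T_def G_def F_def false_lit_def)
    then have "inj_on fst c" using inj_on_subset[OF injF KF(1)] c by auto
    ultimately have "c \<in> clauses n" by (simp add: clauses_def)
    moreover have cl: "c - {l} = K" using c KF by auto
    moreover have "invalid_for \<sigma> c" if "(K, l) \<in> P1"
      using that cl c KF by (auto simp: invalid_for_def lit_false_iff F_def P1_def)
    moreover have "invalid_for (\<sigma> |` S) c" if "(K, l) \<in> P2"
    proof -
      have "K \<subseteq> G" "l \<in> T" using that by (auto simp: P2_def)
      then have "\<forall>l'\<in>K. lit_false (\<sigma> |` S) l'" using S by (auto simp: lit_false_restrict Int_absorb1[OF S] G_def)
      moreover have "(\<sigma> |` S) (fst l) = None" using \<open>l \<in> T\<close> by (auto simp: T_def)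
      ultimately show ?thesis using cl c unfolding invalid_for_def by blast
    qed
    ultimately show ?thesis using Kl by blast
  qed
  have "pair_clauses n S \<sigma> \<inter> (C1 \<union> C2) = {}"
    using bad1 bad2 by (auto simp: pair_clauses_def)
  then have "card (pair_clauses n S \<sigma>) + card (C1 \<union> C2) = card (pair_clauses n S \<sigma> \<union> (C1 \<union> C2))"
    using fC finite_pair_clauses by (simp add: card_Un_disjoint)
  also have "\<dots> \<le> card (clauses n)"
    by (rule card_mono[OF finite_clauses]) (use bad1 bad2 in \<open>auto simp: pair_clauses_def\<close>)
  finally show ?thesis unfolding cU .
qed

text \<open>The true literal is determined by \<open>i\<close>, so the pair of false literals
  determines the clause. For \<open>i\<close> outside the core, a pair within the core would make
  the clause invalid for the restriction; this is the subtracted binomial.\<close>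

lemma card_constraining:
  assumes B: "dom \<sigma> \<subseteq> {..<n}" and S: "S \<subseteq> dom \<sigma>" and i: "i \<in> dom \<sigma>"
  shows "card (pair_clauses n S \<sigma> \<inter> constraining S \<sigma> i)
     \<le> (if i \<in> S then (card S - 1) choose 2 else ((card (dom \<sigma>) - 1) choose 2) - (card S choose 2))"
proof -
  have fin: "finite (dom \<sigma>)" by (rule finite_subset[OF B]) simp
  have finS: "finite S" by (rule finite_subset[OF S fin])
  let ?l = "(i, the (\<sigma> i))"
  define U where "U = (if i \<in> S then S else dom \<sigma>) - {i}"
  define X where "X = {K. K \<subseteq> false_lit \<sigma> ` U \<and> card K = 2 \<and> (i \<in> S \<or> \<not> K \<subseteq> false_lit \<sigma> ` S)}"
  have finU: "finite (false_lit \<sigma> ` U)" using fin finS by (auto simp: U_def)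
  have finX: "finite X"
    by (rule finite_subset[of _ "Pow (false_lit \<sigma> ` U)"]) (use finU in \<open>auto simp: X_def\<close>)
  have "pair_clauses n S \<sigma> \<inter> constraining S \<sigma> i \<subseteq> insert ?l ` X"
  proof
    fix c assume c: "c \<in> pair_clauses n S \<sigma> \<inter> constraining S \<sigma> i"
    define \<tau> where "\<tau> = (if i \<in> S then \<sigma> |` S else \<sigma>)"
    from c have cl: "card c = 3" "inj_on fst c" "\<not> invalid_for (\<sigma> |` S) c"
      by (auto simp: pair_clauses_def clauses_def)
    from c have "constrained_by \<tau> i c" by (auto simp: constraining_def \<tau>_def)
    then obtain l where l: "l \<in> c" "fst l = i" "lit_true \<tau> l" "\<forall>l'\<in>c - {l}. lit_false \<tau> l'"
      by (auto simp: constrained_by_def)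
    have "lit_true \<sigma> l" using l(3) lit_true_mono[OF restrict_map_le] by (auto simp: \<tau>_def split: if_splits)
    then have ll: "l = ?l" using l(2) by (cases l) (auto simp: lit_true_def)
    have fl: "l' \<in> false_lit \<sigma> ` U" if "l' \<in> c - {l}" for l'
    proof -
      have "fst l' \<noteq> i" using that l cl(2) by (metis Diff_iff inj_onD singletonI)
      moreover have "l' \<in> false_lit \<sigma> ` (if i \<in> S then S else dom \<sigma>)"
        using bspec[OF l(4) that] Int_absorb1[OF S]
        by (cases "i \<in> S") (simp_all add: \<tau>_def lit_false_restrict, simp add: lit_false_iff)
      ultimately show ?thesis by (auto simp: U_def false_lit_def)
    qed
    have "c - {l} \<in> X"
    proof -
      have "\<not> c - {l} \<subseteq> false_lit \<sigma> ` S" if "i \<notin> S"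
      proof
        assume "c - {l} \<subseteq> false_lit \<sigma> ` S"
        then have "\<forall>l'\<in>c - {l}. lit_false (\<sigma> |` S) l'" using S by (auto simp: lit_false_restrict Int_absorb1[OF S])
        moreover have "(\<sigma> |` S) (fst l) = None" using that l(2) by auto
        ultimately show False using cl(3) l(1) unfolding invalid_for_def by blast
      qed
      moreover have "card (c - {l}) = 2" using cl(1) l(1) by simp
      ultimately show ?thesis using fl by (auto simp: X_def)
    qed
    moreover have "c = insert ?l (c - {l})" using l(1) ll by auto
    ultimately show "c \<in> insert ?l ` X" by blast
  qed
  then have "card (pair_clauses n S \<sigma> \<inter> constraining S \<sigma> i) \<le> card X"
    using finX by (meson card_image_le card_mono finite_imageI le_trans)
  also have "card X \<le> (if i \<in> S then (card S - 1) choose 2 else ((card (dom \<sigma>) - 1) choose 2) - (card S choose 2))"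
  proof (cases "i \<in> S")
    case True
    then have "card X = card {K. K \<subseteq> false_lit \<sigma> ` U \<and> card K = 2}" by (simp add: X_def)
    also have "\<dots> = (card S - 1) choose 2"
      using finU fin finS True by (simp add: n_subsets card_image inj_false_lit U_def)
    finally show ?thesis using True by simp
  next
    case False
    have sub: "false_lit \<sigma> ` S \<subseteq> false_lit \<sigma> ` U" using False S by (auto simp: U_def)
    have "X = {K. K \<subseteq> false_lit \<sigma> ` U \<and> card K = 2} - {K. K \<subseteq> false_lit \<sigma> ` S \<and> card K = 2}"
      using False by (auto simp: X_def)
    moreover have "finite {K. K \<subseteq> false_lit \<sigma> ` S \<and> card K = 2}"
      by (rule finite_subset[of _ "Pow (false_lit \<sigma> ` S)"]) (use finS in auto)
    moreover have "{K. K \<subseteq> false_lit \<sigma> ` S \<and> card K = 2} \<subseteq> {K. K \<subseteq> false_lit \<sigma> ` U \<and> card K = 2}"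
      using sub by blast
    ultimately have "card X = card {K. K \<subseteq> false_lit \<sigma> ` U \<and> card K = 2} - card {K. K \<subseteq> false_lit \<sigma> ` S \<and> card K = 2}"
      by (simp only: card_Diff_subset)
    also have "\<dots> = ((card (dom \<sigma>) - 1) choose 2) - (card S choose 2)"
      using finU fin finS False i by (simp add: n_subsets card_image inj_false_lit U_def)
    finally show ?thesis using False by simp
  qed
  finally show ?thesis .
qed

section \<open>First moments\<close>

lemma real_choose_2: "real (k choose 2) = real k * (real k - 1) / 2"
  by (induction k) (simp_all add: numeral_2_eq_2 field_simps)

lemma real_choose_3: "real (k choose 3) = real k * (real k - 1) * (real k - 2) / 6"
proof (induction k)
  case (Suc k)
  have "real (Suc k choose 3) = real (k choose 2) + real (k choose 3)"
    by (simp add: numeral_3_eq_3 numeral_2_eq_2)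
  then show ?case by (simp add: Suc.IH real_choose_2 field_simps)
qed simp

text \<open>Limit densities: \<open>a\<close> and \<open>a + d\<close> are the fractions of variables assigned by the smaller and
  by the larger partial assignment, and \<open>bad_density\<close> is the probability that a clause is invalid
  for one of them.\<close>

definition bad_density :: "real \<Rightarrow> real \<Rightarrow> real" where
  "bad_density a d = 3 / 4 * ((a + d) ^ 3 / 6 + (a + d) ^ 2 * (1 - a - d) + a ^ 2 * d / 2)"

text \<open>The occupancy bound with parameter \<open>3 * y / (4 * n ^ 2)\<close>. Since there are
  about \<open>4 / 3 * n ^ 3\<close> clauses, \<open>y\<close> takes the place of the clause
  density. The summand \<open>y\<close> in the exponent absorbs the lower-order part of the clause
  count.\<close>

definition pair_bound :: "nat \<Rightarrow> nat \<Rightarrow> real \<Rightarrow> real \<Rightarrow> nat \<Rightarrow> nat \<Rightarrow> real" where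
  "pair_bound n m y \<rho> s d =
     fact m / (3 * y / (4 * real n ^ 2)) ^ m * (exp (y * n * (1 - bad_density (s / n) (d / n)) + y)
     * ((1 - exp (- (3 / 8 * y * (s / n) ^ 2))) ^ s
     * (1 - (1 - \<rho>) * exp (- (3 / 8 * y * ((s / n + d / n) ^ 2 - (s / n) ^ 2)))) ^ d))"

text \<open>Falling factorials are replaced by powers. In the forbidden clauses this loses at most
  \<open>b * b / 2 + b * (N - b) + x * z / 2\<close>, which is below \<open>N ^ 2\<close>.\<close>

lemma real_card_pair_clauses:
  assumes B: "dom \<sigma> \<subseteq> {..<n}" and S: "S \<subseteq> dom \<sigma>" and "n > 0"
    and s: "card S = s" and sd: "card (dom \<sigma>) = s + d"
  shows "real (card (pair_clauses n S \<sigma>))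
    \<le> 4 / 3 * real n ^ 3 * (1 - bad_density (s / n) (d / n)) + real n ^ 2"
proof -
  define x where "x = real s"
  define z where "z = real d"
  define b where "b = x + z"
  define N where "N = real n"
  have bn: "s + d \<le> n" using card_mono[OF finite_lessThan B] sd by simp
  have le: "0 \<le> x" "0 \<le> z" "b \<le> N" "N > 0" using bn \<open>n > 0\<close> by (auto simp: x_def z_def b_def N_def)
  have "real (card (pair_clauses n S \<sigma>)) + (real ((s + d) choose 3) + real ((s + d) choose 2) * (2 * real (n - (s + d)))
      + real (s choose 2) * real d) \<le> 8 * real (n choose 3)"
    using card_pair_clauses[OF B S, unfolded sd s card_clauses]
    unfolding of_nat_add[symmetric] of_nat_mult[symmetric] of_nat_numeral[symmetric, where ?'a=real]
    by (simp only: of_nat_le_iff) simp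
  moreover have nb: "real (n - (s + d)) = N - b" using bn by (simp add: of_nat_diff N_def b_def x_def z_def)
  moreover have "real (s + d) = b" by (simp add: b_def x_def z_def)
  ultimately have "real (card (pair_clauses n S \<sigma>)) + (b * (b - 1) * (b - 2) / 6
      + b * (b - 1) / 2 * (2 * (N - b)) + x * (x - 1) / 2 * z) \<le> 8 * (N * (N - 1) * (N - 2) / 6)"
    by (simp only: real_choose_2 real_choose_3 x_def z_def N_def)
  moreover have "b * (b - 1) / 2 * (2 * (N - b)) = b * (b - 1) * (N - b)" by simp
  ultimately have *: "real (card (pair_clauses n S \<sigma>))
      \<le> 4 / 3 * (N * (N - 1) * (N - 2)) - (b * (b - 1) * (b - 2) / 6 + b * (b - 1) * (N - b) + x * (x - 1) / 2 * z)"
    by linarith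
  have e: "4 / 3 * N ^ 3 * (1 - bad_density (x / N) (z / N))
      = 4 / 3 * N ^ 3 - (b ^ 3 / 6 + b ^ 2 * (N - b) + x ^ 2 * z / 2)"
    using le(4) unfolding bad_density_def b_def
    by (simp add: field_simps power2_eq_square power3_eq_cube)
  have "4 / 3 * (N * (N - 1) * (N - 2)) \<le> 4 / 3 * N ^ 3"
  proof -
    have "N \<ge> 1" using \<open>n > 0\<close> by (simp add: N_def)
    then have "N * N \<ge> N" "N * N \<ge> 0" by (simp_all add: mult_le_cancel_left1)
    moreover have "N * (N - 1) * (N - 2) = N ^ 3 - 3 * (N * N) + 2 * N"
      by (simp add: algebra_simps power3_eq_cube)
    ultimately show ?thesis by linarith
  qed
  moreover have "b ^ 3 / 6 + b ^ 2 * (N - b) + x ^ 2 * z / 2 - N ^ 2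
      \<le> b * (b - 1) * (b - 2) / 6 + b * (b - 1) * (N - b) + x * (x - 1) / 2 * z"
  proof -
    have "b * (b - 1) * (b - 2) / 6 = b ^ 3 / 6 - b * b / 2 + b / 3"
      by (simp add: field_simps power3_eq_cube)
    moreover have "b * (b - 1) * (N - b) = b ^ 2 * (N - b) - b * (N - b)"
      by (simp add: field_simps power2_eq_square)
    moreover have "x * (x - 1) / 2 * z = x ^ 2 * z / 2 - x * z / 2"
      by (simp add: field_simps power2_eq_square)
    moreover have "b * b / 2 + b * (N - b) + x * z / 2 \<le> N ^ 2"
    proof -
      have "x * z \<le> b * b" using le(1,2) unfolding b_def by (simp add: algebra_simps)
      moreover have "b * b \<le> b * N" using le by (intro mult_left_mono) (auto simp: b_def)
      moreover have "b * N \<le> N * N" using le by (intro mult_right_mono) auto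
      ultimately show ?thesis unfolding power2_eq_square by (simp add: algebra_simps)
    qed
    moreover have "0 \<le> b" using le by (simp add: b_def)
    ultimately show ?thesis by linarith
  qed
  ultimately show ?thesis using * e unfolding N_def x_def z_def by linarith
qed

lemma sum_occupancy_pair_le:
  assumes B: "dom \<sigma> \<subseteq> {..<n}" and S: "S \<subseteq> dom \<sigma>" and "n > 0" "y > 0" "0 \<le> \<rho>" "\<rho> \<le> 1"
    and s: "card S = s" and sd: "card (dom \<sigma>) = s + d"
  shows "(\<Sum>xs\<in>samples (pair_clauses n S \<sigma>) m.
      occupancy_weight (dom \<sigma>) (constraining S \<sigma>) (\<lambda>i. if i \<in> S then 0 else \<rho>) xs)
    \<le> pair_bound n m y \<rho> s d"
proof -
  define Y where "Y = 3 * y / (4 * real n ^ 2)"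
  define h where "h = (\<lambda>i. if i \<in> S then real s ^ 2 / 2 else ((s + d) ^ 2 - real s ^ 2) / 2)"
  let ?M = "4 / 3 * real n ^ 3 * (1 - bad_density (s / n) (d / n)) + real n ^ 2"
  have fin: "finite (dom \<sigma>)" by (rule finite_subset[OF B]) simp
  have finS: "finite S" by (rule finite_subset[OF S fin])
  have Y: "Y > 0" using assms by (simp add: Y_def)
  have h: "real (card (pair_clauses n S \<sigma> \<inter> constraining S \<sigma> i)) \<le> h i" if i: "i \<in> dom \<sigma>" for i
  proof (cases "i \<in> S")
    case True
    then have "s \<ge> 1" using finS s by (cases "s = 0") auto
    have "card (pair_clauses n S \<sigma> \<inter> constraining S \<sigma> i) \<le> (s - 1) choose 2"
      using card_constraining[OF B S i] True s by simp
    then have "real (card (pair_clauses n S \<sigma> \<inter> constraining S \<sigma> i)) \<le> real ((s - 1) choose 2)"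
      by simp
    also have "\<dots> \<le> real s ^ 2 / 2"
      using \<open>s \<ge> 1\<close> by (simp add: real_choose_2 of_nat_diff power2_eq_square algebra_simps)
    finally show ?thesis using True by (simp add: h_def)
  next
    case False
    have "d \<ge> 1"
    proof (rule ccontr)
      assume "\<not> d \<ge> 1"
      then have "S = dom \<sigma>" using s sd S fin by (intro card_subset_eq) auto
      then show False using i False by simp
    qed
    then have "s choose 2 \<le> (s + d - 1) choose 2" by (intro binomial_right_mono) simp
    have "card (pair_clauses n S \<sigma> \<inter> constraining S \<sigma> i) \<le> ((s + d - 1) choose 2) - (s choose 2)"
      using card_constraining[OF B S i] False s sd by simp
    then have "real (card (pair_clauses n S \<sigma> \<inter> constraining S \<sigma> i))
        \<le> real ((s + d - 1) choose 2) - real (s choose 2)"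
      using \<open>s choose 2 \<le> (s + d - 1) choose 2\<close> by linarith
    also have "\<dots> \<le> ((s + d) ^ 2 - real s ^ 2) / 2"
    proof -
      have "real (s + d - 1) = real s + real d - 1" using \<open>d \<ge> 1\<close> by (simp add: of_nat_diff)
      then show ?thesis using \<open>d \<ge> 1\<close> by (simp add: real_choose_2 power2_eq_square field_simps)
    qed
    finally show ?thesis using False by (simp add: h_def)
  qed
  have "(\<Sum>xs\<in>samples (pair_clauses n S \<sigma>) m.
      occupancy_weight (dom \<sigma>) (constraining S \<sigma>) (\<lambda>i. if i \<in> S then 0 else \<rho>) xs)
    \<le> fact m / Y ^ m * (exp (Y * ?M) *
        (\<Prod>i\<in>dom \<sigma>. 1 - (1 - (if i \<in> S then 0 else \<rho>)) * exp (- Y * h i)))"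
    by (rule occupancy_bound[OF fin finite_pair_clauses disjoint_constraining Y])
      (use assms h real_card_pair_clauses[OF B S \<open>n > 0\<close> s sd] in auto)
  also have "(\<Prod>i\<in>dom \<sigma>. 1 - (1 - (if i \<in> S then 0 else \<rho>)) * exp (- Y * h i))
      = (1 - exp (- (3 / 8 * y * (s / n) ^ 2))) ^ s
        * (1 - (1 - \<rho>) * exp (- (3 / 8 * y * ((s / n + d / n) ^ 2 - (s / n) ^ 2)))) ^ d"
  proof -
    have Yh1: "Y * h i = 3 / 8 * y * (s / n) ^ 2" if "i \<in> S" for i
      using that \<open>n > 0\<close> by (simp add: Y_def h_def power_divide)
    have Yh2: "Y * h i = 3 / 8 * y * ((s / n + d / n) ^ 2 - (s / n) ^ 2)" if "i \<notin> S" for i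
      using that \<open>n > 0\<close> by (simp add: Y_def h_def power_divide add_divide_distrib[symmetric] field_simps)
    have "(\<Prod>i\<in>dom \<sigma>. 1 - (1 - (if i \<in> S then 0 else \<rho>)) * exp (- Y * h i))
        = (\<Prod>i\<in>S. 1 - (1 - (if i \<in> S then 0 else \<rho>)) * exp (- Y * h i))
          * (\<Prod>i\<in>dom \<sigma> - S. 1 - (1 - (if i \<in> S then 0 else \<rho>)) * exp (- Y * h i))"
      (is "_ = ?PS * ?PD")
      by (subst prod.subset_diff[OF S fin]) (rule mult.commute)
    also have "?PS = (\<Prod>i\<in>S. 1 - exp (- (3 / 8 * y * (s / n) ^ 2)))"
      using Yh1 by (intro prod.cong) auto
    also have "?PD = (\<Prod>i\<in>dom \<sigma> - S. 1 - (1 - \<rho>) * exp (- (3 / 8 * y * ((s / n + d / n) ^ 2 - (s / n) ^ 2))))"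
      using Yh2 by (intro prod.cong) auto
    also have "card (dom \<sigma> - S) = d" using finS S s sd by (simp add: card_Diff_subset)
    ultimately show ?thesis using s by simp
  qed
  also have "fact m / Y ^ m * (exp (Y * ?M) * \<dots>) \<le> pair_bound n m y \<rho> s d"
    unfolding pair_bound_def Y_def[symmetric]
  proof (intro mult_left_mono mult_right_mono mult_nonneg_nonneg zero_le_power)
    have "Y * ?M = y * n * (1 - bad_density (s / n) (d / n)) + 3 / 4 * y"
      using \<open>n > 0\<close> by (simp add: Y_def field_simps power2_eq_square power3_eq_cube)
    then show "exp (Y * ?M) \<le> exp (y * n * (1 - bad_density (s / n) (d / n)) + y)"
      using \<open>y > 0\<close> by simp
    show "0 \<le> 1 - exp (- (3 / 8 * y * (s / n) ^ 2))" using \<open>y > 0\<close> by simp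
    have "(s / n) ^ 2 \<le> (real s / n + d / n) ^ 2"
      by (intro power_mono) auto
    then have "exp (- (3 / 8 * y * ((s / n + d / n) ^ 2 - (s / n) ^ 2))) \<le> 1" using \<open>y > 0\<close> by simp
    then have "(1 - \<rho>) * exp (- (3 / 8 * y * ((s / n + d / n) ^ 2 - (s / n) ^ 2))) \<le> 1 * 1"
      using \<open>0 \<le> \<rho>\<close> \<open>\<rho> \<le> 1\<close> by (intro mult_mono) auto
    then show "0 \<le> 1 - (1 - \<rho>) * exp (- (3 / 8 * y * ((s / n + d / n) ^ 2 - (s / n) ^ 2)))" by simp
  qed (use Y in auto)
  finally show ?thesis .
qed


section \<open>Union bounds over pairs and over cores alone\<close>

definition core_event :: "nat \<Rightarrow> nat \<Rightarrow> nat \<Rightarrow> formula set" where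
  "core_event n m s = {\<phi> \<in> samples (clauses n) m. \<exists>\<sigma> S. dom \<sigma> = {..<n} \<and> valid n \<phi> \<sigma> \<and>
     S \<subseteq> {..<n} \<and> card S = s \<and> minimal n \<phi> (\<sigma> |` S)}"

definition pairs :: "nat \<Rightarrow> nat \<Rightarrow> (nat set \<times> passign) set" where
  "pairs n s = {(S, \<sigma>). dom \<sigma> \<subseteq> {..<n} \<and> S \<subseteq> dom \<sigma> \<and> card S = s}"

abbreviation pair_weight :: "nat set \<Rightarrow> passign \<Rightarrow> real \<Rightarrow> formula \<Rightarrow> real" where
  "pair_weight S \<sigma> \<rho> \<equiv>
     occupancy_weight (dom \<sigma>) (constraining S \<sigma>) (\<lambda>i. if i \<in> S then 0 else \<rho>)"

lemma finite_passigns: "finite {\<sigma> :: passign. dom \<sigma> \<subseteq> {..<n}}"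
proof -
  have "{\<sigma> :: passign. dom \<sigma> \<subseteq> {..<n}} = (\<Union>B\<in>Pow {..<n}. {\<sigma>. dom \<sigma> = B \<and> ran \<sigma> \<subseteq> UNIV})" by auto
  also have "finite \<dots>"
    by (intro finite_UN_I finite_set_of_finite_maps) (auto intro: finite_subset)
  finally show ?thesis .
qed

lemma finite_pairs: "finite (pairs n s)"
proof (rule finite_subset)
  show "pairs n s \<subseteq> Pow {..<n} \<times> {\<sigma>. dom \<sigma> \<subseteq> {..<n}}" unfolding pairs_def by blast
qed (simp add: finite_passigns)

lemma true_set_inj: "dom \<sigma> = dom \<tau> \<Longrightarrow> {i. \<sigma> i = Some True} = {i. \<tau> i = Some True} \<Longrightarrow> \<sigma> = \<tau>"
proof
  fix i assume *: "dom \<sigma> = dom \<tau>" "{i. \<sigma> i = Some True} = {i. \<tau> i = Some True}"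
  then have "\<sigma> i = None \<longleftrightarrow> \<tau> i = None" "\<sigma> i = Some True \<longleftrightarrow> \<tau> i = Some True"
    by (metis domIff, blast)
  then show "\<sigma> i = \<tau> i" by (cases "\<sigma> i"; cases "\<tau> i") auto
qed

text \<open>A pair is coded by the domain of \<open>\<sigma>\<close>, the subset \<open>S\<close> of
  it, and the subset of variables set to \<open>True\<close>.\<close>

lemma card_pairs_le:
  "card {(S, \<sigma>) \<in> pairs n s. card (dom \<sigma>) = b} \<le> (n choose b) * ((b choose s) * 2 ^ b)"
proof -
  let ?P = "{(S, \<sigma>) \<in> pairs n s. card (dom \<sigma>) = b}"
  let ?D = "Sigma {B. B \<subseteq> {..<n} \<and> card B = b} (\<lambda>B. {S. S \<subseteq> B \<and> card S = s} \<times> Pow B)"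
  let ?f = "\<lambda>(S, \<sigma>). (dom \<sigma>, S, {i. \<sigma> i = Some True})"
  have finB: "finite {B. B \<subseteq> {..<n} \<and> card B = b}" by (rule finite_subset[of _ "Pow {..<n}"]) auto
  have fin1: "finite ({S. S \<subseteq> B \<and> card S = s} \<times> Pow B)" if "B \<subseteq> {..<n}" for B
    using that by (intro finite_cartesian_product finite_subset[of "{S. S \<subseteq> B \<and> card S = s}" "Pow B"])
      (auto dest: finite_subset)
  have inj: "inj_on ?f ?P"
    by (rule inj_onI) (auto dest: true_set_inj)
  have sub: "?f ` ?P \<subseteq> ?D" by (auto simp: pairs_def)
  have "finite ?D" by (rule finite_SigmaI[OF finB]) (use fin1 in auto)
  then have "card ?P \<le> card ?D" using card_inj_on_le[OF inj sub] by simp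
  also have "card ?D = (\<Sum>B | B \<subseteq> {..<n} \<and> card B = b. card ({S. S \<subseteq> B \<and> card S = s} \<times> Pow B))"
    by (rule card_SigmaI[OF finB]) (use fin1 in auto)
  also have "\<dots> = (\<Sum>B | B \<subseteq> {..<n} \<and> card B = b. (b choose s) * 2 ^ b)"
  proof (rule sum.cong)
    fix B assume "B \<in> {B. B \<subseteq> {..<n} \<and> card B = b}"
    then have "finite B" "card B = b" using finite_subset[OF _ finite_lessThan] by auto
    then show "card ({S. S \<subseteq> B \<and> card S = s} \<times> Pow B) = (b choose s) * 2 ^ b"
      by (simp add: card_cartesian_product n_subsets card_Pow)
  qed simp
  also have "\<dots> = (n choose b) * ((b choose s) * 2 ^ b)" by (simp add: n_subsets)
  finally show ?thesis .
qed

text \<open>Inside \<open>S\<close> a missed requirement would contribute 0, but minimality of the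
  restriction rules it out. Outside \<open>S\<close> the missed requirements are the unconstrained
  variables, so the occupancy weight is the \<open>\<rho>\<close> part of the peeling
  weight.\<close>

lemma pair_weight_eq:
  assumes "minimal n \<phi> (\<sigma> |` S)" "S \<subseteq> dom \<sigma>" "dom \<sigma> \<subseteq> {..<n}"
  shows "pair_weight S \<sigma> \<rho> \<phi> = \<rho> ^ card ({i. unconstrained \<phi> \<sigma> i} - S)"
proof -
  have fin: "finite (dom \<sigma>)" by (rule finite_subset[OF assms(3)]) simp
  have "pair_weight S \<sigma> \<rho> \<phi> = (\<Prod>i\<in>dom \<sigma>. if i \<in> {i. unconstrained \<phi> \<sigma> i} - S then \<rho> else 1)"
    unfolding occupancy_weight_def
  proof (rule prod.cong)
    fix i assume i: "i \<in> dom \<sigma>"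
    show "(if set \<phi> \<inter> constraining S \<sigma> i = {} then if i \<in> S then 0 else \<rho> else 1)
        = (if i \<in> {i. unconstrained \<phi> \<sigma> i} - S then \<rho> else 1)"
    proof (cases "i \<in> S")
      case True
      then have "\<not> unconstrained \<phi> (\<sigma> |` S) i" using assms i unfolding minimal_def by blast
      then have "set \<phi> \<inter> constraining S \<sigma> i \<noteq> {}"
        using True i by (auto simp: unconstrained_def constraining_def)
      then show ?thesis using True by simp
    next
      case False
      then have "unconstrained \<phi> \<sigma> i \<longleftrightarrow> set \<phi> \<inter> constraining S \<sigma> i = {}"
        using i by (auto simp: unconstrained_def constraining_def)
      then show ?thesis using False by simp
    qed
  qed simp
  also have "\<dots> = \<rho> ^ card (dom \<sigma> \<inter> ({i. unconstrained \<phi> \<sigma> i} - S))"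
    using fin by (simp only: prod.If_cases[OF fin] Collect_mem_eq prod_constant power_one mult_1_right)
  also have "dom \<sigma> \<inter> ({i. unconstrained \<phi> \<sigma> i} - S) = {i. unconstrained \<phi> \<sigma> i} - S"
    by (auto simp: unconstrained_def)
  finally show ?thesis .
qed

lemma mem_samples_pair_clauses:
  assumes "\<phi> \<in> samples (clauses n) m" "minimal n \<phi> (\<sigma> |` S)" "valid n \<phi> \<sigma>"
  shows "\<phi> \<in> samples (pair_clauses n S \<sigma>) m"
  using assms unfolding samples_def pair_clauses_def minimal_def valid_def by auto

lemma pair_bound_nonneg:
  assumes "y > 0" "0 \<le> \<rho>" "\<rho> \<le> 1"
  shows "0 \<le> pair_bound n m y \<rho> s d"
proof -
  have "(s / n) ^ 2 \<le> (real s / n + d / n) ^ 2"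
    by (intro power_mono) auto
  then have "exp (- (3 / 8 * y * ((s / n + d / n) ^ 2 - (s / n) ^ 2))) \<le> 1" using \<open>y > 0\<close> by simp
  then have "(1 - \<rho>) * exp (- (3 / 8 * y * ((s / n + d / n) ^ 2 - (s / n) ^ 2))) \<le> 1 * 1"
    using assms by (intro mult_mono) auto
  moreover have "exp (- (3 / 8 * y * (s / n) ^ 2)) \<le> 1" using \<open>y > 0\<close> by simp
  ultimately show ?thesis unfolding pair_bound_def using \<open>y > 0\<close>
    by (intro mult_nonneg_nonneg divide_nonneg_nonneg zero_le_power) auto
qed

text \<open>By peeling, each formula of the event receives total weight at least 1 from its pairs.
  Exchanging the sums leaves one occupancy problem per pair, whose bound depends only on
  \<open>s\<close> and the size \<open>b\<close> of the domain.\<close>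

lemma card_core_event_le:
  assumes "n > 0" "y > 0" "0 \<le> \<rho>" "\<rho> \<le> 1"
  shows "real (card (core_event n m s)) \<le> (\<Sum>b\<in>{s..n}. real (n choose b) * real (b choose s) * 2 ^ b
           * (1 - \<rho>) ^ (n - b) * pair_bound n m y \<rho> s (b - s))"
proof -
  define g where "g = (\<lambda>p \<phi>. if \<phi> \<in> samples (pair_clauses n (fst p) (snd p)) m
    then (1 - \<rho>) ^ (n - card (dom (snd p))) * pair_weight (fst p) (snd p) \<rho> \<phi> else 0)"
  have finS: "finite (samples (clauses n) m)" by (rule finite_samples[OF finite_clauses])
  have finE: "finite (core_event n m s)"
    by (rule finite_subset[OF _ finS]) (auto simp: core_event_def)
  have w0: "0 \<le> pair_weight S \<sigma> \<rho> \<phi>" for S \<sigma> \<phi>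
    using assms by (intro occupancy_weight_nonneg) auto
  have g0: "0 \<le> g p \<phi>" for p \<phi> using w0 assms by (simp add: g_def)
  have one: "1 \<le> (\<Sum>p\<in>pairs n s. g p \<phi>)" if "\<phi> \<in> core_event n m s" for \<phi>
  proof -
    from that obtain \<sigma> S where \<phi>: "\<phi> \<in> samples (clauses n) m" and \<sigma>: "dom \<sigma> = {..<n}" "valid n \<phi> \<sigma>"
      and S: "S \<subseteq> {..<n}" "card S = s" and min: "minimal n \<phi> (\<sigma> |` S)"
      by (auto simp: core_event_def)
    define V where "V = {\<tau>. valid n \<phi> \<tau> \<and> \<tau> \<subseteq>\<^sub>m \<sigma> \<and> S \<subseteq> dom \<tau>}"
    \<comment> \<open>All assignments in \<open>V\<close> agree with \<open>\<sigma>\<close> on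
      \<open>S\<close>, so they share its core.\<close>
    have V: "dom \<tau> \<subseteq> {..<n} \<and> minimal n \<phi> (\<tau> |` S)" if "\<tau> \<in> V" for \<tau>
    proof -
      have "\<tau> |` S = \<sigma> |` S"
      proof
        fix i show "(\<tau> |` S) i = (\<sigma> |` S) i"
          using that by (cases "i \<in> S") (auto simp: V_def map_le_def)
      qed
      then show ?thesis using that min by (auto simp: V_def valid_def)
    qed
    have "1 \<le> (\<Sum>\<tau>\<in>V. \<rho> ^ card ({i. unconstrained \<phi> \<tau> i} - S) * (1 - \<rho>) ^ card (dom \<sigma> - dom \<tau>))"
      unfolding V_def using sum_peeling_weights_ge_1[OF \<sigma>(2)] S \<sigma> assms by blast
    also have "\<dots> = (\<Sum>\<tau>\<in>V. g (S, \<tau>) \<phi>)"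
    proof (rule sum.cong)
      fix \<tau> assume \<tau>: "\<tau> \<in> V"
      have d: "dom \<tau> \<subseteq> {..<n}" and mn: "minimal n \<phi> (\<tau> |` S)" using V[OF \<tau>] by auto
      have "\<phi> \<in> samples (pair_clauses n S \<tau>) m"
        by (rule mem_samples_pair_clauses[OF \<phi> mn]) (use \<tau> in \<open>simp add: V_def\<close>)
      moreover have "pair_weight S \<tau> \<rho> \<phi> = \<rho> ^ card ({i. unconstrained \<phi> \<tau> i} - S)"
        by (rule pair_weight_eq[OF mn _ d]) (use \<tau> in \<open>simp add: V_def\<close>)
      moreover have "card (dom \<sigma> - dom \<tau>) = n - card (dom \<tau>)"
        using d \<sigma>(1) finite_subset[OF d] by (simp add: card_Diff_subset)
      ultimately show "\<rho> ^ card ({i. unconstrained \<phi> \<tau> i} - S) * (1 - \<rho>) ^ card (dom \<sigma> - dom \<tau>)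
          = g (S, \<tau>) \<phi>" by (simp add: g_def)
    qed simp
    also have "\<dots> = (\<Sum>p\<in>Pair S ` V. g p \<phi>)"
      by (subst sum.reindex) (auto simp: inj_on_def)
    also have "\<dots> \<le> (\<Sum>p\<in>pairs n s. g p \<phi>)"
    proof (rule sum_mono2[OF finite_pairs])
      show "Pair S ` V \<subseteq> pairs n s" using V S(2) by (auto simp: pairs_def V_def)
    qed (use g0 in auto)
    finally show ?thesis .
  qed
  have "real (card (core_event n m s)) = (\<Sum>\<phi>\<in>core_event n m s. 1)" by simp
  also have "\<dots> \<le> (\<Sum>\<phi>\<in>core_event n m s. \<Sum>p\<in>pairs n s. g p \<phi>)"
    by (rule sum_mono) (rule one)
  also have "\<dots> \<le> (\<Sum>\<phi>\<in>samples (clauses n) m. \<Sum>p\<in>pairs n s. g p \<phi>)"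
    by (rule sum_mono2[OF finS]) (auto simp: core_event_def intro!: sum_nonneg g0)
  also have "\<dots> = (\<Sum>p\<in>pairs n s. \<Sum>\<phi>\<in>samples (clauses n) m. g p \<phi>)"
    by (rule sum.swap)
  also have "\<dots> \<le> (\<Sum>p\<in>pairs n s. (1 - \<rho>) ^ (n - card (dom (snd p))) * pair_bound n m y \<rho> s (card (dom (snd p)) - s))"
  proof (rule sum_mono)
    fix p assume p: "p \<in> pairs n s"
    obtain S \<sigma> where p': "p = (S, \<sigma>)" by (cases p)
    have d: "dom \<sigma> \<subseteq> {..<n}" "S \<subseteq> dom \<sigma>" "card S = s" using p by (auto simp: p' pairs_def)
    have "s \<le> card (dom \<sigma>)" using d finite_subset[OF d(1)] card_mono by blast
    then have sd: "card (dom \<sigma>) = s + (card (dom \<sigma>) - s)" by simp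
    have sub: "samples (pair_clauses n S \<sigma>) m \<subseteq> samples (clauses n) m"
      by (auto simp: samples_def pair_clauses_def)
    have "(\<Sum>\<phi>\<in>samples (clauses n) m. g p \<phi>)
        = (\<Sum>\<phi>\<in>samples (pair_clauses n S \<sigma>) m. (1 - \<rho>) ^ (n - card (dom \<sigma>)) * pair_weight S \<sigma> \<rho> \<phi>)"
      unfolding g_def p' fst_conv snd_conv
      by (subst sum.inter_restrict[OF finS, symmetric]) (use sub in \<open>simp add: Int_absorb1\<close>)
    also have "\<dots> = (1 - \<rho>) ^ (n - card (dom \<sigma>)) * (\<Sum>\<phi>\<in>samples (pair_clauses n S \<sigma>) m. pair_weight S \<sigma> \<rho> \<phi>)"
      by (rule sum_distrib_left[symmetric])
    also have "\<dots> \<le> (1 - \<rho>) ^ (n - card (dom \<sigma>)) * pair_bound n m y \<rho> s (card (dom \<sigma>) - s)"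
      using sum_occupancy_pair_le[OF d(1,2) assms d(3) sd] assms by (intro mult_left_mono) auto
    finally show "(\<Sum>\<phi>\<in>samples (clauses n) m. g p \<phi>)
        \<le> (1 - \<rho>) ^ (n - card (dom (snd p))) * pair_bound n m y \<rho> s (card (dom (snd p)) - s)"
      by (simp add: p')
  qed
  also have "\<dots> = (\<Sum>b\<in>{s..n}. \<Sum>p | p \<in> pairs n s \<and> card (dom (snd p)) = b.
      (1 - \<rho>) ^ (n - card (dom (snd p))) * pair_bound n m y \<rho> s (card (dom (snd p)) - s))"
  proof (rule sum.group[symmetric, OF finite_pairs])
    show "(\<lambda>p. card (dom (snd p))) ` pairs n s \<subseteq> {s..n}"
    proof clarify
      fix S and \<sigma> :: passign assume "(S, \<sigma>) \<in> pairs n s"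
      then have d: "dom \<sigma> \<subseteq> {..<n}" "S \<subseteq> dom \<sigma>" "card S = s" by (auto simp: pairs_def)
      then show "card (dom (snd (S, \<sigma>))) \<in> {s..n}"
        using finite_subset[OF d(1)] card_mono[OF _ d(2)] card_mono[OF _ d(1)] by auto
    qed
  qed simp
  also have "\<dots> \<le> (\<Sum>b\<in>{s..n}. real (n choose b) * real (b choose s) * 2 ^ b
           * (1 - \<rho>) ^ (n - b) * pair_bound n m y \<rho> s (b - s))"
  proof (rule sum_mono)
    fix b assume "b \<in> {s..n}"
    have nn: "0 \<le> (1 - \<rho>) ^ (n - b) * pair_bound n m y \<rho> s (b - s)"
      using pair_bound_nonneg assms by simp
    have "(\<Sum>p | p \<in> pairs n s \<and> card (dom (snd p)) = b.
        (1 - \<rho>) ^ (n - card (dom (snd p))) * pair_bound n m y \<rho> s (card (dom (snd p)) - s))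
      = real (card {p \<in> pairs n s. card (dom (snd p)) = b}) * ((1 - \<rho>) ^ (n - b) * pair_bound n m y \<rho> s (b - s))"
      by simp
    also have "\<dots> \<le> real ((n choose b) * ((b choose s) * 2 ^ b)) * ((1 - \<rho>) ^ (n - b) * pair_bound n m y \<rho> s (b - s))"
    proof (rule mult_right_mono[OF _ nn])
      have "{p \<in> pairs n s. card (dom (snd p)) = b} = {(S, \<sigma>) \<in> pairs n s. card (dom \<sigma>) = b}" by auto
      then show "real (card {p \<in> pairs n s. card (dom (snd p)) = b}) \<le> real ((n choose b) * ((b choose s) * 2 ^ b))"
        using card_pairs_le[of n s b] by (simp only: of_nat_le_iff)
    qed
    finally show "(\<Sum>p | p \<in> pairs n s \<and> card (dom (snd p)) = b.
        (1 - \<rho>) ^ (n - card (dom (snd p))) * pair_bound n m y \<rho> s (card (dom (snd p)) - s))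
      \<le> real (n choose b) * real (b choose s) * 2 ^ b * (1 - \<rho>) ^ (n - b) * pair_bound n m y \<rho> s (b - s)"
      by (simp only: of_nat_mult of_nat_power of_nat_numeral mult.assoc)
  qed
  finally show ?thesis .
qed

text \<open>Union bound over the pairs with \<open>dom \<sigma> = S\<close>, that is
  \<open>d = 0\<close>. Their weight is the indicator that every core variable is
  constrained.\<close>

lemma card_core_event_le_plain:
  assumes "n > 0" "y > 0"
  shows "real (card (core_event n m s)) \<le> real (n choose s) * 2 ^ s * pair_bound n m y 0 s 0"
proof -
  define P where "P = {(S, \<sigma>) \<in> pairs n s. card (dom \<sigma>) = s}"
  have finP: "finite P" by (rule finite_subset[OF _ finite_pairs[of n s]]) (auto simp: P_def)
  have finE: "finite (core_event n m s)"
    by (rule finite_subset[OF _ finite_samples[OF finite_clauses]]) (auto simp: core_event_def)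
  let ?E = "\<lambda>p. {\<phi> \<in> samples (pair_clauses n (fst p) (snd p)) m. pair_weight (fst p) (snd p) 0 \<phi> = 1}"
  have finp: "finite (samples (pair_clauses n S \<sigma>) m)" for S \<sigma>
    by (rule finite_samples[OF finite_pair_clauses])
  have "core_event n m s \<subseteq> (\<Union>p\<in>P. ?E p)"
  proof
    fix \<phi> assume "\<phi> \<in> core_event n m s"
    then obtain \<sigma> S where \<phi>: "\<phi> \<in> samples (clauses n) m" and \<sigma>: "dom \<sigma> = {..<n}"
      and S: "S \<subseteq> {..<n}" "card S = s" and min: "minimal n \<phi> (\<sigma> |` S)"
      by (auto simp: core_event_def)
    let ?\<tau> = "\<sigma> |` S"
    have d: "dom ?\<tau> = S" using S \<sigma> by auto
    have rr: "?\<tau> |` S = ?\<tau>" by simp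
    have "\<phi> \<in> samples (pair_clauses n S ?\<tau>) m"
      by (rule mem_samples_pair_clauses[OF \<phi>]) (use min in \<open>simp_all add: minimal_def\<close>)
    moreover have "pair_weight S ?\<tau> 0 \<phi> = 1"
    proof -
      \<comment> \<open>The exponent is 0, and \<open>0 ^ 0 = 1\<close> makes the weight 1 although
        \<open>\<rho> = 0\<close>.\<close>
      have e: "{i. unconstrained \<phi> ?\<tau> i} - S = {}"
        by (auto simp: unconstrained_def restrict_map_def)
      have "pair_weight S ?\<tau> 0 \<phi> = 0 ^ card ({i. unconstrained \<phi> ?\<tau> i} - S)"
        by (rule pair_weight_eq[of n]) (use min d S in auto)
      then show ?thesis unfolding e by simp
    qed
    moreover have "(S, ?\<tau>) \<in> P" using d S by (auto simp: P_def pairs_def)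
    ultimately show "\<phi> \<in> (\<Union>p\<in>P. ?E p)"
      by (intro UN_I[of "(S, ?\<tau>)"]) (simp_all only: mem_Collect_eq fst_conv snd_conv)
  qed
  then have "card (core_event n m s) \<le> card (\<Union>p\<in>P. ?E p)"
    by (intro card_mono finite_UN_I finP finite_Collect_conjI) (simp_all only: Collect_mem_eq finp simp_thms)
  also have "\<dots> \<le> (\<Sum>p\<in>P. card (?E p))" by (rule card_UN_le[OF finP])
  finally have "real (card (core_event n m s)) \<le> real (\<Sum>p\<in>P. card (?E p))" by (rule of_nat_mono)
  then have "real (card (core_event n m s)) \<le> (\<Sum>p\<in>P. real (card (?E p)))" by (simp only: of_nat_sum)
  also have "\<dots> \<le> (\<Sum>p\<in>P. pair_bound n m y 0 s 0)"
  proof (rule sum_mono)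
    fix p assume p: "p \<in> P"
    obtain S \<sigma> where p': "p = (S, \<sigma>)" by (cases p)
    have d: "dom \<sigma> \<subseteq> {..<n}" "S \<subseteq> dom \<sigma>" "card S = s" "card (dom \<sigma>) = s + 0"
      using p by (auto simp: p' P_def pairs_def)
    have "real (card (?E p)) = (\<Sum>\<phi>\<in>?E p. pair_weight S \<sigma> 0 \<phi>)" by (simp add: p')
    also have "\<dots> \<le> (\<Sum>\<phi>\<in>samples (pair_clauses n S \<sigma>) m. pair_weight S \<sigma> 0 \<phi>)"
      by (rule sum_mono2[OF finp]) (auto simp: p' intro!: occupancy_weight_nonneg)
    also have "\<dots> \<le> pair_bound n m y 0 s 0"
      using sum_occupancy_pair_le[OF d(1,2) assms _ _ d(3,4), of 0 m] by simp
    finally show "real (card (?E p)) \<le> pair_bound n m y 0 s 0" .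
  qed
  also have "\<dots> = real (card P) * pair_bound n m y 0 s 0" by simp
  also have "\<dots> \<le> real ((n choose s) * ((s choose s) * 2 ^ s)) * pair_bound n m y 0 s 0"
    using card_pairs_le[of n s s] pair_bound_nonneg[OF \<open>y > 0\<close>, of 0] unfolding P_def
    by (intro mult_right_mono) (simp_all only: of_nat_le_iff)
  finally show ?thesis by simp
qed

section \<open>Satisfiability at large densities\<close>

definition sat_event :: "nat \<Rightarrow> nat \<Rightarrow> formula set" where
  "sat_event n m = {\<phi> \<in> samples (clauses n) m. \<exists>\<sigma>. satisfying n \<phi> \<sigma>}"

text \<open>A satisfying assignment with the largest number of variables set to \<open>True\<close> cannot have an
  unconstrained variable set to \<open>False\<close>.\<close>

lemma ex_satisfying_false_constrained:
  assumes "satisfying n \<phi> \<sigma>0" "set \<phi> \<subseteq> clauses n"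
  obtains \<sigma> where "satisfying n \<phi> \<sigma>" "\<And>i. \<sigma> i = Some False \<Longrightarrow> \<not> unconstrained \<phi> \<sigma> i"
proof -
  let ?T = "\<lambda>\<sigma> :: passign. card {i. \<sigma> i = Some True}"
  have fin: "finite {i. \<sigma> i = Some True}" if "satisfying n \<phi> \<sigma>" for \<sigma>
    by (rule finite_subset[of _ "{..<n}"]) (use that in \<open>auto simp: satisfying_def\<close>)
  have bd: "?T \<sigma> < Suc n" if "satisfying n \<phi> \<sigma>" for \<sigma>
  proof -
    have "{i. \<sigma> i = Some True} \<subseteq> {..<n}" using that by (auto simp: satisfying_def)
    from card_mono[OF finite_lessThan this] show ?thesis by simp
  qed
  then have "\<exists>\<sigma>. satisfying n \<phi> \<sigma> \<and> (\<forall>\<tau>. satisfying n \<phi> \<tau> \<longrightarrow> ?T \<tau> \<le> ?T \<sigma>)"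
    by (intro ex_has_greatest_nat[of "satisfying n \<phi>" \<sigma>0 ?T "Suc n"] assms(1)) blast
  then obtain \<sigma> where \<sigma>: "satisfying n \<phi> \<sigma>" and max: "\<And>\<tau>. satisfying n \<phi> \<tau> \<Longrightarrow> ?T \<tau> \<le> ?T \<sigma>"
    by blast
  have "\<not> unconstrained \<phi> \<sigma> i" if i: "\<sigma> i = Some False" for i
  proof
    assume u: "unconstrained \<phi> \<sigma> i"
    let ?\<tau> = "\<sigma>(i \<mapsto> True)"
    have dom: "dom ?\<tau> = {..<n}" using \<sigma> i by (auto simp: satisfying_def)
    have "\<exists>l\<in>c. lit_true ?\<tau> l" if c: "c \<in> set \<phi>" for c
    proof (rule ccontr)
      assume *: "\<not> (\<exists>l\<in>c. lit_true ?\<tau> l)"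
      obtain l where l: "l \<in> c" "lit_true \<sigma> l" using \<sigma> c by (auto simp: satisfying_def)
      \<comment> \<open>The flip of \<open>i\<close> removed the last true literal of the clause, so
        this literal is on \<open>i\<close> and all others are false under \<open>\<sigma>\<close>:
        the clause constrained \<open>i\<close>.\<close>
      have "fst l = i" using * l by (auto simp: lit_true_def split: if_splits)
      have "lit_false \<sigma> l'" if l': "l' \<in> c - {l}" for l'
      proof (cases "fst l' = i")
        case True
        then show ?thesis using l l' i \<open>fst l = i\<close> by (cases l; cases l') (auto simp: lit_true_def lit_false_def)
      next
        case False
        then have "\<not> lit_true \<sigma> l'" using * l' by (auto simp: lit_true_def)
        moreover have "fst l' \<in> dom \<sigma>"
        proof -
          have "c \<subseteq> {..<n} \<times> UNIV" using c assms(2) by (auto simp: clauses_def)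
          then have "fst l' < n" using l' by auto
          then show ?thesis using \<sigma> by (simp add: satisfying_def)
        qed
        ultimately show ?thesis by (auto simp: lit_true_def lit_false_def)
      qed
      then have "constrained_by \<sigma> i c" using l \<open>fst l = i\<close> unfolding constrained_by_def by blast
      then show False using u c by (auto simp: unconstrained_def)
    qed
    then have sat: "satisfying n \<phi> ?\<tau>" using dom by (simp add: satisfying_def)
    have "{j. \<sigma> j = Some True} \<subseteq> {j. ?\<tau> j = Some True}" by auto
    moreover have "i \<in> {j. ?\<tau> j = Some True} - {j. \<sigma> j = Some True}" using i by simp
    ultimately have "{j. \<sigma> j = Some True} \<subset> {j. ?\<tau> j = Some True}" by blast
    then have "?T \<sigma> < ?T ?\<tau>" by (intro psubset_card_mono fin[OF sat])
    then show False using max[OF sat] by simp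
  qed
  then show thesis using that \<sigma> by blast
qed

text \<open>Only variables set to \<open>False\<close> carry a requirement, each with factor
  \<open>x = 1 - exp (- (3 / 8 * y))\<close>. Summing \<open>x ^ card U\<close> over the possible
  sets \<open>U\<close> of such variables gives \<open>(1 + x) ^ n\<close>. The 7/8 is
  \<open>1 - bad_density 1 0\<close>.\<close>

lemma card_sat_event_le:
  assumes "n > 0" "y > 0"
  shows "real (card (sat_event n m)) \<le> fact m / (3 * y / (4 * real n ^ 2)) ^ m
    * (exp (7 / 8 * y * n + y) * (2 - exp (- (3 / 8 * y))) ^ n)"
proof -
  define Y where "Y = 3 * y / (4 * real n ^ 2)"
  define x where "x = 1 - exp (- (3 / 8 * y))"
  define I where "I = (\<lambda>\<sigma> :: passign. {i. \<sigma> i = Some False})"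
  define P where "P = {\<sigma> :: passign. dom \<sigma> = {..<n}}"
  define W where "W = (\<lambda>\<sigma>. occupancy_weight (I \<sigma>) (constraining {..<n} \<sigma>) (\<lambda>_. 0))"
  define C where "C = fact m / Y ^ m * exp (7 / 8 * y * n + y)"
  let ?A = "\<lambda>\<sigma>. samples (pair_clauses n {..<n} \<sigma>) m"
  let ?E = "\<lambda>\<sigma>. {\<phi> \<in> ?A \<sigma>. W \<sigma> \<phi> = 1}"
  have Y: "Y > 0" using assms by (simp add: Y_def)
  have x: "0 \<le> x" using assms by (simp add: x_def)
  have C: "0 \<le> C" using Y by (simp add: C_def)
  have finP: "finite P" by (rule finite_subset[OF _ finite_passigns[of n]]) (auto simp: P_def)
  have finA: "finite (?A \<sigma>)" for \<sigma> by (rule finite_samples[OF finite_pair_clauses])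
  have "sat_event n m \<subseteq> (\<Union>\<sigma>\<in>P. ?E \<sigma>)"
  proof
    fix \<phi> assume "\<phi> \<in> sat_event n m"
    then obtain \<sigma>0 where \<phi>: "\<phi> \<in> samples (clauses n) m" and "satisfying n \<phi> \<sigma>0"
      by (auto simp: sat_event_def)
    moreover have "set \<phi> \<subseteq> clauses n" using \<phi> by (auto simp: samples_def)
    ultimately obtain \<sigma> where \<sigma>: "satisfying n \<phi> \<sigma>" "\<And>i. \<sigma> i = Some False \<Longrightarrow> \<not> unconstrained \<phi> \<sigma> i"
      using ex_satisfying_false_constrained by metis
    have dom: "dom \<sigma> = {..<n}" using \<sigma>(1) by (simp add: satisfying_def)
    have r: "\<sigma> |` {..<n} = \<sigma>" unfolding dom[symmetric] by (auto simp: restrict_map_def fun_eq_iff domIff)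
    have "\<phi> \<in> ?A \<sigma>"
      using \<phi> satisfying_imp_valid[OF \<sigma>(1)] by (auto simp: samples_def pair_clauses_def valid_def r)
    moreover have "W \<sigma> \<phi> = 1"
      unfolding W_def occupancy_weight_def
    proof (rule prod.neutral, clarify)
      fix i assume "i \<in> I \<sigma>"
      then have "\<exists>c\<in>set \<phi>. constrained_by \<sigma> i c"
        using \<sigma>(2)[of i] by (auto simp: I_def unconstrained_def)
      then show "(if set \<phi> \<inter> constraining {..<n} \<sigma> i = {} then 0 else 1 :: real) = 1"
        by (auto simp: constraining_def r)
    qed
    ultimately show "\<phi> \<in> (\<Union>\<sigma>\<in>P. ?E \<sigma>)"
      using dom by (intro UN_I[of \<sigma>]) (simp_all only: mem_Collect_eq P_def)
  qed
  then have "card (sat_event n m) \<le> card (\<Union>\<sigma>\<in>P. ?E \<sigma>)"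
    by (intro card_mono finite_UN_I finP finite_Collect_conjI) (simp_all only: Collect_mem_eq finA simp_thms)
  also have "\<dots> \<le> (\<Sum>\<sigma>\<in>P. card (?E \<sigma>))" by (rule card_UN_le[OF finP])
  finally have "real (card (sat_event n m)) \<le> real (\<Sum>\<sigma>\<in>P. card (?E \<sigma>))" by (rule of_nat_mono)
  then have "real (card (sat_event n m)) \<le> (\<Sum>\<sigma>\<in>P. real (card (?E \<sigma>)))" by (simp only: of_nat_sum)
  also have "\<dots> \<le> (\<Sum>\<sigma>\<in>P. C * x ^ card (I \<sigma>))"
  proof (rule sum_mono)
    fix \<sigma> assume "\<sigma> \<in> P"
    then have dom: "dom \<sigma> = {..<n}" by (simp add: P_def)
    have d: "dom \<sigma> \<subseteq> {..<n}" "{..<n} \<subseteq> dom \<sigma>" "card (dom \<sigma>) = n + 0" "card {..<n} = n"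
      using dom by auto
    have sub: "I \<sigma> \<subseteq> {..<n}" unfolding dom[symmetric] by (auto simp: I_def)
    have finI: "finite (I \<sigma>)" by (rule finite_subset[OF sub]) simp
    let ?M = "4 / 3 * real n ^ 3 * (7 / 8) + real n ^ 2"
    have "bad_density (real n / n) (real 0 / n) = 1 / 8" using \<open>n > 0\<close> by (simp add: bad_density_def)
    then have M: "real (card (pair_clauses n {..<n} \<sigma>)) \<le> ?M"
      using real_card_pair_clauses[OF d(1,2) \<open>n > 0\<close> d(4,3)] by (simp only:) simp
    have h: "real (card (pair_clauses n {..<n} \<sigma> \<inter> constraining {..<n} \<sigma> i)) \<le> real n ^ 2 / 2" if "i \<in> I \<sigma>" for i
    proof -
      have i: "i \<in> {..<n}" "i \<in> dom \<sigma>" using that sub dom by auto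
      have "card (pair_clauses n {..<n} \<sigma> \<inter> constraining {..<n} \<sigma> i) \<le> (n - 1) choose 2"
        using card_constraining[OF d(1,2) i(2)] i(1) by simp
      then have "real (card (pair_clauses n {..<n} \<sigma> \<inter> constraining {..<n} \<sigma> i)) \<le> real ((n - 1) choose 2)"
        by simp
      also have "\<dots> \<le> real n ^ 2 / 2"
        using \<open>n > 0\<close> by (simp add: real_choose_2 of_nat_diff power2_eq_square algebra_simps)
      finally show ?thesis .
    qed
    have "real (card (?E \<sigma>)) = (\<Sum>\<phi>\<in>?E \<sigma>. W \<sigma> \<phi>)" by simp
    also have "\<dots> \<le> (\<Sum>\<phi>\<in>?A \<sigma>. W \<sigma> \<phi>)"
      by (rule sum_mono2[OF finA]) (auto simp: W_def intro!: occupancy_weight_nonneg)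
    also have "\<dots> \<le> fact m / Y ^ m * (exp (Y * ?M) * (\<Prod>i\<in>I \<sigma>. 1 - (1 - 0) * exp (- Y * (real n ^ 2 / 2))))"
      unfolding W_def
      by (rule occupancy_bound[OF finI finite_pair_clauses disjoint_constraining Y]) (use h M in auto)
    also have "(\<Prod>i\<in>I \<sigma>. 1 - (1 - 0) * exp (- Y * (real n ^ 2 / 2))) = x ^ card (I \<sigma>)"
      using \<open>n > 0\<close> by (simp add: x_def Y_def)
    also have "fact m / Y ^ m * (exp (Y * ?M) * x ^ card (I \<sigma>)) \<le> C * x ^ card (I \<sigma>)"
    proof -
      have "Y * ?M = 7 / 8 * y * n + 3 / 4 * y"
        using \<open>n > 0\<close> by (simp add: Y_def field_simps power2_eq_square power3_eq_cube)
      then have "exp (Y * ?M) \<le> exp (7 / 8 * y * n + y)" using \<open>y > 0\<close> by simp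
      then have "fact m / Y ^ m * exp (Y * ?M) \<le> C"
        unfolding C_def using Y by (intro mult_left_mono) auto
      from mult_right_mono[OF this, of "x ^ card (I \<sigma>)"] show ?thesis using x by (simp only: mult.assoc zero_le_power)
    qed
    finally show "real (card (?E \<sigma>)) \<le> C * x ^ card (I \<sigma>)" .
  qed
  also have "\<dots> = C * (\<Sum>\<sigma>\<in>P. x ^ card (I \<sigma>))" by (rule sum_distrib_left[symmetric])
  also have "(\<Sum>\<sigma>\<in>P. x ^ card (I \<sigma>)) = (\<Sum>U\<in>I ` P. x ^ card U)"
  proof -
    have "inj_on I P"
    proof (rule inj_onI)
      fix \<sigma> \<tau> assume *: "\<sigma> \<in> P" "\<tau> \<in> P" "I \<sigma> = I \<tau>"
      show "\<sigma> = \<tau>"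
      proof
        fix i
        have "dom \<sigma> = dom \<tau>" using *(1,2) by (simp add: P_def)
        then have "\<sigma> i = None \<longleftrightarrow> \<tau> i = None" by (metis domIff)
        moreover have "\<sigma> i = Some False \<longleftrightarrow> \<tau> i = Some False" using *(3) unfolding I_def by blast
        ultimately show "\<sigma> i = \<tau> i" by (cases "\<sigma> i"; cases "\<tau> i") auto
      qed
    qed
    then show ?thesis by (simp add: sum.reindex)
  qed
  also have "C * (\<Sum>U\<in>I ` P. x ^ card U) \<le> C * (\<Sum>U\<in>Pow {..<n}. x ^ card U)"
  proof (intro mult_left_mono[OF _ C] sum_mono2)
    show "I ` P \<subseteq> Pow {..<n}"
    proof clarify
      fix \<sigma> i assume "\<sigma> \<in> P" "i \<in> I \<sigma>"
      then have "i \<in> dom \<sigma>" "dom \<sigma> = {..<n}" by (auto simp: P_def I_def)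
      then show "i < n" by simp
    qed
  qed (use x in auto)
  also have "(\<Sum>U\<in>Pow {..<n}. x ^ card U) = (\<Prod>i<n. x + 1)"
    by (subst prod_add) simp_all
  also have "\<dots> = (2 - exp (- (3 / 8 * y))) ^ n" by (simp add: x_def)
  finally show ?thesis by (simp only: C_def Y_def mult.assoc)
qed

section \<open>Exponential rates\<close>

text \<open>Stirling's upper bound \<open>fact m \<le> e * sqrt m * (m / e) ^ m\<close>. The
  induction step is \<open>(2 * m + 1) * ln (1 + 1 / m) \<ge> 2\<close>, from the first term of the
  artanh series.\<close>

lemma ln_fact_le: "m \<ge> 1 \<Longrightarrow> ln (fact m :: real) \<le> 1 + ln m / 2 + m * ln m - m"
proof (induction m rule: dec_induct)
  case (step m)
  define l where "l = ln (real m + 1) - ln (real m)"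
  have m: "real m > 0" using step by simp
  have "(real m + 1) / m > 1" using m by (simp add: field_simps)
  from ln_approx_bounds(1)[OF this, of 1]
  have "2 * (((real m + 1) / m - 1) / ((real m + 1) / m + 1)) \<le> ln ((real m + 1) / m)" by simp
  moreover have "((real m + 1) / m - 1) / ((real m + 1) / m + 1) = 1 / (2 * real m + 1)"
    using m by (simp add: field_simps)
  moreover have "ln ((real m + 1) / m) = l" using m by (simp add: ln_div l_def)
  ultimately have "2 / (2 * real m + 1) \<le> l" by simp
  then have "(2 * real m + 1) * (2 / (2 * real m + 1)) \<le> (2 * real m + 1) * l"
    by (rule mult_left_mono) simp
  also have "(2 * real m + 1) * (2 / (2 * real m + 1)) = 2"
    using m by (simp add: divide_eq_eq)
  finally have "2 \<le> (2 * real m + 1) * l" .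
  moreover have "ln (fact (Suc m) :: real) = ln (real m + 1) + ln (fact m)"
    using m by (simp add: ln_mult add.commute del: of_nat_Suc)
  ultimately show ?case using step.IH by (simp add: l_def algebra_simps)
qed simp

text \<open>Replacing the exact clause count \<open>4 / 3 * n * (n - 1) * (n - 2)\<close> by
  \<open>4 / 3 * n ^ 3\<close> costs at most \<open>(1 - 3 / n) ^ m\<close> in the denominator,
  hence a factor \<open>exp (6 * m / n)\<close>, which stays bounded with the density.\<close>

lemma fact_div_le:
  assumes "m \<ge> 1" "n \<ge> 6" "y > 0"
  shows "fact m / (3 * y / (4 * real n ^ 2)) ^ m / real (8 * (n choose 3)) ^ m
    \<le> sqrt m * exp (1 + 6 * (m / n) + n * (m / n * ln (m / n / y) - m / n))"
proof -
  define N where "N = real n"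
  define x where "x = y * (N - 1) * (N - 2) / N"
  have N: "N \<ge> 6" using assms(2) by (simp add: N_def)
  have m: "real m > 0" using assms(1) by simp
  have x0: "x > 0" using N assms(3) by (simp add: x_def)
  have "3 * y / (4 * real n ^ 2) * real (8 * (n choose 3)) = x"
    using N by (simp add: real_choose_3 x_def power2_eq_square flip: N_def)
  then have "fact m / (3 * y / (4 * real n ^ 2)) ^ m / real (8 * (n choose 3)) ^ m = fact m / x ^ m"
    by (simp add: power_mult_distrib[symmetric] del: of_nat_mult)
  also have "\<dots> = exp (ln (fact m) - m * ln x)"
    using x0 by (simp add: exp_diff exp_of_nat_mult)
  also have "\<dots> \<le> exp (ln m / 2 + (1 + 6 * (m / N) + N * (m / N * ln (m / N / y) - m / N)))"
  proof -
    have "- (3 / N) - 2 * (3 / N) ^ 2 \<le> ln (1 - 3 / N)"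
      by (rule ln_one_minus_pos_lower_bound) (use N in \<open>simp_all add: field_simps\<close>)
    moreover have "2 * (3 / N) ^ 2 \<le> 3 / N" using N by (simp add: field_simps power2_eq_square)
    ultimately have "- 6 / N \<le> ln (1 - 3 / N)" by simp
    also have "ln (1 - 3 / N) \<le> ln (x / (y * N))"
    proof -
      have "1 - 3 / N \<le> x / (y * N)" using N assms(3) by (simp add: x_def field_simps)
      moreover have "0 < 1 - 3 / N" using N by (simp add: field_simps)
      ultimately show ?thesis by (intro ln_mono)
    qed
    also have "\<dots> = ln x - ln (y * N)" using x0 N assms(3) by (subst ln_div) auto
    finally have "ln (y * N) - 6 / N \<le> ln x" by simp
    then have le: "m * (ln (y * N) - 6 / N) \<le> m * ln x" by (intro mult_left_mono) auto
    have e: "ln (m / N / y) = ln m - ln (y * N)"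
      using m N assms(3) by (simp add: ln_div ln_mult)
    have "ln (fact m :: real) - m * ln x \<le> (1 + ln m / 2 + m * ln m - m) - m * (ln (y * N) - 6 / N)"
      by (rule diff_mono[OF ln_fact_le[OF assms(1)] le])
    also have "\<dots> = ln m / 2 + (1 + 6 * (m / N) + (m * ln (m / N / y) - m))"
      unfolding e by (simp add: algebra_simps)
    finally have "ln (fact m :: real) - m * ln x \<le> \<dots>" .
    moreover have "N * (m / N * ln (m / N / y) - m / N) = m * ln (m / N / y) - m"
      using N by (simp add: field_simps)
    ultimately show ?thesis by simp
  qed
  also have "\<dots> = sqrt m * exp (1 + 6 * (m / N) + N * (m / N * ln (m / N / y) - m / N))"
  proof -
    have "exp (ln m / 2) = sqrt m" using m by (simp flip: ln_sqrt)
    then show ?thesis by (simp only: exp_add)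
  qed
  finally show ?thesis by (simp only: N_def)
qed

text \<open>The left side is one term of the binomial expansion of \<open>(k + (n - k)) ^ n\<close>.
  This gives the entropy bound without a polynomial factor.\<close>

lemma choose_self_power_le: "k \<le> n \<Longrightarrow> real (n choose k) * (real k ^ k * real (n - k) ^ (n - k)) \<le> real n ^ n"
proof -
  assume k: "k \<le> n"
  have "real (n choose k) * real k ^ k * real (n - k) ^ (n - k)
      \<le> (\<Sum>i\<le>n. real (n choose i) * real k ^ i * real (n - k) ^ (n - i))"
    using k by (intro member_le_sum[of k "{..n}" "\<lambda>i. real (n choose i) * real k ^ i * real (n - k) ^ (n - i)"]) auto
  also have "\<dots> = (real k + real (n - k)) ^ n" by (rule binomial_ring[symmetric])
  also have "real k + real (n - k) = real n" using k by simp
  finally show ?thesis by (simp add: mult.assoc)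
qed

text \<open>At \<open>k = 0\<close> the conventions \<open>0 ^ 0 = 1\<close> and
  \<open>0 * ln 0 = 0\<close> agree, so the entropy formulas hold for empty classes too.\<close>

lemma self_power_eq_exp: "real k ^ k = exp (k * ln k)"
  by (cases "k = 0") (simp_all add: exp_of_nat_mult)

lemma trinomial_le_exp:
  assumes "s + d \<le> n" "n > 0"
  shows "real (n choose (s + d)) * real ((s + d) choose s)
     \<le> exp (n * (- (s / n * ln (s / n)) - d / n * ln (d / n) - (1 - s / n - d / n) * ln (1 - s / n - d / n)))"
proof -
  define r where "r = n - (s + d)"
  have pos: "0 < real k ^ k" for k by (cases "k = 0") auto
  have 1: "real (n choose (s + d)) * (real (s + d) ^ (s + d) * real r ^ r) \<le> real n ^ n"
    unfolding r_def by (rule choose_self_power_le[OF assms(1)])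
  have 2: "real ((s + d) choose s) * (real s ^ s * real d ^ d) \<le> real (s + d) ^ (s + d)"
    using choose_self_power_le[of s "s + d"] by simp
  have "real (n choose (s + d)) * real ((s + d) choose s) * (real s ^ s * real d ^ d) * real r ^ r
      = real (n choose (s + d)) * (real ((s + d) choose s) * (real s ^ s * real d ^ d)) * real r ^ r"
    by (simp only: mult.assoc)
  also have "\<dots> \<le> real (n choose (s + d)) * real (s + d) ^ (s + d) * real r ^ r"
    by (intro mult_right_mono mult_left_mono 2) simp_all
  also have "\<dots> \<le> real n ^ n" using 1 by (simp only: mult.assoc)
  finally have "real (n choose (s + d)) * real ((s + d) choose s)
      \<le> real n ^ n / (real s ^ s * real d ^ d * real r ^ r)"
    using pos[of s] pos[of d] pos[of r] by (simp add: field_simps)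
  also have "\<dots> = exp (n * ln n - s * ln s - d * ln d - r * ln r)"
    by (simp add: self_power_eq_exp exp_diff field_simps flip: exp_add)
  also have "n * ln n - s * ln s - d * ln d - r * ln r
      = n * (- (s / n * ln (s / n)) - d / n * ln (d / n) - r / n * ln (r / n))"
  proof -
    have k: "real k * ln (k / n) = k * ln k - k * ln n" for k
      using assms(2) by (cases "k = 0") (simp_all add: ln_div algebra_simps)
    have "real n = real s + real d + real r" using assms by (simp add: r_def)
    then have "n * ln n = s * ln n + d * ln n + r * ln n" by (metis distrib_right)
    moreover have "n * (- (s / n * ln (s / n)) - d / n * ln (d / n) - r / n * ln (r / n))
        = - (s * ln (s / n)) - d * ln (d / n) - r * ln (r / n)"
      using assms(2) by (simp add: algebra_simps)
    ultimately show ?thesis by (simp add: k)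
  qed
  also have "real r / n = 1 - s / n - d / n"
    using assms by (simp add: r_def of_nat_diff field_simps)
  finally show ?thesis .
qed

text \<open>Logarithm per variable of one term of the sum over pairs, divided by the number of
  formulas. In order: entropy of the split into core, extension and unassigned variables; truth
  values and the factor of the unassigned variables; density and admissible clauses; requirements of
  the core and of the extension.\<close>

definition pair_exponent :: "real \<Rightarrow> real \<Rightarrow> real \<Rightarrow> real \<Rightarrow> real \<Rightarrow> real" where
  "pair_exponent y \<mu> \<rho> a d =
     - (a * ln a) - d * ln d - (1 - a - d) * ln (1 - a - d)
     + (a + d) * ln 2 + (1 - a - d) * ln (1 - \<rho>)
     + (\<mu> * ln (\<mu> / y) - \<mu>) + y * (1 - bad_density a d)
     + a * ln (1 - exp (- (3 / 8 * y * a ^ 2)))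
     + d * ln (1 - (1 - \<rho>) * exp (- (3 / 8 * y * ((a + d) ^ 2 - a ^ 2))))"

lemma pair_term_le:
  assumes "m \<ge> 1" "n \<ge> 6" "y > 0" "0 \<le> \<rho>" "\<rho> < 1" "s \<ge> 1" "s + d \<le> n"
  shows "real (n choose (s + d)) * real ((s + d) choose s) * 2 ^ (s + d) * (1 - \<rho>) ^ (n - (s + d))
      * pair_bound n m y \<rho> s d / real (8 * (n choose 3)) ^ m
    \<le> sqrt m * exp (1 + 6 * (m / n) + y) * exp (n * pair_exponent y (m / n) \<rho> (s / n) (d / n))"
proof -
  define a where "a = real s / n"
  define b where "b = real d / n"
  define r where "r = 1 - a - b"
  define \<mu> where "\<mu> = real m / n"
  define u where "u = 1 - exp (- (3 / 8 * y * a ^ 2))"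
  define v where "v = 1 - (1 - \<rho>) * exp (- (3 / 8 * y * ((a + b) ^ 2 - a ^ 2)))"
  have n: "real n > 0" using assms(2) by simp
  have a: "a > 0" and b: "b \<ge> 0" using assms n by (simp_all add: a_def b_def)
  have u: "u > 0" using a assms(3) by (simp add: u_def)
  have sa: "real s = n * a" and db: "real d = n * b" using n by (simp_all add: a_def b_def)
  have vd: "v ^ d \<le> exp (n * (b * ln v))"
  proof (cases "d = 0")
    case False
    then have "b > 0" using n by (simp add: b_def)
    then have "a ^ 2 < (a + b) ^ 2" using a by (intro power_strict_mono) auto
    then have "exp (- (3 / 8 * y * ((a + b) ^ 2 - a ^ 2))) < 1" using assms(3) by simp
    then have "(1 - \<rho>) * exp (- (3 / 8 * y * ((a + b) ^ 2 - a ^ 2))) < 1 * 1"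
      using assms(4,5) by (intro mult_le_less_imp_less) auto
    then have "v > 0" by (simp add: v_def)
    then have "v ^ d = exp (d * ln v)" by (simp add: exp_of_nat_mult)
    then show ?thesis by (simp add: db mult.assoc)
  qed (simp add: b_def)
  have v0: "0 \<le> v"
  proof -
    have "a ^ 2 \<le> (a + b) ^ 2" using a b by (intro power_mono) auto
    then have "exp (- (3 / 8 * y * ((a + b) ^ 2 - a ^ 2))) \<le> 1" using assms(3) by simp
    then have "(1 - \<rho>) * exp (- (3 / 8 * y * ((a + b) ^ 2 - a ^ 2))) \<le> 1 * 1"
      using assms(4,5) by (intro mult_mono) auto
    then show ?thesis by (simp add: v_def)
  qed
  have us: "u ^ s = exp (n * (a * ln u))"
    using u by (simp add: sa[symmetric] exp_of_nat_mult mult.assoc[symmetric])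
  have two: "2 ^ (s + d) = exp (n * ((a + b) * ln 2))"
  proof -
    have "n * ((a + b) * ln 2) = real (s + d) * ln 2" by (simp add: sa db algebra_simps)
    then show ?thesis by (simp only: exp_of_nat_mult) simp
  qed
  have stars: "(1 - \<rho>) ^ (n - (s + d)) = exp (n * (r * ln (1 - \<rho>)))"
  proof -
    have "real (n - (s + d)) = n * r" using assms(7) by (simp add: of_nat_diff sa db r_def algebra_simps)
    then have "n * (r * ln (1 - \<rho>)) = real (n - (s + d)) * ln (1 - \<rho>)" by simp
    then show ?thesis using assms(5) by (simp only: exp_of_nat_mult) simp
  qed
  have "real (n choose (s + d)) * real ((s + d) choose s) * 2 ^ (s + d) * (1 - \<rho>) ^ (n - (s + d))
      * pair_bound n m y \<rho> s d / real (8 * (n choose 3)) ^ m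
    = (real (n choose (s + d)) * real ((s + d) choose s)) * 2 ^ (s + d) * (1 - \<rho>) ^ (n - (s + d))
      * (fact m / (3 * y / (4 * real n ^ 2)) ^ m / real (8 * (n choose 3)) ^ m)
      * exp (y * n * (1 - bad_density a b) + y) * u ^ s * v ^ d"
    by (simp only: pair_bound_def a_def b_def u_def v_def times_divide_eq_left times_divide_eq_right mult.assoc)
  also have "\<dots> \<le> exp (n * (- (a * ln a) - b * ln b - r * ln r)) * exp (n * ((a + b) * ln 2)) * exp (n * (r * ln (1 - \<rho>)))
      * (sqrt m * exp (1 + 6 * \<mu> + n * (\<mu> * ln (\<mu> / y) - \<mu>)))
      * exp (y * n * (1 - bad_density a b) + y) * exp (n * (a * ln u)) * exp (n * (b * ln v))"
    unfolding two stars us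
    by (intro mult_mono mult_nonneg_nonneg vd)
      (use trinomial_le_exp[OF assms(7)] n fact_div_le[OF assms(1-3)] v0 assms(3)
       in \<open>simp_all add: a_def b_def r_def \<mu>_def\<close>)
  also have "\<dots> = sqrt m * exp (1 + 6 * \<mu> + y) * exp (n * pair_exponent y \<mu> \<rho> a b)"
    unfolding pair_exponent_def r_def u_def v_def
    by (simp add: exp_add[symmetric] algebra_simps)
  finally show ?thesis by (simp only: a_def b_def \<mu>_def)
qed

lemma sat_prob_le:
  assumes "m \<ge> 1" "n \<ge> 6" "y > 0"
  shows "real (card (sat_event n m)) / real (8 * (n choose 3)) ^ m
    \<le> sqrt m * exp (1 + 6 * (m / n) + y) * exp (n * (m / n * ln (m / n / y) - m / n + 7 / 8 * y
        + ln (2 - exp (- (3 / 8 * y)))))"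
proof -
  have "exp (- (3 / 8 * y)) \<le> 1" using assms(3) by simp
  then have p: "2 - exp (- (3 / 8 * y)) > 0" by linarith
  have "real (card (sat_event n m)) / real (8 * (n choose 3)) ^ m
      \<le> (fact m / (3 * y / (4 * real n ^ 2)) ^ m * (exp (7 / 8 * y * n + y) * (2 - exp (- (3 / 8 * y))) ^ n))
        / real (8 * (n choose 3)) ^ m"
    using card_sat_event_le[of n y m] assms by (intro divide_right_mono) auto
  also have "\<dots> = (fact m / (3 * y / (4 * real n ^ 2)) ^ m / real (8 * (n choose 3)) ^ m)
      * (exp (7 / 8 * y * n + y) * exp (n * ln (2 - exp (- (3 / 8 * y)))))"
    using p by (simp add: exp_of_nat_mult)
  also have "\<dots> \<le> (sqrt m * exp (1 + 6 * (m / n) + n * (m / n * ln (m / n / y) - m / n)))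
      * (exp (7 / 8 * y * n + y) * exp (n * ln (2 - exp (- (3 / 8 * y)))))"
    by (intro mult_right_mono fact_div_le assms) simp
  also have "\<dots> = sqrt m * exp (1 + 6 * (m / n) + y) * exp (n * (m / n * ln (m / n / y) - m / n + 7 / 8 * y
        + ln (2 - exp (- (3 / 8 * y)))))"
    by (simp add: exp_add[symmetric] algebra_simps)
  finally show ?thesis .
qed

section \<open>Elementary upper bounds for the logarithms in the exponent\<close>

lemma fact_ge_power_6: "6 ^ k * fact k \<le> (fact (2 * k + 1) :: real)"
proof (induction k)
  case (Suc k)
  have "(6::real) ^ Suc k * fact (Suc k) = (6 * (real k + 1)) * (6 ^ k * fact k)"
    by (simp add: algebra_simps)
  also have "\<dots> \<le> ((2 * real k + 2) * (2 * real k + 3)) * fact (2 * k + 1)"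
  proof (rule mult_mono[OF _ Suc.IH])
    show "6 * (real k + 1) \<le> (2 * real k + 2) * (2 * real k + 3)" by (simp add: algebra_simps)
  qed auto
  also have "\<dots> = fact (2 * Suc k + 1)" by (simp add: algebra_simps)
  finally show ?case .
qed simp

text \<open>Termwise comparison of the power series, using
  \<open>6 ^ k * fact k \<le> fact (2 * k + 1)\<close>.\<close>

lemma sinh_le:
  assumes "x \<ge> 0"
  shows "sinh x \<le> x * exp (x ^ 2 / 6 :: real)"
proof -
  let ?f = "\<lambda>n. if even n then 0 else x ^ n /\<^sub>R fact n"
  have inj: "strict_mono (\<lambda>k::nat. 2 * k + 1)" by (auto simp: strict_mono_def)
  have zero: "?f n = 0" if "n \<notin> range (\<lambda>k. 2 * k + 1)" for n
    using that by (auto elim!: oddE)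
  have A: "(\<lambda>k. ?f (2 * k + 1)) sums sinh x"
    using sums_mono_reindex[OF inj, of ?f, OF zero, THEN iffD2, OF _ sinh_converges] .
  have B: "(\<lambda>k. x * ((x ^ 2 / 6) ^ k /\<^sub>R fact k)) sums (x * exp (x ^ 2 / 6))"
    by (intro sums_mult exp_converges)
  have C: "?f (2 * k + 1) \<le> x * ((x ^ 2 / 6) ^ k /\<^sub>R fact k)" for k
  proof -
    have "x ^ (2 * k + 1) / fact (2 * k + 1) \<le> x ^ (2 * k + 1) / (6 ^ k * fact k)"
      using assms by (intro divide_left_mono fact_ge_power_6) auto
    also have "\<dots> = x * ((x ^ 2 / 6) ^ k /\<^sub>R fact k)"
      unfolding power_divide power_mult[symmetric] by (simp add: divide_inverse)
    finally have "x ^ (2 * k + 1) / fact (2 * k + 1) \<le> x * ((x ^ 2 / 6) ^ k /\<^sub>R fact k)" .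
    moreover have "?f (2 * k + 1) = x ^ (2 * k + 1) / fact (2 * k + 1)"
      by (simp add: divide_inverse mult.commute del: fact_Suc power_Suc)
    ultimately show ?thesis by (simp only:)
  qed
  show ?thesis by (rule sums_le[OF C A B])
qed

text \<open>From \<open>1 - exp (- x) = 2 * exp (- (x / 2)) * sinh (x / 2)\<close>. The bound keeps
  the exact \<open>ln x\<close>: with \<open>x\<close> proportional to \<open>a ^ 2\<close> it turns
  the entropy term \<open>- a * ln a\<close> into the convex \<open>a * ln a\<close>.\<close>

lemma ln_one_minus_exp_le:
  assumes "x > 0"
  shows "ln (1 - exp (- x)) \<le> ln x - x / 2 + x ^ 2 / (24 :: real)"
proof -
  have "1 - exp (- x) = 2 * exp (- (x / 2)) * sinh (x / 2)"
    by (simp add: sinh_def right_diff_distrib flip: exp_add)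
  also have "\<dots> \<le> 2 * exp (- (x / 2)) * (x / 2 * exp ((x / 2) ^ 2 / 6))"
    using assms by (intro mult_left_mono sinh_le) auto
  also have "\<dots> = exp (ln x - x / 2 + x ^ 2 / 24)"
  proof -
    have "exp (ln x - x / 2 + x ^ 2 / 24) = exp (ln x) * exp (- (x / 2)) * exp (x ^ 2 / 24)"
      by (simp flip: exp_add)
    then show ?thesis using assms by (simp add: power_divide)
  qed
  finally have "1 - exp (- x) \<le> exp (ln x - x / 2 + x ^ 2 / 24)" .
  moreover have "0 < 1 - exp (- x)" using assms by simp
  ultimately show ?thesis by (metis ln_exp ln_mono)
qed

text \<open>Gibbs' inequality for the weights \<open>1 / (1 + w)\<close> and \<open>w / (1 + w)\<close>; it is sharp for
  \<open>w = (1 - \<rho>) / (exp x - 1 + \<rho>)\<close>.\<close>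

lemma ln_one_minus_scaled_exp_le:
  fixes x w \<rho> :: real
  assumes "w > 0" "\<rho> < 1" "(1 - \<rho>) * exp (- x) < 1"
  shows "ln (1 - (1 - \<rho>) * exp (- x)) \<le> w * x + w * ln w - (1 + w) * ln (1 + w) - w * ln (1 - \<rho>)"
proof -
  define q where "q = (1 - \<rho>) * exp (- x)"
  have q: "0 < q" "q < 1" using assms by (simp_all add: q_def)
  have "ln ((1 - q) * (1 + w)) \<le> (1 - q) * (1 + w) - 1"
    using q assms by (intro ln_le_minus_one) simp
  moreover have "w * ln (q * (1 + w) / w) \<le> w * (q * (1 + w) / w - 1)"
    using q assms by (intro mult_left_mono ln_le_minus_one) auto
  moreover have "w * (q * (1 + w) / w - 1) = q * (1 + w) - w" using assms by (simp add: field_simps)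
  moreover have "ln ((1 - q) * (1 + w)) = ln (1 - q) + ln (1 + w)"
    using q assms by (simp add: ln_mult)
  moreover have "ln (q * (1 + w) / w) = ln (1 - \<rho>) - x + ln (1 + w) - ln w"
    using q assms by (simp add: ln_mult ln_div q_def)
  ultimately have "ln (1 - q) + ln (1 + w) + w * (ln (1 - \<rho>) - x + ln (1 + w) - ln w)
      \<le> (1 - q) * (1 + w) - 1 + (q * (1 + w) - w)" by simp
  then show ?thesis unfolding q_def[symmetric] by (simp add: algebra_simps)
qed

text \<open>The tangent at \<open>t\<close> of a concave function.\<close>

lemma neg_entropy_le:
  fixes x t :: real
  assumes "x \<ge> 0" "t > 0"
  shows "- (x * ln x) \<le> - (x * ln t) + t - x"
proof (cases "x = 0")
  case False
  then have "x > 0" using assms by simp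
  then have "x * ln (t / x) \<le> x * (t / x - 1)" using assms by (intro mult_left_mono ln_le_minus_one) auto
  then show ?thesis using \<open>x > 0\<close> assms by (simp add: ln_div right_diff_distrib)
qed (use assms in simp)

lemma rate_antimono:
  fixes \<mu> \<mu>0 y :: real
  assumes "0 < \<mu>0" "\<mu>0 \<le> \<mu>" "\<mu> \<le> y"
  shows "\<mu> * ln (\<mu> / y) - \<mu> \<le> \<mu>0 * ln (\<mu>0 / y) - \<mu>0"
proof (rule DERIV_nonpos_imp_nonincreasing[OF assms(2)])
  fix x assume x: "\<mu>0 \<le> x" "x \<le> \<mu>"
  have y: "y > 0" using assms by simp
  have "((\<lambda>x. x * ln (x / y) - x) has_real_derivative ln (x / y)) (at x)"
    using x assms y by (auto intro!: derivative_eq_intros)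
  moreover have "ln (x / y) \<le> 0" using x assms y by simp
  ultimately show "\<exists>z. ((\<lambda>x. x * ln (x / y) - x) has_real_derivative z) (at x) \<and> z \<le> 0" by blast
qed

text \<open>An upper bound, with the denominator of the integer check, for
  \<open>4.453 * ln (4.453 / 4.75) - 4.453 + 4.75\<close>, the density term at its worst
  density.\<close>

definition rate_const :: real where
  "rate_const = 10184408 / 2 ^ 30"

lemma rate_le_rate_const:
  assumes "4.453 \<le> \<mu>" "\<mu> \<le> 19 / 4"
  shows "\<mu> * ln (\<mu> / (19 / 4)) - \<mu> + 19 / 4 \<le> rate_const"
proof -
  have "\<mu> * ln (\<mu> / (19 / 4)) - \<mu> \<le> 4.453 * ln (4.453 / (19 / 4)) - 4.453"
    by (rule rate_antimono) (use assms in auto)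
  moreover have "ln (4750 / 4453 :: real) \<ge> (\<Sum>k<3. 2 * (297 / 9203) ^ (2 * k + 1) / of_nat (2 * k + 1))"
    using ln_approx_bounds[of "4750 / 4453 :: real" 3] by simp
  then have "ln (4750 / 4453 :: real) \<ge> 2 * (297 / 9203) + 2 * (297 / 9203) ^ 3 / 3 + 2 * (297 / 9203) ^ 5 / 5"
    by (simp add: eval_nat_numeral)
  moreover have "ln (4.453 / (19 / 4) :: real) = - ln (4750 / 4453)"
    by (simp flip: ln_inverse)
  ultimately show ?thesis by (simp add: rate_const_def power_divide)
qed

text \<open>A majorant of \<open>pair_exponent\<close> that is linear in the logarithms of the free parameters
  \<open>t\<close>, \<open>u\<close>, \<open>w\<close> and, for these fixed, convex in each of \<open>a\<close> and \<open>d\<close> where it is used.\<close>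

definition majorant :: "real \<Rightarrow> real \<Rightarrow> real \<Rightarrow> real \<Rightarrow> real \<Rightarrow> real \<Rightarrow> real" where
  "majorant \<rho> t u w a d = rate_const + a * ln (57 / 16) + a * ln a - 57 / 16 * a ^ 2 + 133 / 64 * a ^ 3
     + 1083 / 8192 * a ^ 5 + d * (ln 2 - ln t) + t - d
     - (1 - a - d) * ln u + u - (1 - a - d) + (1 - a - d) * ln (1 - \<rho>)
     - 19 / 4 * (3 / 2 * a * d + 3 / 4 * d ^ 2 - 3 / 2 * a ^ 2 * d - 9 / 8 * a * d ^ 2 - d ^ 3 / 4)
     + d * (w * ln w - (1 + w) * ln (1 + w) - w * ln (1 - \<rho>) + (1 + w) * (57 / 32) * d * (2 * a + d))"

text \<open>Tangents at \<open>t\<close> and \<open>u\<close> bound the entropies of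
  \<open>d\<close> and of the unassigned fraction, Gibbs' inequality bounds the requirements of the
  extension, and the sinh bound those of the core. In the last, \<open>2 * ln a\<close> outweighs
  the \<open>- ln a\<close> of the entropy, so \<open>a * ln a\<close> survives. The recurring 57/32
  is \<open>3 / 8 * 19 / 4\<close>.\<close>

lemma pair_exponent_le_majorant:
  assumes \<mu>: "4.453 \<le> \<mu>" "\<mu> \<le> 19 / 4" and \<rho>: "0 \<le> \<rho>" "\<rho> < 1"
    and a: "0 < a" and d: "0 \<le> d" "a + d \<le> 1" and tuw: "t > 0" "u > 0" "w > 0"
  shows "pair_exponent (19 / 4) \<mu> \<rho> a d \<le> majorant \<rho> t u w a d"
proof -
  define l1 where "l1 = 3 / 8 * (19 / 4) * a ^ 2"
  define l2 where "l2 = 3 / 8 * (19 / 4) * ((a + d) ^ 2 - a ^ 2)"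
  define k where "k = w * ln w - (1 + w) * ln (1 + w) - w * ln (1 - \<rho>)"
  have "l1 > 0" using a by (simp add: l1_def)
  then have "a * ln (1 - exp (- l1)) \<le> a * (ln l1 - l1 / 2 + l1 ^ 2 / 24)"
    using a by (intro mult_left_mono ln_one_minus_exp_le) auto
  moreover have "ln l1 = ln (57 / 32) + 2 * ln a"
  proof -
    have "l1 = 57 / 32 * (a * a)" by (simp add: l1_def power2_eq_square)
    moreover have "ln (57 / 32 * (a * a)) = ln (57 / 32) + (ln a + ln a)"
      using a by (subst ln_mult_pos) (simp_all add: ln_mult_pos)
    ultimately show ?thesis by (simp only:)
  qed
  ultimately have core: "a * ln (1 - exp (- l1)) \<le> a * ln (57 / 32) + 2 * (a * ln a) + a * (- l1 / 2 + l1 ^ 2 / 24)"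
    by (simp add: algebra_simps)
  have ext: "d * ln (1 - (1 - \<rho>) * exp (- l2)) \<le> d * (k + w * l2)"
  proof (cases "d = 0")
    case False
    then have "a ^ 2 < (a + d) ^ 2" using a d by (intro power_strict_mono) auto
    then have "exp (- l2) < 1" by (simp add: l2_def)
    then have "(1 - \<rho>) * exp (- l2) < 1 * 1" using \<rho> by (intro mult_le_less_imp_less) auto
    then have "ln (1 - (1 - \<rho>) * exp (- l2)) \<le> w * l2 + w * ln w - (1 + w) * ln (1 + w) - w * ln (1 - \<rho>)"
      using tuw \<rho> by (intro ln_one_minus_scaled_exp_le) auto
    also have "\<dots> = k + w * l2" by (simp add: k_def)
    finally show ?thesis using d by (intro mult_left_mono)
  qed simp
  have e1: "- (d * ln d) \<le> - (d * ln t) + t - d" using neg_entropy_le[of d t] d tuw by simp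
  have e2: "- ((1 - a - d) * ln (1 - a - d)) \<le> - ((1 - a - d) * ln u) + u - (1 - a - d)"
    using neg_entropy_le[of "1 - a - d" u] d tuw by simp
  have rate: "\<mu> * ln (\<mu> / (19 / 4)) - \<mu> + 19 / 4 \<le> rate_const"
    by (rule rate_le_rate_const[OF \<mu>])
  have ln57: "a * ln (57 / 16) = a * ln 2 + a * ln (57 / 32)"
  proof -
    have "ln (57 / 16 :: real) = ln 2 + ln (57 / 32)" by (subst ln_mult_pos[symmetric]) auto
    then show ?thesis by (simp add: distrib_left)
  qed
  have poly: "19 / 4 * (1 - bad_density a d) + a * (- l1 / 2 + l1 ^ 2 / 24) + d * (w * l2)
     = 19 / 4 - 57 / 16 * a ^ 2 + 133 / 64 * a ^ 3 + 1083 / 8192 * a ^ 5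
       - 19 / 4 * (3 / 2 * a * d + 3 / 4 * d ^ 2 - 3 / 2 * a ^ 2 * d - 9 / 8 * a * d ^ 2 - d ^ 3 / 4)
       + d * ((1 + w) * (57 / 32) * d * (2 * a + d))"
    unfolding bad_density_def l1_def l2_def by (simp add: eval_nat_numeral field_simps)
  have "pair_exponent (19 / 4) \<mu> \<rho> a d =
     - (a * ln a) - d * ln d - (1 - a - d) * ln (1 - a - d) + (a * ln 2 + d * ln 2)
     + (1 - a - d) * ln (1 - \<rho>) + (\<mu> * ln (\<mu> / (19 / 4)) - \<mu>) + 19 / 4 * (1 - bad_density a d)
     + a * ln (1 - exp (- l1)) + d * ln (1 - (1 - \<rho>) * exp (- l2))"
    unfolding pair_exponent_def l1_def l2_def by (simp add: distrib_right)
  also have "\<dots> \<le> (- (a * ln a) + 2 * (a * ln a)) + (- (d * ln t) + t - d)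
     + (- ((1 - a - d) * ln u) + u - (1 - a - d)) + (a * ln 2 + d * ln 2)
     + (1 - a - d) * ln (1 - \<rho>) + (rate_const - 19 / 4)
     + (19 / 4 * (1 - bad_density a d) + a * (- l1 / 2 + l1 ^ 2 / 24) + d * (w * l2))
     + a * ln (57 / 32) + d * k"
    using core ext e1 e2 rate by (simp add: distrib_left)
  also have "\<dots> = majorant \<rho> t u w a d"
    unfolding poly majorant_def k_def[symmetric] ln57 by (simp add: algebra_simps)
  finally show ?thesis .
qed

section \<open>Integer approximation of logarithms\<close>

definition ln_table :: "int list list" where
  "ln_table = [
    [0, 0, 744261118, 1179625963, 1488522236, 1728120800, 1923887081, 2089405113, 2232783354,
     2359251925, 2472381918, 2574720444, 2668148199, 2754093402, 2833666231, 2907746762,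
     2977044472, 3042139664, 3103513043, 3161567280, 3216643036, 3269031075, 3318981562,
     3366711279, 3412409317, 3456241599, 3498354520, 3538877888, 3577927349, 3615606366,
     3652007880, 3687215685],
    [3721305590, 3754346407, 3786400782, 3817525912, 3847774161, 3877193586, 3905828398,
     3933719364, 3960904154, 3987417644, 4013292193, 4038557873, 4063242680, 4087372725,
     4110972397, 4134064509, 4156670435, 4178810226, 4200502717, 4221765627, 4242615637,
     4263068481, 4283139006, 4302841244, 4322188467, 4341193243, 4359867484, 4378222492,
     4396268998, 4414017201, 4431476802, 4448657038],
    [4465566708, 4482214201, 4498607525, 4514754323, 4530661900, 4546337241, 4561787030,
     4577017666, 4592035279, 4606845746, 4621454704, 4635867562, 4650089516, 4664125557,
     4677980482, 4691658907, 4705165272, 4718503851, 4731678762, 4744693974, 4757553311,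
     4770260464, 4782818991, 4795232329, 4807503798, 4819636603, 4831633843, 4843498514,
     4855233514, 4866841647, 4878325626, 4889688080],
    [4900931552, 4912058510, 4923071344, 4933972369, 4944763835, 4955447922, 4966026744,
     4976502358, 4986876755, 4997151875, 5007329599, 5017411756, 5027400124, 5037296432,
     5047102362, 5056819549, 5066449585, 5075994019, 5085454361, 5094832078, 5104128602,
     5113345327, 5122483610, 5131544777, 5140530116, 5149440888, 5158278319, 5167043607,
     5175737920, 5184362399, 5192918156, 5201406278],
    [5209827826, 5218183835, 5226475319, 5234703266, 5242868643, 5250972393, 5259015440,
     5266998688, 5274923018, 5282789293, 5290598359, 5298351041, 5306048148, 5313690471,
     5321278784, 5328813846, 5336296397, 5343727166, 5351106864, 5358436188, 5365715822,
     5372946434, 5380128680, 5387263204, 5394350634, 5401391589, 5408386675, 5415336484,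
     5422241600, 5429102594, 5435920025, 5442694444],
    [5449426389, 5456116391, 5462764969, 5469372632, 5475939880, 5482467206, 5488955092,
     5495404011, 5501814429, 5508186803, 5514521581, 5520819206, 5527080109, 5533304716,
     5539493447, 5545646712, 5551764916, 5557848455, 5563897721, 5569913097, 5575894961,
     5581843684, 5587759632, 5593643164, 5599494632, 5605314386, 5611102765, 5616860108,
     5622586744, 5628283001, 5633949198, 5639585651],
    [5645192670, 5650770563, 5656319628, 5661840164, 5667332461, 5672796808, 5678233487,
     5683642777, 5689024953, 5694380285, 5699709040, 5705011479, 5710287862, 5715538444,
     5720763476, 5725963204, 5731137873, 5736287724, 5741412993, 5746513914, 5751590717,
     5756643629, 5761672874, 5766678672, 5771661242, 5776620797, 5781557550, 5786471709,
     5791363480, 5796233065, 5801080666, 5805906481],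
    [5810710703, 5815493525, 5820255137, 5824995727, 5829715479, 5834414575, 5839093196,
     5843751519, 5848389720, 5853007972, 5857606445, 5862185308, 5866744728, 5871284870,
     5875805895, 5880307963, 5884791234, 5889255864, 5893702006, 5898129814, 5902539437,
     5906931025, 5911304725, 5915660682, 5919999038, 5924319937, 5928623517, 5932909917,
     5937179274, 5941431723, 5945667396, 5949886426],
    [5954088944, 5958275077, 5962444953, 5966598699, 5970736437, 5974858292, 5978964384,
     5983054834, 5987129761, 5991189281, 5995233511, 5999262566, 6003276558, 6007275601,
     6011259806, 6015229281, 6019184136, 6023124477, 6027050411, 6030962043, 6034859477,
     6038742815, 6042612159, 6046467610, 6050309266, 6054137227, 6057951589, 6061752449,
     6065539902, 6069314043, 6073074963, 6076822757],
    [6080557515, 6084279328, 6087988284, 6091684473, 6095367982, 6099038898, 6102697306,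
     6106343292, 6109976940, 6113598332, 6117207552, 6120804680, 6124389798, 6127962985,
     6131524321, 6135073884, 6138611752, 6142138001, 6145652707, 6149155946, 6152647793,
     6156128320, 6159597602, 6163055711, 6166502718, 6169938695, 6173363712, 6176777838,
     6180181143, 6183573695, 6186955562, 6190326810],
    [6193687507, 6197037719, 6200377509, 6203706944, 6207026087, 6210335001, 6213633750,
     6216922395, 6220200998, 6223469621, 6226728324, 6229977167, 6233216210, 6236445511,
     6239665129, 6242875122, 6246075547, 6249266461, 6252447921, 6255619982, 6258782699,
     6261936129, 6265080324, 6268215338, 6271341227, 6274458041, 6277565834, 6280664658,
     6283754565, 6286835605, 6289907830, 6292971290],
    [6296026034, 6299072112, 6302109573, 6305138466, 6308158839, 6311170739, 6314174215,
     6317169313, 6320156079, 6323134560, 6326104802, 6329066851, 6332020750, 6334966546,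
     6337904282, 6340834002, 6343755750, 6346669570, 6349575504, 6352473594, 6355363883,
     6358246413, 6361121226, 6363988362, 6366847862, 6369699768, 6372544119, 6375380955,
     6378210316, 6381032241, 6383846769, 6386653938],
    [6389453788, 6392246356, 6395031681, 6397809798, 6400580746, 6403344562, 6406101282,
     6408850942, 6411593579, 6414329229, 6417057926, 6419779707, 6422494605, 6425202657,
     6427903895, 6430598356, 6433286071, 6435967076, 6438641403, 6441309086, 6443970158,
     6446624651, 6449272597, 6451914030, 6454548980, 6457177481, 6459799562, 6462415256,
     6465024593, 6467627605, 6470224322, 6472814774],
    [6475398991, 6477977004, 6480548842, 6483114535, 6485674111, 6488227601, 6490775032,
     6493316434, 6495851835, 6498381263, 6500904747, 6503422314, 6505933992, 6508439808,
     6510939790, 6513433965, 6515922360, 6518405001, 6520881915, 6523353129, 6525818668,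
     6528278559, 6530732827, 6533181498, 6535624598, 6538062151, 6540494183, 6542920720,
     6545341784, 6547757403, 6550167599, 6552572396],
    [6554971821, 6557365895, 6559754643, 6562138088, 6564516255, 6566889166, 6569256845,
     6571619314, 6573976597, 6576328716, 6578675693, 6581017552, 6583354314, 6585686002,
     6588012637, 6590334242, 6592650838, 6594962447, 6597269090, 6599570788, 6601867563,
     6604159435, 6606446426, 6608728556, 6611005846, 6613278317, 6615545988, 6617808880,
     6620067013, 6622320406, 6624569081, 6626813057],
    [6629052352, 6631286987, 6633516982, 6635742354, 6637963124, 6640179310, 6642390931,
     6644598007, 6646800555, 6648998594, 6651192143, 6653381220, 6655565843, 6657746030,
     6659921800, 6662093169, 6664260156, 6666422779, 6668581055, 6670735001, 6672884635,
     6675029974, 6677171035, 6679307836, 6681440392, 6683568721, 6685692840, 6687812766,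
     6689928514, 6692040101, 6694147544, 6696250859],
    [6698350062, 6700445168, 6702536195, 6704623157, 6706706071, 6708784953, 6710859817,
     6712930679, 6714997555, 6717060460, 6719119410, 6721174419, 6723225502, 6725272675,
     6727315952, 6729355348, 6731390878, 6733422557, 6735450399, 6737474418, 6739494629,
     6741511046, 6743523684, 6745532556, 6747537676, 6749539060, 6751536719, 6753530670,
     6755520924, 6757507496, 6759490399, 6761469647]
  ]"

text \<open>\<open>ln_approx k\<close> is \<open>2\<^sup>30 ln k\<close> rounded to an integer; the entry for \<open>k = 0\<close> is a dummy.\<close>

definition ln_approx :: "nat \<Rightarrow> int" where
  "ln_approx k = ln_table ! (k div 32) ! (k mod 32)"

lemma upt_32: "[0..<32] = [0,1,2,3,4,5,6,7,8,9,10,11,12,13,14,15,16,17,18,19,20,21,22,23,24,25,26,27,28,29,30,31::nat]"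
  by (simp add: upt_rec)

text \<open>Instantiated row by row, this gives the simplifier one rewrite rule per table entry
  instead of list indexing.\<close>

lemma ln_approx_row: "map (\<lambda>j. ln_approx (32 * i + j)) [0..<32] = ln_table ! i" if "length (ln_table ! i) = 32"
proof -
  have "map (\<lambda>j. ln_approx (32 * i + j)) [0..<32] = map ((!) (ln_table ! i)) [0..<32]"
    by (simp add: ln_approx_def)
  then show ?thesis using that by (metis map_nth)
qed

lemmas ln_approx_eval =
  ln_approx_row[of 0, unfolded upt_32 ln_table_def, simplified]
  ln_approx_row[of 1, unfolded upt_32 ln_table_def, simplified]
  ln_approx_row[of 2, unfolded upt_32 ln_table_def, simplified]
  ln_approx_row[of 3, unfolded upt_32 ln_table_def, simplified]
  ln_approx_row[of 4, unfolded upt_32 ln_table_def, simplified]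
  ln_approx_row[of 5, unfolded upt_32 ln_table_def, simplified]
  ln_approx_row[of 6, unfolded upt_32 ln_table_def, simplified]
  ln_approx_row[of 7, unfolded upt_32 ln_table_def, simplified]
  ln_approx_row[of 8, unfolded upt_32 ln_table_def, simplified]
  ln_approx_row[of 9, unfolded upt_32 ln_table_def, simplified]
  ln_approx_row[of 10, unfolded upt_32 ln_table_def, simplified]
  ln_approx_row[of 11, unfolded upt_32 ln_table_def, simplified]
  ln_approx_row[of 12, unfolded upt_32 ln_table_def, simplified]
  ln_approx_row[of 13, unfolded upt_32 ln_table_def, simplified]
  ln_approx_row[of 14, unfolded upt_32 ln_table_def, simplified]
  ln_approx_row[of 15, unfolded upt_32 ln_table_def, simplified]
  ln_approx_row[of 16, unfolded upt_32 ln_table_def, simplified]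

text \<open>With \<open>q = 2 * k + 1\<close> and denominators cleared: each increment of the table
  is within 1 of \<open>2 ^ 30 * (2 / q + 2 / (3 * q ^ 3))\<close>, the first two terms of the
  series for \<open>ln ((k + 1) / k)\<close>.\<close>

lemma ln_approx_step: "list_all (\<lambda>k. \<bar>(ln_approx (k + 1) - ln_approx k) * (3 * (2 * int k + 1) ^ 3)
    - (3 * (2 * int k + 1) ^ 2 + 1) * 2 ^ 31\<bar> \<le> 3 * (2 * int k + 1) ^ 3) [256..<512]"
  by (simp add: ln_approx_eval)

lemma ln_approx_double: "list_all (\<lambda>k. \<bar>ln_approx (2 * k) - ln_approx k - ln_approx 2\<bar> \<le> 2) (1 # [2..<256])"
  by (simp add: ln_approx_eval)

lemma ln_Suc_approx:
  assumes "k \<ge> 256"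
  shows "\<bar>ln (real (k + 1)) - ln (real k) - (2 / (2 * real k + 1) + 2 / (3 * (2 * real k + 1) ^ 3))\<bar> \<le> 1 / 2 ^ 40"
proof -
  define x where "x = real (k + 1) / real k"
  define z where "z = 1 / (2 * real k + 1)"
  have k: "real k \<ge> 256" using assms by simp
  have x1: "x > 1" using k by (simp add: x_def)
  have z: "(x - 1) / (x + 1) = z" using k by (simp add: x_def z_def field_simps)
  have zb: "0 < z" "z \<le> 1 / 513" using k by (auto simp: z_def field_simps)
  have "ln x \<in> {(\<Sum>j<2. 2 * z ^ (2 * j + 1) / of_nat (2 * j + 1))..
      (\<Sum>j<2. 2 * z ^ (2 * j + 1) / of_nat (2 * j + 1)) + 2 * (z ^ (2 * 2 + 1) / (1 - z ^ 2) / of_nat (2 * 2 + 1))}"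
    using ln_approx_bounds[OF x1, of 2] unfolding z .
  then have *: "2 * z + 2 * z ^ 3 / 3 \<le> ln x" "ln x \<le> 2 * z + 2 * z ^ 3 / 3 + 2 * (z ^ 5 / (1 - z ^ 2) / 5)"
    by (simp_all add: eval_nat_numeral)
  have "z ^ 2 \<le> (1 / 513) ^ 2" using zb by (intro power_mono) auto
  then have "1 - z ^ 2 \<ge> 1 / 2" by (simp add: power2_eq_square)
  then have "z ^ 5 / (1 - z ^ 2) \<le> z ^ 5 / (1 / 2)" using zb by (intro divide_left_mono) auto
  also have "\<dots> \<le> (1 / 513) ^ 5 / (1 / 2)" using zb by (intro divide_right_mono power_mono) auto
  finally have "2 * (z ^ 5 / (1 - z ^ 2) / 5) \<le> 2 * ((1 / 513) ^ 5 / (1 / 2) / 5)"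
    by (intro mult_left_mono divide_right_mono) auto
  also have "\<dots> \<le> 1 / 2 ^ 40" by (simp add: power_divide)
  finally have "2 * (z ^ 5 / (1 - z ^ 2) / 5) \<le> 1 / 2 ^ 40" .
  moreover have "ln x = ln (real (k + 1)) - ln (real k)" using k by (simp add: x_def ln_div)
  moreover have "2 * z + 2 * z ^ 3 / 3 = 2 / (2 * real k + 1) + 2 / (3 * (2 * real k + 1) ^ 3)"
    by (simp add: z_def power_divide)
  ultimately show ?thesis using * by linarith
qed

lemma ln_2_approx: "\<bar>2 ^ 30 * ln 2 - real_of_int (ln_approx 2)\<bar> \<le> 1"
proof -
  have "ln (2::real) \<in> {(\<Sum>j<9. 2 * (1 / 3) ^ (2 * j + 1) / of_nat (2 * j + 1))..
      (\<Sum>j<9. 2 * (1 / 3) ^ (2 * j + 1) / of_nat (2 * j + 1)) + 2 * ((1 / 3) ^ (2 * 9 + 1) / (1 - (1 / 3) ^ 2) / of_nat (2 * 9 + 1))}"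
    using ln_approx_bounds[of "2::real" 9] by simp
  moreover have e: "ln_approx 2 = 744261118" by (simp add: ln_approx_eval)
  ultimately show ?thesis unfolding e by (simp add: eval_nat_numeral abs_le_iff)
qed

text \<open>The error at 256, obtained from 8 times \<open>ln 2\<close>, is at most 12, below
  \<open>2 * (256 - 245) = 22\<close>; each step to the next integer adds at most 2.\<close>

lemma ln_approx_upper_half:
  assumes "256 \<le> k" "k \<le> 512"
  shows "\<bar>2 ^ 30 * ln (real k) - real_of_int (ln_approx k)\<bar> \<le> 2 * (real k - 245)"
  using assms
proof (induction k rule: dec_induct)
  case base
  have "(256::real) = 2 ^ 8" by simp
  then have "ln (256::real) = 8 * ln 2" by (simp only: ln_realpow[of 2 8])
  then have "2 ^ 30 * ln (real 256) - real_of_int (ln_approx 256)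
      = 8 * (2 ^ 30 * ln 2 - real_of_int (ln_approx 2)) + (8 * real_of_int (ln_approx 2) - real_of_int (ln_approx 256))"
    by simp
  also have "\<bar>\<dots>\<bar> \<le> 8 * 1 + 4"
    using ln_2_approx by (intro order_trans[OF abs_triangle_ineq] add_mono) (auto simp: abs_mult ln_approx_eval)
  finally show ?case by simp
next
  case (step k)
  define q where "q = 2 * real k + 1"
  have q: "q > 0" by (simp add: q_def)
  have "k \<in> set [256..<512]" unfolding set_upt atLeastLessThan_iff using step by simp
  then have "\<bar>(ln_approx (k + 1) - ln_approx k) * (3 * (2 * int k + 1) ^ 3)
      - (3 * (2 * int k + 1) ^ 2 + 1) * 2 ^ 31\<bar> \<le> 3 * (2 * int k + 1) ^ 3"
    using ln_approx_step unfolding list_all_iff by blast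
  then have "real_of_int \<bar>(ln_approx (k + 1) - ln_approx k) * (3 * (2 * int k + 1) ^ 3)
      - (3 * (2 * int k + 1) ^ 2 + 1) * 2 ^ 31\<bar> \<le> real_of_int (3 * (2 * int k + 1) ^ 3)"
    by (simp only: of_int_le_iff)
  then have "\<bar>(real_of_int (ln_approx (k + 1)) - real_of_int (ln_approx k)) * (3 * q ^ 3) - (3 * q ^ 2 + 1) * 2 ^ 31\<bar> \<le> 3 * q ^ 3"
    by (simp add: q_def)
  then have "\<bar>(real_of_int (ln_approx (k + 1)) - real_of_int (ln_approx k)) - (3 * q ^ 2 + 1) * 2 ^ 31 / (3 * q ^ 3)\<bar> * (3 * q ^ 3) \<le> 3 * q ^ 3"
    using q by (subst abs_mult_pos) (simp_all add: left_diff_distrib)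
  then have "\<bar>(real_of_int (ln_approx (k + 1)) - real_of_int (ln_approx k)) - (3 * q ^ 2 + 1) * 2 ^ 31 / (3 * q ^ 3)\<bar> \<le> 1"
    using q by simp
  moreover have "(3 * q ^ 2 + 1) * 2 ^ 31 / (3 * q ^ 3) = 2 ^ 30 * (2 / q + 2 / (3 * q ^ 3))"
    using q by (simp add: field_simps power2_eq_square power3_eq_cube)
  moreover have "\<bar>ln (real (k + 1)) - ln (real k) - (2 / q + 2 / (3 * q ^ 3))\<bar> \<le> 1 / 2 ^ 40"
    unfolding q_def by (rule ln_Suc_approx) (use step in simp)
  moreover have "\<bar>2 ^ 30 * ln (real k) - real_of_int (ln_approx k)\<bar> \<le> 2 * (real k - 245)"
    using step by simp
  moreover have "\<bar>2 ^ 30 * l1 - a1\<bar> \<le> E + 2"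
    if "\<bar>(a1 - a0) - P\<bar> \<le> 1" "P = 2 ^ 30 * p" "\<bar>l1 - l0 - p\<bar> \<le> 1 / 2 ^ 40" "\<bar>2 ^ 30 * l0 - a0\<bar> \<le> E"
    for a0 a1 l0 l1 p P E :: real
    using that by (simp add: abs_if split: if_splits)
  ultimately have "\<bar>2 ^ 30 * ln (real (k + 1)) - real_of_int (ln_approx (k + 1))\<bar> \<le> 2 * (real k - 245) + 2"
    by blast
  then show ?case by simp
qed

text \<open>Below 256 the entry is compared with the one at twice the argument, which adds an error
  of at most 2 + 1. The start 534 is \<open>2 * (512 - 245)\<close>, the worst error in the upper
  half.\<close>

lemma ln_approx_correct_aux:
  "256 \<le> k * 2 ^ j \<Longrightarrow> k \<le> 512 \<Longrightarrow> \<bar>2 ^ 30 * ln (real k) - real_of_int (ln_approx k)\<bar> \<le> 534 + 4 * real j"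
proof (induction j arbitrary: k)
  case 0
  then show ?case using ln_approx_upper_half[of k] by simp
next
  case (Suc j)
  show ?case
  proof (cases "256 \<le> k")
    case True
    then show ?thesis using ln_approx_upper_half[of k] Suc.prems by simp
  next
    case False
    have "0 < k" using Suc.prems(1) by (cases k) auto
    have "256 \<le> (2 * k) * 2 ^ j" using Suc.prems by (simp add: mult_ac)
    then have IH: "\<bar>2 ^ 30 * ln (real (2 * k)) - real_of_int (ln_approx (2 * k))\<bar> \<le> 534 + 4 * real j"
      using False by (intro Suc.IH) auto
    have "k \<in> set (1 # [2..<256])"
      unfolding list.set set_upt insert_iff atLeastLessThan_iff using False \<open>0 < k\<close> by linarith
    then have "\<bar>ln_approx (2 * k) - ln_approx k - ln_approx 2\<bar> \<le> 2"
      using ln_approx_double unfolding list_all_iff by blast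
    then have "real_of_int \<bar>ln_approx (2 * k) - ln_approx k - ln_approx 2\<bar> \<le> real_of_int 2"
      by (simp only: of_int_le_iff)
    then have "\<bar>real_of_int (ln_approx (2 * k)) - real_of_int (ln_approx k) - real_of_int (ln_approx 2)\<bar> \<le> 2"
      by simp
    moreover have "ln (real (2 * k)) = ln 2 + ln (real k)" using \<open>0 < k\<close> by (simp add: ln_mult)
    ultimately show ?thesis using IH ln_2_approx by (simp add: abs_le_iff distrib_left)
  qed
qed

text \<open>Eight doublings lift any \<open>k \<ge> 1\<close> to at least 256, and 534 + 32 is below
  \<open>2 ^ 10\<close>.\<close>

lemma ln_approx_correct:
  assumes "1 \<le> k" "k \<le> 512"
  shows "\<bar>ln (real k) - real_of_int (ln_approx k) / 2 ^ 30\<bar> \<le> 1 / 2 ^ 20"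
proof -
  have "\<bar>2 ^ 30 * ln (real k) - real_of_int (ln_approx k)\<bar> \<le> 534 + 4 * real 8"
    by (rule ln_approx_correct_aux) (use assms in auto)
  then show ?thesis by (simp add: abs_le_iff field_simps)
qed

lemma ln_bounds:
  assumes "1 \<le> k" "k \<le> 512"
  shows "ln (real k) \<le> real_of_int (ln_approx k) / 2 ^ 30 + 1 / 2 ^ 20"
    and "real_of_int (ln_approx k) / 2 ^ 30 - 1 / 2 ^ 20 \<le> ln (real k)"
  using ln_approx_correct[OF assms, unfolded abs_le_iff] by linarith+

section \<open>The majorant on a grid of cells\<close>

text \<open>Everything is measured in units of \<open>1 / 512\<close>, so that \<open>A\<close>, \<open>D\<close>, \<open>R\<close>, \<open>td\<close>, \<open>tr\<close> stand for the values
  \<open>a\<close>, \<open>d\<close>, \<open>\<rho>\<close>, \<open>t\<close>, \<open>u\<close> of the majorant, and \<open>w = k / W\<close>. The integer \<open>corner_val\<close> is \<open>2\<^sup>58 W\<close> times the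
  majorant computed with \<open>ln_approx\<close>, plus an allowance for the rounding of the logarithms.\<close>

definition base_val :: "nat \<Rightarrow> int" where
  "base_val A = 10184408 * 2 ^ 28 + int A * (ln_approx 57 - ln_approx 16 + ln_approx A - ln_approx 512) * 2 ^ 19
     - 57 * int A ^ 2 * 2 ^ 36 + 133 * int A ^ 3 * 2 ^ 25 + 1083 * int A ^ 5"

definition corner_val :: "int \<Rightarrow> int \<Rightarrow> int \<Rightarrow> int \<Rightarrow> int \<Rightarrow> int \<Rightarrow> int \<Rightarrow> int \<Rightarrow> int \<Rightarrow> int \<Rightarrow> int" where
  "corner_val pa A D td tr ld lr kp k W =
     W * pa + 2 ^ 19 * (W * (D * ld + (td + tr + A - 512) * 2 ^ 30 + (512 - A - D) * lr
       + 3 * 2 ^ 21 + 5 * 2 ^ 11 * D) + D * kp + 2 ^ 13 * D * k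
       + 2 ^ 7 * ((W + k) * 57 * D ^ 2 * (2 * A + D)
          - 19 * W * (6144 * A * D + 3072 * D ^ 2 - 12 * A ^ 2 * D - 9 * A * D ^ 2 - 2 * D ^ 3)))"

definition corners_ok :: "int \<Rightarrow> int \<Rightarrow> int \<Rightarrow> int \<Rightarrow> int \<Rightarrow> int \<Rightarrow> int \<Rightarrow> int \<Rightarrow> int \<Rightarrow> int \<Rightarrow> int \<Rightarrow> int \<Rightarrow> int \<Rightarrow> int \<Rightarrow> bool" where
  "corners_ok pa0 pa1 A0 A1 D0 D1 td tr ld lr kp k W s \<longleftrightarrow>
     corner_val pa0 A0 D0 td tr ld lr kp k W \<le> s \<and> corner_val pa1 A1 D0 td tr ld lr kp k W \<le> s \<and>
     corner_val pa0 A0 D1 td tr ld lr kp k W \<le> s \<and> corner_val pa1 A1 D1 td tr ld lr kp k W \<le> s"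

text \<open>A slice \<open>A0 \<le> a \<le> A1\<close> is cut into cells \<open>D0 \<le> d \<le> D1\<close>. The inequality that involves \<open>2048\<close> makes
  the majorant convex in \<open>d\<close> on the cell. In \<open>a\<close> it is convex after adding a parabola with second
  derivative \<open>M / 16\<close>, whose cost is charged to the corner values.\<close>

fun cells_ok :: "int \<Rightarrow> int \<Rightarrow> nat \<Rightarrow> nat \<Rightarrow> nat \<Rightarrow> nat \<Rightarrow> nat \<Rightarrow> (nat \<times> nat \<times> nat \<times> nat \<times> nat) list \<Rightarrow> bool" where
  "cells_ok pa0 pa1 A0 A1 M R D0 [] \<longleftrightarrow> 512 < A0 + D0"
| "cells_ok pa0 pa1 A0 A1 M R D0 ((D1, td, tr, k, W) # cs) \<longleftrightarrow>
     D0 < D1 \<and> D1 \<le> 512 \<and> 0 < td \<and> td \<le> 512 \<and> 0 < tr \<and> tr \<le> 512 \<and> 0 < k \<and> 0 < W \<and> k + W \<le> 512 \<and>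
     W * 2048 \<le> W * (6 * A0 + 4 * D0) + (W + k) * (4 * A0 + 6 * D0) \<and>
     corners_ok pa0 pa1 (int A0) (int A1) (int D0) (int D1) (int td) (int tr)
       (ln_approx 2 + ln_approx 512 - ln_approx td) (ln_approx (512 - R) - ln_approx tr)
       (int k * ln_approx k - (int W + int k) * ln_approx (k + W) + int W * ln_approx W
         - int k * (ln_approx (512 - R) - ln_approx 512))
       (int k) (int W) (- (int W * 2 ^ 33 * int M * (int A1 - int A0) ^ 2)) \<and>
     cells_ok pa0 pa1 A0 A1 M R D1 cs"

text \<open>\<open>R\<close> belongs to a slice and not to its cells because \<open>\<rho>\<close>
  may depend on the core size but must be common to all extensions of a core.\<close>

fun slices_ok :: "nat \<Rightarrow> (nat \<times> nat \<times> nat \<times> (nat \<times> nat \<times> nat \<times> nat \<times> nat) list) list \<Rightarrow> bool" where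
  "slices_ok A0 [] \<longleftrightarrow> 380 \<le> A0"
| "slices_ok A0 ((A1, M, R, cs) # ss) \<longleftrightarrow>
     0 < A0 \<and> A0 < A1 \<and> A1 \<le> 512 \<and> 0 < R \<and> R < 512 \<and>
     57 * 2 ^ 11 * A1 \<le> (M * 2 ^ 10 + 399 * A0) * A1 + 2 ^ 23 \<and>
     cells_ok (base_val A0) (base_val A1) A0 A1 M R 0 cs \<and> slices_ok A1 ss"

text \<open>In the second derivative \<open>1 / a\<close> is least at \<open>a1\<close> and
  \<open>399 / 32 * a\<close> at \<open>a0\<close>; apart from the constants \<open>- 57 / 8\<close>
  and \<open>M\<close>, the remaining terms are nonnegative.\<close>

lemma convex_majorant_fst:
  fixes t u w \<rho> d M a0 a1 c :: real
  assumes a0: "0 < a0" "a0 \<le> a1" and d: "0 \<le> d"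
    and M: "57 / 8 \<le> 1 / a1 + 399 / 32 * a0 + M"
  shows "convex_on {a0..a1} (\<lambda>a. majorant \<rho> t u w a d + M / 2 * (a - c) ^ 2)"
proof (rule f''_ge0_imp_convex)
  fix a assume a: "a \<in> {a0..a1}"
  then have "a > 0" using a0 by auto
  show "((\<lambda>a. majorant \<rho> t u w a d + M / 2 * (a - c) ^ 2) has_real_derivative
      ln (57 / 16) + ln a + 1 - 57 / 8 * a + 399 / 64 * a ^ 2 + 5415 / 8192 * a ^ 4 + ln u + 1 - ln (1 - \<rho>)
      - 19 / 4 * (3 / 2 * d - 3 * a * d - 9 / 8 * d ^ 2) + (1 + w) * (57 / 16) * d ^ 2 + M * (a - c)) (at a)"
    unfolding majorant_def using \<open>a > 0\<close>
    by (auto intro!: derivative_eq_intros simp: power2_eq_square field_simps)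
  show "((\<lambda>a. ln (57 / 16) + ln a + 1 - 57 / 8 * a + 399 / 64 * a ^ 2 + 5415 / 8192 * a ^ 4 + ln u + 1 - ln (1 - \<rho>)
      - 19 / 4 * (3 / 2 * d - 3 * a * d - 9 / 8 * d ^ 2) + (1 + w) * (57 / 16) * d ^ 2 + M * (a - c)) has_real_derivative
      1 / a - 57 / 8 + 399 / 32 * a + 5415 / 2048 * a ^ 3 + 57 / 4 * d + M) (at a)"
    using \<open>a > 0\<close> by (auto intro!: derivative_eq_intros simp: field_simps)
  have "1 / a1 \<le> 1 / a" using a \<open>a > 0\<close> by (intro divide_left_mono) auto
  then show "0 \<le> 1 / a - 57 / 8 + 399 / 32 * a + 5415 / 2048 * a ^ 3 + 57 / 4 * d + M"
  proof -
    assume "1 / a1 \<le> 1 / a"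
    moreover have "0 \<le> 5415 / 2048 * a ^ 3" "399 / 32 * a0 \<le> 399 / 32 * a" using a \<open>a > 0\<close> by auto
    ultimately show ?thesis using M d by linarith
  qed
qed (rule convex_real_interval)

text \<open>The second derivative increases with \<open>d\<close>, so its value at \<open>d0\<close>
  decides.\<close>

lemma convex_majorant_snd:
  fixes t u w \<rho> d0 d1 a :: real
  assumes "0 \<le> a" "0 \<le> d0" "0 < w"
    and M: "57 / 8 \<le> 171 / 16 * a + 57 / 8 * d0 + (1 + w) * (57 / 32) * (4 * a + 6 * d0)"
  shows "convex_on {d0..d1} (\<lambda>d. majorant \<rho> t u w a d)"
proof (rule f''_ge0_imp_convex)
  fix d assume d: "d \<in> {d0..d1}"
  define k where "k = w * ln w - (1 + w) * ln (1 + w) - w * ln (1 - \<rho>)"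
  show "((\<lambda>d. majorant \<rho> t u w a d) has_real_derivative
      ln 2 - ln t - 1 + ln u + 1 - ln (1 - \<rho>)
      - 19 / 4 * (3 / 2 * a + 3 / 2 * d - 3 / 2 * a ^ 2 - 9 / 4 * a * d - 3 / 4 * d ^ 2)
      + k + (1 + w) * (57 / 32) * (4 * a * d + 3 * d ^ 2)) (at d)"
    unfolding majorant_def k_def[symmetric]
    by (auto intro!: derivative_eq_intros simp: power2_eq_square field_simps)
  show "((\<lambda>d. ln 2 - ln t - 1 + ln u + 1 - ln (1 - \<rho>)
      - 19 / 4 * (3 / 2 * a + 3 / 2 * d - 3 / 2 * a ^ 2 - 9 / 4 * a * d - 3 / 4 * d ^ 2)
      + k + (1 + w) * (57 / 32) * (4 * a * d + 3 * d ^ 2)) has_real_derivative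
      - 57 / 8 + 171 / 16 * a + 57 / 8 * d + (1 + w) * (57 / 32) * (4 * a + 6 * d)) (at d)"
    by (auto intro!: derivative_eq_intros simp: field_simps)
  have "(1 + w) * (57 / 32) * (4 * a + 6 * d0) \<le> (1 + w) * (57 / 32) * (4 * a + 6 * d)"
    using d assms by (intro mult_left_mono) auto
  then show "0 \<le> - 57 / 8 + 171 / 16 * a + 57 / 8 * d + (1 + w) * (57 / 32) * (4 * a + 6 * d)"
    using M d unfolding atLeastAtMost_iff by linarith
qed (rule convex_real_interval)

text \<open>Convexity in \<open>d\<close> bounds the majorant on the sides \<open>a = a0\<close> and
  \<open>a = a1\<close> by the corners; convexity in \<open>a\<close> then bounds it in between. The
  parabola is centred at the midpoint, so it costs the same \<open>M / 8 * (a1 - a0) ^ 2\<close> at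
  both ends.\<close>

lemma majorant_le_corners:
  fixes t u w \<rho> d0 d1 a0 a1 M B :: real
  assumes a: "0 < a0" "a0 \<le> a" "a \<le> a1" and d: "0 \<le> d0" "d0 \<le> d" "d \<le> d1" and w: "w > 0" and M0: "0 \<le> M"
    and M1: "57 / 8 \<le> 1 / a1 + 399 / 32 * a0 + M"
    and M2: "57 / 8 \<le> 171 / 16 * a0 + 57 / 8 * d0 + (1 + w) * (57 / 32) * (4 * a0 + 6 * d0)"
    and c: "majorant \<rho> t u w a0 d0 \<le> B" "majorant \<rho> t u w a1 d0 \<le> B"
      "majorant \<rho> t u w a0 d1 \<le> B" "majorant \<rho> t u w a1 d1 \<le> B"
  shows "majorant \<rho> t u w a d \<le> B + M / 8 * (a1 - a0) ^ 2"
proof -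
  have snd: "majorant \<rho> t u w x d \<le> B" if x: "x = a0 \<or> x = a1" for x
  proof -
    have "a0 \<le> x" using x a by auto
    then have "(1 + w) * (57 / 32) * (4 * a0 + 6 * d0) \<le> (1 + w) * (57 / 32) * (4 * x + 6 * d0)"
      using w by (intro mult_left_mono) auto
    then have "57 / 8 \<le> 171 / 16 * x + 57 / 8 * d0 + (1 + w) * (57 / 32) * (4 * x + 6 * d0)"
      using M2 \<open>a0 \<le> x\<close> by linarith
    then have "convex_on {d0..d1} (\<lambda>d. majorant \<rho> t u w x d)"
      using a d w \<open>a0 \<le> x\<close> by (intro convex_majorant_snd) auto
    then have "majorant \<rho> t u w x d \<le> max (majorant \<rho> t u w x d0) (majorant \<rho> t u w x d1)"
      by (rule convex_on_le_max) (use d in auto)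
    then show ?thesis using x c by auto
  qed
  define m where "m = (a0 + a1) / 2"
  have "convex_on {a0..a1} (\<lambda>a. majorant \<rho> t u w a d + M / 2 * (a - m) ^ 2)"
    using a d M1 by (intro convex_majorant_fst) auto
  then have "majorant \<rho> t u w a d + M / 2 * (a - m) ^ 2
      \<le> max (majorant \<rho> t u w a0 d + M / 2 * (a0 - m) ^ 2) (majorant \<rho> t u w a1 d + M / 2 * (a1 - m) ^ 2)"
    by (rule convex_on_le_max) (use a in auto)
  also have "M / 2 * (a0 - m) ^ 2 = M / 8 * (a1 - a0) ^ 2"
    by (simp add: m_def power2_eq_square field_simps)
  also have "M / 2 * (a1 - m) ^ 2 = M / 8 * (a1 - a0) ^ 2"
    by (simp add: m_def power2_eq_square field_simps)
  also have "max (majorant \<rho> t u w a0 d + M / 8 * (a1 - a0) ^ 2) (majorant \<rho> t u w a1 d + M / 8 * (a1 - a0) ^ 2)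
      \<le> B + M / 8 * (a1 - a0) ^ 2"
    using snd by simp
  finally have "majorant \<rho> t u w a d + M / 2 * (a - m) ^ 2 \<le> B + M / 8 * (a1 - a0) ^ 2" .
  moreover have "0 \<le> M / 2 * (a - m) ^ 2" using M0 by simp
  ultimately show ?thesis by linarith
qed

lemma base_val_eq:
  fixes A :: nat
  defines "a \<equiv> real A / 512" and "l \<equiv> \<lambda>k. real_of_int (ln_approx k) / 2 ^ 30"
  shows "real_of_int (base_val A) / 2 ^ 58
    = rate_const + a * (l 57 - l 16 + l A - l 512) - 57 / 16 * a ^ 2 + 133 / 64 * a ^ 3 + 1083 / 8192 * a ^ 5"
  unfolding base_val_def a_def l_def rate_const_def by (simp add: field_simps)

lemma corner_val_eq:
  fixes A D td tr k W pa lt lu kp :: real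
  assumes "W > 0"
  defines "a \<equiv> A / 512" and "d \<equiv> D / 512" and "w \<equiv> k / W"
  shows "(W * pa + 2 ^ 19 * (W * (D * lt + (td + tr + A - 512) * 2 ^ 30 + (512 - A - D) * lu
       + 3 * 2 ^ 21 + 5 * 2 ^ 11 * D) + D * kp + 2 ^ 13 * D * k
       + 2 ^ 7 * ((W + k) * 57 * D ^ 2 * (2 * A + D)
          - 19 * W * (6144 * A * D + 3072 * D ^ 2 - 12 * A ^ 2 * D - 9 * A * D ^ 2 - 2 * D ^ 3)))) / (2 ^ 58 * W)
    = pa / 2 ^ 58 + d * (lt / 2 ^ 30) + td / 512 - d + tr / 512 - (1 - a - d) + (1 - a - d) * (lu / 2 ^ 30)
      + d * (kp / W / 2 ^ 30) + (1 + w) * (57 / 32) * d ^ 2 * (2 * a + d)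
      - 19 / 4 * (3 / 2 * a * d + 3 / 4 * d ^ 2 - 3 / 2 * a ^ 2 * d - 9 / 8 * a * d ^ 2 - d ^ 3 / 4)
      + 1 / 2 ^ 19 * (6 + 5 * d + 4 * d * w)"
  using assms(1) unfolding a_def d_def w_def
  by (simp add: field_simps power2_eq_square power3_eq_cube)

text \<open>The logarithms enter linearly through \<open>L\<close>, so rounding contributes
  \<open>L e\<close>, at most \<open>(6 + 5 * d + 4 * d * w) / 2 ^ 20\<close>.
  \<open>corner_val\<close> contains twice this allowance; the surplus yields the margin
  \<open>6 / 2 ^ 20\<close>, which becomes the decay rate for the larger cores.\<close>

lemma corner_val_bound:
  fixes A D R td tr k W :: nat
  assumes A: "1 \<le> A" "A \<le> 512" and D: "D \<le> 512" and R: "R < 512"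
    and t: "1 \<le> td" "td \<le> 512" and u: "1 \<le> tr" "tr \<le> 512" and k: "1 \<le> k" "1 \<le> W" "k + W \<le> 512"
  shows "majorant (R / 512) (td / 512) (tr / 512) (k / W) (A / 512) (D / 512) + 6 / 2 ^ 20
    \<le> real_of_int (corner_val (base_val A) (int A) (int D) (int td) (int tr)
        (ln_approx 2 + ln_approx 512 - ln_approx td) (ln_approx (512 - R) - ln_approx tr)
        (int k * ln_approx k - (int W + int k) * ln_approx (k + W) + int W * ln_approx W
         - int k * (ln_approx (512 - R) - ln_approx 512))
        (int k) (int W)) / (2 ^ 58 * real W)"
proof -
  define l where "l = (\<lambda>k. real_of_int (ln_approx k) / 2 ^ 30)"
  define e where "e = (\<lambda>k. ln (real k) - l k)"
  define a where "a = real A / 512"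
  define d where "d = real D / 512"
  define w where "w = real k / real W"
  define r where "r = 1 - a - d"
  define L where "L = (\<lambda>f :: nat \<Rightarrow> real. a * (f 57 - f 16 + f A - f 512) + d * (f 2 + f 512 - f td)
     + r * (f (512 - R) - f tr) + d * (w * f k - (1 + w) * f (k + W) + f W - w * (f (512 - R) - f 512)))"
  define Q where "Q = rate_const - 57 / 16 * a ^ 2 + 133 / 64 * a ^ 3 + 1083 / 8192 * a ^ 5
     + td / 512 - d + tr / 512 - r + (1 + w) * (57 / 32) * d ^ 2 * (2 * a + d)
     - 19 / 4 * (3 / 2 * a * d + 3 / 4 * d ^ 2 - 3 / 2 * a ^ 2 * d - 9 / 8 * a * d ^ 2 - d ^ 3 / 4)"
  have W: "real W > 0" using k by simp
  have bounds: "0 \<le> a" "a \<le> 1" "0 \<le> d" "d \<le> 1" "w > 0" "\<bar>r\<bar> \<le> 1"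
    using A D k by (auto simp: a_def d_def w_def r_def abs_le_iff)
  have e: "\<bar>e j\<bar> \<le> 1 / 2 ^ 20" if "1 \<le> j" "j \<le> 512" for j
    unfolding e_def l_def by (rule ln_approx_correct[OF that])
  have "majorant (R / 512) (td / 512) (tr / 512) (k / W) (A / 512) (D / 512) = Q + L (\<lambda>j. ln (real j))"
  proof -
    have ln1: "ln (57 / 16 :: real) = ln (real 57) - ln (real 16)" by (simp add: ln_div)
    have lnA: "ln (real A / 512) = ln (real A) - ln (real 512)" using A by (simp add: ln_div)
    have lnt: "ln (real td / 512) = ln (real td) - ln (real 512)" using t by (simp add: ln_div)
    have lnu: "ln (real tr / 512) = ln (real tr) - ln (real 512)" using u by (simp add: ln_div)
    have "1 - real R / 512 = real (512 - R) / real 512" using R by (simp add: of_nat_diff)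
    moreover have "ln (real (512 - R) / real 512) = ln (real (512 - R)) - ln (real 512)"
      using R by (subst ln_div) auto
    ultimately have lnR: "ln (1 - real R / 512) = ln (real (512 - R)) - ln (real 512)" by (simp only:)
    have lnw: "ln (real k / real W) = ln (real k) - ln (real W)" using k by (simp add: ln_div)
    have "1 + real k / real W = real (k + W) / real W" using k by (simp add: field_simps)
    then have lnw1: "ln (1 + real k / real W) = ln (real (k + W)) - ln (real W)" using k by (simp add: ln_div)
    show ?thesis
      unfolding majorant_def ln1 lnA lnt lnu lnR lnw lnw1 Q_def L_def
      unfolding a_def[symmetric] d_def[symmetric] w_def[symmetric] r_def
      by (simp add: algebra_simps power2_eq_square)
  qed
  also have "L (\<lambda>j. ln (real j)) = L l + L e"
    by (simp add: L_def e_def algebra_simps)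
  also have "L e \<le> 1 / 2 ^ 20 * (6 + 5 * d + 4 * d * w)"
  proof -
    have "e 57 - e 16 + e A - e 512 \<le> 4 * (1 / 2 ^ 20)"
      using e[of 57] e[of 16] e[of A] e[of 512] A by (simp only: abs_le_iff) simp
    then have 1: "a * (e 57 - e 16 + e A - e 512) \<le> a * (4 * (1 / 2 ^ 20))"
      using bounds by (intro mult_left_mono)
    have "e 2 + e 512 - e td \<le> 3 * (1 / 2 ^ 20)"
      using e[of 2] e[of td] e[of 512] t by (simp only: abs_le_iff) simp
    then have 2: "d * (e 2 + e 512 - e td) \<le> d * (3 * (1 / 2 ^ 20))"
      using bounds by (intro mult_left_mono)
    have "\<bar>e (512 - R)\<bar> \<le> 1 / 2 ^ 20" by (rule e) (use R in auto)
    moreover have "\<bar>e tr\<bar> \<le> 1 / 2 ^ 20" by (rule e) (use u in auto)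
    ultimately have "\<bar>e (512 - R) - e tr\<bar> \<le> 2 * (1 / 2 ^ 20)" by linarith
    then have "\<bar>r\<bar> * \<bar>e (512 - R) - e tr\<bar> \<le> 1 * (2 * (1 / 2 ^ 20))"
      using bounds by (intro mult_mono) auto
    then have 3: "r * (e (512 - R) - e tr) \<le> 2 * (1 / 2 ^ 20)"
      unfolding abs_mult[symmetric] mult_1_left by (rule abs_le_D1)
    have ek: "e k \<le> 1 / 2 ^ 20" by (rule abs_le_D1[OF e]) (use k in auto)
    have eR: "- e (512 - R) \<le> 1 / 2 ^ 20" by (rule abs_le_D2[OF e]) (use R in auto)
    have e512: "e 512 \<le> 1 / 2 ^ 20" by (rule abs_le_D1[OF e]) auto
    have ekW: "- e (k + W) \<le> 1 / 2 ^ 20" by (rule abs_le_D2[OF e]) (use k in auto)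
    have "w * e k \<le> w * (1 / 2 ^ 20)" "w * (- e (512 - R)) \<le> w * (1 / 2 ^ 20)" "w * e 512 \<le> w * (1 / 2 ^ 20)"
      "(1 + w) * (- e (k + W)) \<le> (1 + w) * (1 / 2 ^ 20)"
      using bounds by (intro mult_left_mono ek eR e512 ekW; simp)+
    moreover have "e W \<le> 1 / 2 ^ 20" using e[of W] k by (simp add: abs_le_iff)
    ultimately have "w * e k - (1 + w) * e (k + W) + e W - w * (e (512 - R) - e 512)
        \<le> (2 + 4 * w) * (1 / 2 ^ 20)" by (simp add: algebra_simps)
    then have 4: "d * (w * e k - (1 + w) * e (k + W) + e W - w * (e (512 - R) - e 512))
        \<le> d * ((2 + 4 * w) * (1 / 2 ^ 20))"
      using bounds by (intro mult_left_mono)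
    have "L e \<le> a * (4 * (1 / 2 ^ 20)) + d * (3 * (1 / 2 ^ 20)) + 2 * (1 / 2 ^ 20) + d * ((2 + 4 * w) * (1 / 2 ^ 20))"
      unfolding L_def by (intro add_mono 1 2 3 4)
    also have "\<dots> = (4 * a + 2 + 5 * d + 4 * d * w) / 2 ^ 20" by (simp add: field_simps)
    also have "\<dots> \<le> (6 + 5 * d + 4 * d * w) / 2 ^ 20"
      using bounds by (intro divide_right_mono) auto
    finally show ?thesis by simp
  qed
  finally have main: "majorant (R / 512) (td / 512) (tr / 512) (k / W) (A / 512) (D / 512)
      \<le> Q + (L l + 1 / 2 ^ 20 * (6 + 5 * d + 4 * d * w))" by simp
  have "0 \<le> 5 * d + 4 * d * w" using bounds by simp
  then have "6 / 2 ^ 20 + 1 / 2 ^ 20 * (6 + 5 * d + 4 * d * w) \<le> 1 / 2 ^ 19 * (6 + 5 * d + 4 * d * w)" by simp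
  then have "majorant (R / 512) (td / 512) (tr / 512) (k / W) (A / 512) (D / 512) + 6 / 2 ^ 20
      \<le> Q + L l + 1 / 2 ^ 19 * (6 + 5 * d + 4 * d * w)" using main by linarith
  also have "\<dots> = real_of_int (corner_val (base_val A) (int A) (int D) (int td) (int tr)
        (ln_approx 2 + ln_approx 512 - ln_approx td) (ln_approx (512 - R) - ln_approx tr)
        (int k * ln_approx k - (int W + int k) * ln_approx (k + W) + int W * ln_approx W
         - int k * (ln_approx (512 - R) - ln_approx 512))
        (int k) (int W)) / (2 ^ 58 * real W)"
  proof -
    have kp: "(real k * real_of_int (ln_approx k) - (real W + real k) * real_of_int (ln_approx (k + W))
        + real W * real_of_int (ln_approx W) - real k * (real_of_int (ln_approx (512 - R)) - real_of_int (ln_approx 512))) / real W / 2 ^ 30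
       = w * l k - (1 + w) * l (k + W) + l W - w * (l (512 - R) - l 512)"
      using W by (simp add: w_def l_def field_simps)
    show ?thesis
      unfolding corner_val_def
      by (simp only: of_int_add of_int_mult of_int_diff of_int_power of_int_numeral of_int_of_nat_eq,
          subst corner_val_eq[OF W],
          simp only: kp base_val_eq a_def[symmetric] d_def[symmetric] w_def[symmetric],
          simp add: Q_def L_def l_def r_def field_simps)
  qed
  finally show ?thesis .
qed

lemma cells_ok_sound:
  assumes "cells_ok (base_val A0) (base_val A1) A0 A1 M R D0 cs"
    and A: "0 < A0" "A0 \<le> A1" "A1 \<le> 512" and R: "0 < R" "R < 512"
    and M: "57 * 2 ^ 11 * A1 \<le> (M * 2 ^ 10 + 399 * A0) * A1 + 2 ^ 23"
    and a: "real A0 / 512 \<le> a" "a \<le> real A1 / 512" and d: "real D0 / 512 \<le> d" "d \<le> 1 - a"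
  shows "\<exists>t u w. 0 < t \<and> 0 < u \<and> 0 < w \<and> majorant (R / 512) t u w a d \<le> - (6 / 2 ^ 20)"
  using assms(1) d(1)
proof (induction cs arbitrary: D0)
  case Nil
  \<comment> \<open>Past the last cell \<open>d\<close> would exceed \<open>1 - a\<close>, because
    \<open>512 < A0 + D0\<close>.\<close>
  then have "real 512 < real (A0 + D0)" by (simp only: cells_ok.simps of_nat_less_iff)
  then have False using Nil.prems a d by simp
  then show ?case ..
next
  case (Cons c cs)
  obtain D1 td tr k W where c: "c = (D1, td, tr, k, W)" by (cases c)
  let ?lt = "ln_approx 2 + ln_approx 512 - ln_approx td" and ?lu = "ln_approx (512 - R) - ln_approx tr"
  let ?kp = "int k * ln_approx k - (int W + int k) * ln_approx (k + W) + int W * ln_approx W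
         - int k * (ln_approx (512 - R) - ln_approx 512)"
  let ?V = "\<lambda>A D. corner_val (base_val A) (int A) (int D) (int td) (int tr) ?lt ?lu ?kp (int k) (int W)"
  \<comment> \<open>Scaled by \<open>2 ^ 58 * W\<close>, this is minus the cost of the parabola with
    second derivative \<open>M / 16\<close>; the two cancel in the final bound.\<close>
  define s where "s = - (int W * 2 ^ 33 * int M * (int A1 - int A0) ^ 2)"
  from Cons.prems(1) have ok: "D0 < D1" "D1 \<le> 512" "0 < td" "td \<le> 512" "0 < tr" "tr \<le> 512" "0 < k" "0 < W" "k + W \<le> 512"
    and M2: "W * 2048 \<le> W * (6 * A0 + 4 * D0) + (W + k) * (4 * A0 + 6 * D0)"
    and V: "?V A0 D0 \<le> s" "?V A1 D0 \<le> s" "?V A0 D1 \<le> s" "?V A1 D1 \<le> s"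
    and rest: "cells_ok (base_val A0) (base_val A1) A0 A1 M R D1 cs"
    unfolding c cells_ok.simps corners_ok_def s_def by blast+
  show ?case
  proof (cases "d \<le> real D1 / 512")
    case False
    then show ?thesis using Cons.IH[OF rest] by simp
  next
    case True
    have W: "real W > 0" using ok by simp
    let ?m = "majorant (R / 512) (td / 512) (tr / 512) (k / W)"
    define B where "B = real_of_int s / (2 ^ 58 * real W) - 6 / 2 ^ 20"
    have corner: "?m (real A / 512) (real D / 512) \<le> B" if "?V A D \<le> s" "1 \<le> A" "A \<le> 512" "D \<le> 512" for A D
    proof -
      have "real_of_int (?V A D) / (2 ^ 58 * real W) \<le> real_of_int s / (2 ^ 58 * real W)"
        using that W by (intro divide_right_mono) auto
      then show ?thesis
        using corner_val_bound[of A D R td tr k W] that ok R unfolding B_def by simp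
    qed
    have "?m a d \<le> B + (real M / 16) / 8 * (real A1 / 512 - real A0 / 512) ^ 2"
    proof (rule majorant_le_corners)
      show "57 / 8 \<le> 1 / (real A1 / 512) + 399 / 32 * (real A0 / 512) + real M / 16"
      proof -
        have "real (57 * 2 ^ 11 * A1) \<le> real ((M * 2 ^ 10 + 399 * A0) * A1 + 2 ^ 23)"
          using M by (simp only: of_nat_le_iff)
        then show ?thesis using A by (simp add: field_simps)
      qed
      show "57 / 8 \<le> 171 / 16 * (real A0 / 512) + 57 / 8 * (real D0 / 512)
          + (1 + real k / real W) * (57 / 32) * (4 * (real A0 / 512) + 6 * (real D0 / 512))"
      proof -
        have "real (W * 2048) \<le> real (W * (6 * A0 + 4 * D0) + (W + k) * (4 * A0 + 6 * D0))"
          using M2 by (simp only: of_nat_le_iff)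
        then show ?thesis using W by (simp add: field_simps)
      qed
      show "?m (real A0 / 512) (real D0 / 512) \<le> B" by (rule corner[OF V(1)]) (use A ok in auto)
      show "?m (real A1 / 512) (real D0 / 512) \<le> B" by (rule corner[OF V(2)]) (use A ok in auto)
      show "?m (real A0 / 512) (real D1 / 512) \<le> B" by (rule corner[OF V(3)]) (use A ok in auto)
      show "?m (real A1 / 512) (real D1 / 512) \<le> B" by (rule corner[OF V(4)]) (use A ok in auto)
      show "real A0 / 512 \<le> a" "a \<le> real A1 / 512" "real D0 / 512 \<le> d" "d \<le> real D1 / 512" by fact+
    qed (use A(1) ok W in simp_all)
    also have "\<dots> = - (6 / 2 ^ 20)"
    proof -
      have "real_of_int s = - (real W * 2 ^ 33 * real M * (real A1 - real A0) ^ 2)"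
        by (simp add: s_def)
      then show ?thesis using W by (simp add: B_def power2_eq_square field_simps)
    qed
    finally have "?m a d \<le> - (6 / 2 ^ 20)" .
    then show ?thesis using ok W by (intro exI[of _ "td / 512"] exI[of _ "tr / 512"] exI[of _ "k / W"]) auto
  qed
qed

lemma slices_ok_sound:
  assumes "slices_ok A0 ss" "real A0 / 512 \<le> a" "a < 380 / 512"
  shows "\<exists>\<rho>. 0 < \<rho> \<and> \<rho> < 1 \<and> (\<forall>\<mu> d. 4.453 \<le> \<mu> \<longrightarrow> \<mu> \<le> 19 / 4 \<longrightarrow> 0 \<le> d \<longrightarrow> a + d \<le> 1 \<longrightarrow>
    pair_exponent (19 / 4) \<mu> \<rho> a d \<le> - (6 / 2 ^ 20))"
  using assms(1,2)
proof (induction ss arbitrary: A0)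
  case Nil
  then have "real 380 \<le> real A0" by (simp only: slices_ok.simps of_nat_le_iff)
  then have False using Nil.prems assms(3) by simp
  then show ?case ..
next
  case (Cons c ss)
  obtain A1 M R cs where c: "c = (A1, M, R, cs)" by (cases c)
  from Cons.prems(1) have A: "0 < A0" "A0 < A1" "A1 \<le> 512" and R: "0 < R" "R < 512"
    and M: "57 * 2 ^ 11 * A1 \<le> (M * 2 ^ 10 + 399 * A0) * A1 + 2 ^ 23"
    and cs: "cells_ok (base_val A0) (base_val A1) A0 A1 M R 0 cs" and rest: "slices_ok A1 ss"
    unfolding c slices_ok.simps by blast+
  show ?case
  proof (cases "a \<le> real A1 / 512")
    case False
    then show ?thesis using Cons.IH[OF rest] by simp
  next
    case True
    have "pair_exponent (19 / 4) \<mu> (R / 512) a d \<le> - (6 / 2 ^ 20)"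
      if "4.453 \<le> \<mu>" "\<mu> \<le> 19 / 4" "0 \<le> d" "a + d \<le> 1" for \<mu> d
    proof -
      have "real 0 / 512 \<le> d" "d \<le> 1 - a" using that by simp_all
      then obtain t u w where "0 < t" "0 < u" "0 < w" and m: "majorant (R / 512) t u w a d \<le> - (6 / 2 ^ 20)"
        using cells_ok_sound[OF cs A(1) less_imp_le[OF A(2)] A(3) R M Cons.prems(2) True] by blast
      moreover have "a > 0" using Cons.prems(2) A(1) by (smt (verit) divide_pos_pos of_nat_0_less_iff)
      ultimately have "pair_exponent (19 / 4) \<mu> (R / 512) a d \<le> majorant (R / 512) t u w a d"
        using that R by (intro pair_exponent_le_majorant) auto
      then show ?thesis using m by simp
    qed
    then show ?thesis using R by (intro exI[of _ "R / 512"]) auto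
  qed
qed

text \<open>The entries were found by a numerical search: each cell is about as large as the check permits,
  and \<open>td\<close>, \<open>tr\<close>, \<open>k / W\<close> are close to the optimal \<open>t\<close>, \<open>u\<close>, \<open>w\<close> at its centre.\<close>

definition slices :: "(nat \<times> nat \<times> nat \<times> (nat \<times> nat \<times> nat \<times> nat \<times> nat) list) list" where
  "slices = [
    (132, 13, 89,
     [(48,24,370,219,64), (112,80,314,132,64), (176,143,251,88,64), (240,207,187,52,64),
      (304,272,122,28,64), (352,328,66,18,64), (400,375,19,14,64), (411,404,1,11,64)]),
    (156, 11, 84,
     [(48,24,343,223,64), (112,80,288,130,64), (176,143,224,80,64), (240,207,160,43,64),
      (304,272,95,24,64), (352,328,40,16,64), (372,361,6,13,64), (381,375,1,12,64)]),
    (180, 8, 78,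
     [(40,20,323,242,64), (88,64,280,143,64), (136,111,232,100,64), (200,167,176,58,64),
      (264,232,111,31,64), (312,288,55,19,64), (344,327,16,16,64), (357,349,1,13,64)]),
    (204, 4, 72,
     [(32,16,303,267,64), (72,52,267,161,64), (120,95,224,111,64), (184,151,167,61,64),
      (232,208,111,34,64), (264,248,71,24,64), (304,283,36,20,64), (318,310,9,16,64),
      (319,318,2,15,64), (333,325,1,14,64)]),
    (224, 0, 65,
     [(24,12,285,308,64), (56,40,257,191,64), (88,71,226,142,64), (136,111,185,91,64),
      (184,160,138,49,64), (224,204,93,33,64), (256,240,57,24,64), (284,269,28,21,64),
      (296,289,8,18,64), (309,301,1,16,64)]),
    (244, 0, 61,
     [(22,11,266,326,64), (50,36,241,203,64), (82,65,212,149,64), (122,101,176,93,64),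
      (162,141,135,55,64), (194,178,99,39,64), (216,205,72,30,64), (240,228,49,25,64),
      (260,249,28,23,64), (272,265,12,20,64), (277,273,4,19,64), (289,281,1,17,64)]),
    (260, 0, 57,
     [(18,9,250,357,64), (42,30,229,226,64), (66,53,206,173,64), (98,81,177,118,64),
      (130,114,146,74,64), (162,146,113,50,64), (184,173,86,39,64), (200,192,67,32,64),
      (218,209,50,27,64), (236,226,33,27,64), (250,242,17,23,64), (259,253,6,21,64),
      (269,263,1,19,64)]),
    (276, 0, 50,
     [(14,7,236,105,16), (30,22,221,281,64), (46,37,205,231,64), (68,56,187,167,64),
      (96,81,161,114,64), (128,111,132,71,64), (152,140,103,52,64), (168,160,83,42,64),
      (179,174,69,37,64), (188,184,59,35,64), (200,194,49,32,64), (214,206,37,31,64),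
      (224,218,25,27,64), (234,228,15,25,64), (243,237,6,23,64), (253,247,1,21,64)]),
    (280, 0, 50,
     [(16,8,225,101,16), (36,26,207,252,64), (58,46,186,192,64), (86,71,161,130,64),
      (118,102,132,83,64), (146,132,101,55,64), (166,156,77,42,64), (180,173,60,37,64),
      (194,187,47,35,64), (208,200,33,31,64), (226,216,17,27,64), (237,230,3,23,64)]),
    (292, 0, 43,
     [(11,6,220,125,16), (23,17,208,342,64), (34,28,198,283,64), (48,40,185,223,64),
      (66,56,169,168,64), (90,78,148,118,64), (114,102,123,81,64), (134,124,101,60,64),
      (146,140,85,52,64), (154,150,75,47,64), (161,158,67,43,64), (166,164,61,41,64),
      (170,168,57,40,64), (178,174,51,37,64), (188,182,43,37,64), (198,192,33,33,64),
      (208,202,23,30,64), (220,213,12,27,64), (229,223,2,25,64), (233,229,1,23,64)]),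
    (302, 0, 37,
     [(8,4,211,151,16), (16,12,203,109,16), (23,20,196,390,64), (30,25,188,312,64),
      (39,33,180,265,64), (51,44,170,212,64), (69,60,155,162,64), (91,80,134,115,64),
      (113,102,112,81,64), (129,121,93,61,64), (140,134,79,55,64), (147,144,71,50,64),
      (152,150,65,48,64), (157,154,59,45,64), (165,161,53,42,64), (175,169,45,41,64),
      (185,179,35,37,64), (197,190,24,33,64), (211,203,11,29,64), (221,215,1,26,64)]),
    (310, 0, 34,
     [(8,4,202,161,16), (15,12,194,116,16), (21,18,188,396,64), (27,23,182,340,64),
      (35,30,175,291,64), (46,39,166,227,64), (60,53,153,183,64), (78,69,137,135,64),
      (98,88,118,96,64), (114,105,99,72,64), (126,120,85,61,64), (134,130,75,57,64),
      (138,136,69,55,64), (142,140,65,52,64), (145,144,61,50,64), (150,148,57,47,64),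
      (156,153,52,47,64), (165,159,46,44,64), (173,168,37,41,64), (185,178,27,37,64),
      (201,192,13,32,64), (211,205,1,28,64)]),
    (318, 0, 30,
     [(7,4,194,184,16), (12,10,188,135,16), (16,14,184,116,16), (18,17,181,111,16),
      (20,19,179,426,64), (22,21,177,399,64), (26,23,174,363,64), (32,28,169,315,64),
      (41,35,162,253,64), (53,46,150,207,64), (69,61,137,155,64), (87,78,119,114,64),
      (103,95,102,87,64), (115,109,88,69,64), (123,119,78,64,64), (128,126,71,61,64),
      (132,130,67,58,64), (135,134,63,55,64), (137,136,61,54,64), (142,140,57,52,64),
      (148,145,53,49,64), (154,150,47,48,64), (163,157,40,45,64), (174,167,30,40,64),
      (188,180,17,35,64), (203,194,3,31,64)]),
    (324, 0, 27,
     [(7,4,187,200,16), (12,10,182,143,16), (15,14,178,132,16), (17,16,175,119,16),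
      (19,18,173,114,16), (22,20,170,418,64), (26,23,167,373,64), (32,28,162,322,64),
      (41,35,154,257,64), (53,46,144,203,64), (69,61,130,155,64), (85,77,113,115,64),
      (99,92,98,90,64), (111,105,85,75,64), (119,115,75,66,64), (125,122,68,61,64),
      (130,128,63,59,64), (136,133,57,57,64), (143,140,52,53,64), (152,147,44,50,64),
      (164,157,33,44,64), (180,171,19,38,64), (195,186,4,33,64)]),
    (330, 0, 25,
     [(4,2,183,237,16), (8,6,179,180,16), (12,10,175,144,16), (15,14,172,140,16),
      (17,16,169,126,16), (20,18,166,111,16), (24,21,163,392,64), (29,25,158,340,64),
      (37,32,151,291,64), (48,41,142,224,64), (62,55,130,173,64), (76,69,116,131,64),
      (90,83,102,101,64), (101,96,89,85,64), (109,105,79,75,64), (115,112,72,70,64),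
      (119,117,67,66,64), (123,121,63,63,64), (127,125,59,60,64), (133,130,55,58,64),
      (139,135,49,56,64), (148,143,42,51,64), (160,153,31,46,64), (176,167,17,39,64),
      (189,181,3,34,64)]),
    (338, 0, 22,
     [(4,2,176,264,16), (8,6,172,195,16), (11,10,168,175,16), (13,12,166,153,16),
      (15,14,164,143,16), (16,15,162,130,16), (17,16,162,125,16), (19,18,160,121,16),
      (22,20,158,110,16), (27,24,154,382,64), (34,30,148,317,64), (43,38,140,249,64),
      (55,49,129,196,64), (67,61,117,150,64), (79,72,104,118,64), (89,84,93,99,64),
      (98,94,83,87,64), (103,100,77,79,64), (108,106,71,76,64), (111,110,67,72,64),
      (113,112,65,70,64), (117,115,62,67,64), (121,119,58,66,64), (127,123,54,62,64),
      (134,129,48,59,64), (143,137,40,54,64), (155,148,29,47,64), (171,162,15,41,64),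
      (183,175,2,35,64)]),
    (346, 0, 19,
     [(4,2,168,298,16), (8,6,164,211,16), (11,10,160,191,16), (14,12,158,152,16),
      (17,15,154,140,16), (21,18,151,117,16), (26,23,146,405,64), (33,29,140,333,64),
      (42,37,132,258,64), (53,47,121,203,64), (65,59,110,156,64), (76,70,99,123,64),
      (85,80,89,104,64), (91,88,81,93,64), (97,94,75,85,64), (102,100,69,81,64),
      (106,104,65,76,64), (111,108,61,72,64), (117,113,56,69,64), (124,119,50,65,64),
      (133,127,42,59,64), (145,138,31,52,64), (161,152,17,45,64), (173,166,3,38,64),
      (175,173,1,35,64)]),
    (358, 0, 14,
     [(3,2,158,405,16), (5,4,156,299,16), (7,6,154,258,16), (9,8,152,240,16), (10,9,150,209,16),
      (11,10,150,195,16), (12,11,148,189,16), (14,12,147,168,16), (16,14,145,155,16),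
      (20,17,142,134,16), (25,22,138,111,16), (32,28,132,346,64), (40,36,124,276,64),
      (49,44,115,215,64), (59,54,105,174,64), (68,64,95,144,64), (76,72,87,120,64),
      (83,80,79,109,64), (89,86,73,98,64), (95,92,67,90,64), (101,97,61,85,64),
      (108,103,56,78,64), (114,110,49,73,64), (122,117,42,67,64), (132,126,33,60,64),
      (144,137,22,52,64), (158,150,9,45,64), (167,161,1,40,64)]),
    (372, 0, 11,
     [(3,2,146,486,16), (7,5,142,315,16), (10,8,138,241,16), (14,11,135,181,16),
      (19,16,130,148,16), (25,21,125,108,16), (32,28,118,348,64), (40,36,111,267,64),
      (48,44,102,216,64), (55,52,95,175,64), (62,58,87,156,64), (68,65,81,133,64),
      (73,70,75,124,64), (78,76,71,114,64), (83,80,66,105,64), (89,85,61,99,64), (95,91,55,93,64),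
      (101,97,49,85,64), (107,103,43,78,64), (116,111,36,71,64), (127,121,26,62,64),
      (139,132,14,54,64), (148,143,4,47,64), (155,150,1,43,64)]),
    (380, 0, 11,
     [(4,2,134,443,16), (10,7,129,253,16), (16,13,123,171,16), (23,19,116,118,16),
      (31,27,108,358,64), (39,35,101,267,64), (47,43,92,215,64), (54,50,85,179,64),
      (61,58,77,159,64), (67,64,71,140,64), (73,70,66,125,64), (80,75,60,112,64),
      (89,83,52,101,64), (100,93,42,87,64), (114,106,29,73,64), (132,122,13,59,64),
      (141,135,1,50,64)])
  ]"


text \<open>102/512 lies just below 1/5, where the bound for small cores ends; the slices reach up
  to 380/512, where counting cores alone takes over.\<close>

lemma slices_ok_slices: "slices_ok 102 slices"
  by (simp add: slices_def base_val_def corners_ok_def corner_val_def ln_approx_eval)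

section \<open>Large cores: the majorant at \<open>d = 0\<close>\<close>

definition plain_val :: "nat \<Rightarrow> nat \<Rightarrow> int" where
  "plain_val A tr = base_val A + 2 ^ 19 * ((int tr + int A - 512) * 2 ^ 30
     + (512 - int A) * (ln_approx 512 - ln_approx tr) + 3 * 2 ^ 21)"

text \<open>From \<open>A0 = 379\<close> on, \<open>399 / 32 * a\<close> exceeds 57/8, so the
  majorant is convex in \<open>a\<close> without a parabola.\<close>

fun plain_ok :: "nat \<Rightarrow> (nat \<times> nat) list \<Rightarrow> bool" where
  "plain_ok A0 [] \<longleftrightarrow> 512 \<le> A0"
| "plain_ok A0 ((A1, tr) # cs) \<longleftrightarrow> 379 \<le> A0 \<and> A0 < A1 \<and> A1 \<le> 512 \<and> 0 < tr \<and> tr \<le> 512 \<and>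
     plain_val A0 tr \<le> 0 \<and> plain_val A1 tr \<le> 0 \<and> plain_ok A1 cs"

text \<open>The cells start one unit below 380 because \<open>plain_ok_sound\<close> treats
  \<open>a\<close> strictly above the left end; strictness there lets the end point
  \<open>a = 1\<close> be included.\<close>

lemma plain_ok_cells: "plain_ok 379 [(415, 116), (447, 80), (482, 52), (512, 26)]"
  by (simp add: plain_val_def base_val_def ln_approx_eval)

lemma majorant_zero: "majorant \<rho> t u w a 0 = t + (majorant \<rho> s u w a 0 - s)"
  by (simp add: majorant_def)

text \<open>The corner estimate is reused with \<open>t = 1 / 512\<close>, whose contribution is the
  \<open>2 ^ 49\<close>. At \<open>d = 0\<close> the parameter \<open>t\<close> is just a summand,
  so the bound transfers to every \<open>t\<close>.\<close>

lemma plain_val_bound: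
  assumes "1 \<le> A" "A \<le> 512" "1 \<le> tr" "tr \<le> 512" "plain_val A tr \<le> 0"
  shows "majorant 0 t (tr / 512) 1 (A / 512) 0 \<le> t - 6 / 2 ^ 20"
proof -
  let ?V = "corner_val (base_val A) (int A) (int 0) (int 1) (int tr)
        (ln_approx 2 + ln_approx 512 - ln_approx 1) (ln_approx (512 - 0) - ln_approx tr)
        (int 1 * ln_approx 1 - (int 1 + int 1) * ln_approx (1 + 1) + int 1 * ln_approx 1
         - int 1 * (ln_approx (512 - 0) - ln_approx 512))
        (int 1) (int 1)"
  have "?V = plain_val A tr + 2 ^ 49" by (simp add: corner_val_def plain_val_def algebra_simps)
  then have "real_of_int ?V \<le> 2 ^ 49" using assms(5) by simp
  then have "real_of_int ?V / (2 ^ 58 * real 1) \<le> 2 ^ 49 / (2 ^ 58 * real 1)" by (intro divide_right_mono) auto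
  moreover have "majorant (real 0 / 512) (real 1 / 512) (tr / 512) (real 1 / real 1) (A / 512) (real 0 / 512) + 6 / 2 ^ 20
      \<le> real_of_int ?V / (2 ^ 58 * real 1)"
    by (rule corner_val_bound) (use assms in auto)
  ultimately have "majorant 0 (1 / 512) (tr / 512) 1 (A / 512) 0 + 6 / 2 ^ 20 \<le> 1 / 512" by simp
  then show ?thesis using majorant_zero[of 0 t "tr / 512" 1 "A / 512" "1 / 512"] by simp
qed

lemma plain_ok_sound:
  assumes "plain_ok A0 cs" "real A0 / 512 < a" "a \<le> 1"
  shows "\<exists>u>0. \<forall>t. majorant 0 t u 1 a 0 \<le> t - 6 / 2 ^ 20"
  using assms(1,2)
proof (induction cs arbitrary: A0)
  case Nil
  then have "real 512 \<le> real A0" by (simp only: plain_ok.simps of_nat_le_iff)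
  then have False using Nil.prems assms(3) by simp
  then show ?case ..
next
  case (Cons c cs)
  obtain A1 tr where c: "c = (A1, tr)" by (cases c)
  from Cons.prems(1) have A: "379 \<le> A0" "A0 < A1" "A1 \<le> 512" and u: "0 < tr" "tr \<le> 512"
    and V: "plain_val A0 tr \<le> 0" "plain_val A1 tr \<le> 0" and rest: "plain_ok A1 cs"
    unfolding c plain_ok.simps by blast+
  show ?case
  proof (cases "a \<le> real A1 / 512")
    case False
    then show ?thesis using Cons.IH[OF rest] by simp
  next
    case True
    have "majorant 0 t (tr / 512) 1 a 0 \<le> t - 6 / 2 ^ 20" for t
    proof -
      have "57 / 8 \<le> 399 / 32 * (real A0 / 512)" using A(1) by simp
      moreover have "0 \<le> 1 / (real A1 / 512)" by simp
      ultimately have "57 / 8 \<le> 1 / (real A1 / 512) + 399 / 32 * (real A0 / 512) + 0" by linarith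
      then have "convex_on {real A0 / 512..real A1 / 512} (\<lambda>a. majorant 0 t (tr / 512) 1 a 0 + 0 / 2 * (a - 0) ^ 2)"
        by (intro convex_majorant_fst) (use A in auto)
      then have "convex_on {real A0 / 512..real A1 / 512} (\<lambda>a. majorant 0 t (tr / 512) 1 a 0)" by simp
      then have "majorant 0 t (tr / 512) 1 a 0
          \<le> max (majorant 0 t (tr / 512) 1 (real A0 / 512) 0) (majorant 0 t (tr / 512) 1 (real A1 / 512) 0)"
        by (rule convex_on_le_max) (use True Cons.prems(2) in auto)
      also have "\<dots> \<le> t - 6 / 2 ^ 20"
        using plain_val_bound[of A0 tr t] plain_val_bound[of A1 tr t] A u V by simp
      finally show ?thesis .
    qed
    then show ?thesis using u by (intro exI[of _ "tr / 512"]) auto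
  qed
qed

lemma pair_exponent_large:
  assumes "4.453 \<le> \<mu>" "\<mu> \<le> 19 / 4" "380 / 512 \<le> a" "a \<le> 1"
  shows "pair_exponent (19 / 4) \<mu> 0 a 0 \<le> - (6 / 2 ^ 20)"
proof -
  obtain u where u: "u > 0" "\<And>t. majorant 0 t u 1 a 0 \<le> t - 6 / 2 ^ 20"
    using plain_ok_sound[OF plain_ok_cells, of a] assms by auto
  show ?thesis
  \<comment> \<open>The entropy of \<open>d\<close> vanishes at \<open>d = 0\<close>, but its
    tangent still contributes \<open>t\<close>; letting \<open>t\<close> tend to 0 removes
    it.\<close>
  proof (rule field_le_epsilon)
    fix t :: real assume "t > 0"
    then have "pair_exponent (19 / 4) \<mu> 0 a 0 \<le> majorant 0 t u 1 a 0"
      using assms u by (intro pair_exponent_le_majorant) auto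
    then show "pair_exponent (19 / 4) \<mu> 0 a 0 \<le> - (6 / 2 ^ 20) + t" using u(2)[of t] by linarith
  qed
qed

section \<open>Small cores\<close>

lemma one_minus_ln_bound:
  assumes "0 \<le> a" "a < (1::real)"
  shows "- ((1 - a) * ln (1 - a)) \<le> a - a ^ 2 / 2"
proof -
  let ?f = "\<lambda>x::real. (1 - x) * ln (1 - x) + x - x ^ 2 / 2"
  have "?f 0 \<le> ?f a"
  proof (rule DERIV_nonneg_imp_nondecreasing[OF assms(1)])
    fix x assume x: "0 \<le> x" "x \<le> a"
    then have "(?f has_real_derivative - ln (1 - x) - x) (at x)"
      using assms by (auto intro!: derivative_eq_intros)
    moreover have "ln (1 - x) \<le> - x" using ln_le_minus_one[of "1 - x"] x assms by simp
    ultimately show "\<exists>y. (?f has_real_derivative y) (at x) \<and> y \<ge> 0" by force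
  qed
  then show ?thesis by simp
qed

text \<open>With \<open>y = \<mu>\<close> the density and clause terms collapse to
  \<open>- \<mu> * bad_density a 0\<close>, and every remaining term has a factor
  \<open>a\<close>.\<close>

lemma pair_exponent_small_aux:
  assumes \<mu>: "0 < \<mu>" and a: "0 < a" "a < 1"
  shows "pair_exponent \<mu> \<mu> 0 a 0
    \<le> a * (1 - a / 2 + ln (3 / 4 * \<mu> * a) - 3 / 4 * \<mu> * a + 7 / 16 * \<mu> * a ^ 2 + 3 / 512 * \<mu> ^ 2 * a ^ 4)"
proof -
  define x where "x = 3 / 8 * \<mu> * a ^ 2"
  have x: "x > 0" using assms by (simp add: x_def)
  have lnx: "ln x = ln (3 / 4 * \<mu> * a) - ln 2 + ln a"
  proof -
    have "x = (3 / 4 * \<mu> * a) / 2 * a" by (simp add: x_def power2_eq_square)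
    then have "ln x = ln ((3 / 4 * \<mu> * a) / 2) + ln a" using assms by (simp only: ln_mult_pos mult_pos_pos divide_pos_pos zero_less_numeral)
    also have "ln ((3 / 4 * \<mu> * a) / 2) = ln (3 / 4 * \<mu> * a) - ln 2" using assms by (subst ln_div) auto
    finally show ?thesis by simp
  qed
  have "a * ln (1 - exp (- x)) \<le> a * (ln x - x / 2 + x ^ 2 / 24)"
    using a x by (intro mult_left_mono ln_one_minus_exp_le) auto
  also have "\<dots> = a * ln (3 / 4 * \<mu> * a) - a * ln 2 + a * ln a + a * (- x / 2 + x ^ 2 / 24)"
    unfolding lnx by (simp add: algebra_simps)
  finally have 1: "a * ln (1 - exp (- x)) \<le> \<dots>" .
  have "pair_exponent \<mu> \<mu> 0 a 0 = - (a * ln a) - (1 - a) * ln (1 - a) + a * ln 2 - \<mu> * bad_density a 0 + a * ln (1 - exp (- x))"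
    using \<mu> unfolding pair_exponent_def x_def by (simp add: algebra_simps)
  also have "\<dots> \<le> a - a ^ 2 / 2 - \<mu> * bad_density a 0 + a * ln (3 / 4 * \<mu> * a) + a * (- x / 2 + x ^ 2 / 24)"
    using 1 one_minus_ln_bound[of a] a by simp
  also have "\<dots> = a * (1 - a / 2 + ln (3 / 4 * \<mu> * a) - 3 / 4 * \<mu> * a + 7 / 16 * \<mu> * a ^ 2 + 3 / 512 * \<mu> ^ 2 * a ^ 4)"
    unfolding bad_density_def x_def by (simp add: eval_nat_numeral field_simps)
  finally show ?thesis .
qed

text \<open>For cores of bounded size \<open>s = n * a\<close> the linear bound gives no decay in
  \<open>n\<close>; there \<open>a * ln (10 * a)\<close> supplies a factor \<open>10 * s / n\<close>
  per core variable. The linear bound handles the larger sizes.\<close>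

lemma pair_exponent_small:
  assumes \<mu>: "0 < \<mu>" "\<mu> \<le> 19 / 4" and a: "0 < a" "a \<le> 1 / 5"
  shows "pair_exponent \<mu> \<mu> 0 a 0 \<le> a * (- (1 / 20))" "pair_exponent \<mu> \<mu> 0 a 0 \<le> a * ln (10 * a)"
proof -
  define v where "v = \<mu> * a"
  have v: "0 < v" "v \<le> 19 / 4 * a" "v \<le> 19 / 20"
    using assms mult_mono[of \<mu> "19 / 4" a "1 / 5"] by (auto simp: v_def)
  define l where "l = ln (3 / 4 * v)"
  define p where "p = v * a"
  define q where "q = v ^ 2 * a ^ 2"
  define G where "G = 1 - a / 2 + l - 3 / 4 * v + 7 / 16 * p + 3 / 512 * q"
  have E: "pair_exponent \<mu> \<mu> 0 a 0 \<le> a * G"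
    using pair_exponent_small_aux[of \<mu> a] assms by (simp add: G_def l_def p_def q_def v_def power_mult_distrib eval_nat_numeral mult_ac)
  have va: "p \<le> v * (1 / 5)" using v a unfolding p_def by (intro mult_left_mono) auto
  have "v * a \<le> 1 * 1" using v a by (intro mult_mono) auto
  then have "(v * a) * (v * a) \<le> (v * a) * 1" using v a by (intro mult_left_mono) auto
  then have va2: "q \<le> p" by (simp add: p_def q_def power2_eq_square mult_ac)
  have "G \<le> - (1 / 20)"
  proof -
    \<comment> \<open>Tangent at the largest possible \<open>v = 19 / 20\<close>, where
      \<open>3 / 4 * v = 57 / 80\<close>.\<close>
    have "ln (v / (19 / 20)) \<le> v / (19 / 20) - 1" using v by (intro ln_le_minus_one) auto
    moreover have "l = ln (57 / 80) + ln (v / (19 / 20))"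
      using v unfolding l_def by (subst ln_mult_pos[symmetric]) auto
    moreover have "ln (57 / 80 :: real) = ln (real 57) - ln (real 80)" by (simp add: ln_div)
    moreover have "ln (real 57) - ln (real 80) \<le> - (338 / 1000)"
      using ln_bounds(1)[of 57] ln_bounds(2)[of 80] by (simp add: ln_approx_eval)
    ultimately have "l \<le> - (338 / 1000) + (20 / 19 * v - 1)" by simp
    then show ?thesis using v va va2 unfolding G_def by linarith
  qed
  then show "pair_exponent \<mu> \<mu> 0 a 0 \<le> a * (- (1 / 20))"
    using E a by (meson less_imp_le mult_left_mono order_trans)
  have "G \<le> ln (10 * a)"
  proof -
    have "G \<le> 1 + l" using v va va2 a unfolding G_def by linarith
    also have "\<dots> = ln (exp 1 * (3 / 4 * v))" using v unfolding l_def by (subst ln_mult_pos) auto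
    also have "\<dots> \<le> ln (10 * a)"
    proof (rule ln_mono)
      \<comment> \<open>Origin of the 10: \<open>2.72 * 3 / 4 * 19 / 4\<close> is about
        9.69.\<close>
      have "exp 1 * (3 / 4 * v) \<le> (272 / 100) * (3 / 4 * (19 / 4 * a))"
        using e_less_272 v by (intro mult_mono) auto
      also have "\<dots> \<le> 10 * a" using a by simp
      finally show "exp 1 * (3 / 4 * v) \<le> 10 * a" .
    qed (use v in auto)
    finally show ?thesis .
  qed
  then show "pair_exponent \<mu> \<mu> 0 a 0 \<le> a * ln (10 * a)"
    using E a by (meson less_imp_le mult_left_mono order_trans)
qed

text \<open>Here \<open>y = 1.06 * \<mu>\<close>. The tangents to \<open>ln (2 - w)\<close> at
  \<open>w = 3 / 20\<close> and to \<open>exp (- x)\<close> at \<open>ln (20 / 3)\<close>, about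
  1.897, are taken near \<open>x = 1.884\<close>, the value at \<open>\<mu> = 4.74\<close>. They
  leave a linear function that decreases in \<open>\<mu>\<close>, so the left end decides.\<close>

lemma sat_exponent_neg:
  fixes \<mu> :: real
  assumes "4.74 \<le> \<mu>"
  shows "\<mu> * ln (\<mu> / (1.06 * \<mu>)) - \<mu> + 7 / 8 * (1.06 * \<mu>) + ln (2 - exp (- (3 / 8 * (1.06 * \<mu>)))) \<le> - (1 / 1000)"
proof -
  define x where "x = 3 / 8 * (1.06 * \<mu>)"
  define w where "w = exp (- x)"
  have w: "0 < w" "w \<le> 1" using assms by (simp_all add: w_def x_def)
  have "ln (\<mu> / (1.06 * \<mu>)) = - ln (53 / 50)" using assms by (simp flip: ln_inverse)
  also have "ln (53 / 50 :: real) = ln (real 53) - ln (real 50)" by (simp add: ln_div)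
  finally have "ln (\<mu> / (1.06 * \<mu>)) \<le> - (582 / 10000)"
    using ln_bounds(2)[of 53] ln_bounds(1)[of 50] by (simp add: ln_approx_eval)
  then have 1: "\<mu> * ln (\<mu> / (1.06 * \<mu>)) \<le> \<mu> * (- (582 / 10000))"
    using assms by (intro mult_left_mono) auto
  have "ln (37 / 20 :: real) = ln (real 37) - ln (real 20)" by (simp add: ln_div)
  then have l185: "ln (37 / 20 :: real) \<le> 6153 / 10000"
    using ln_bounds(1)[of 37] ln_bounds(2)[of 20] by (simp add: ln_approx_eval)
  have "ln ((2 - w) / (37 / 20)) \<le> (2 - w) / (37 / 20) - 1" using w by (intro ln_le_minus_one) auto
  moreover have "ln (2 - w) = ln (37 / 20) + ln ((2 - w) / (37 / 20))"
    using w by (subst ln_mult_pos[symmetric]) auto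
  ultimately have 2: "ln (2 - w) \<le> 6153 / 10000 + ((2 - w) / (37 / 20) - 1)" using l185 by linarith
  have "ln (20 / 3 :: real) = ln (real 20) - ln (real 3)" by (simp add: ln_div)
  then have l015: "ln (20 / 3 :: real) \<ge> 1897 / 1000"
    using ln_bounds(2)[of 20] ln_bounds(1)[of 3] by (simp add: ln_approx_eval)
  have "exp (ln (20 / 3) + - x) = exp (ln (20 / 3)) * w" unfolding w_def by (rule exp_add)
  then have w_eq: "3 / 20 * exp (ln (20 / 3) + - x) = w" by simp
  have "3 / 20 * (1 + (1897 / 1000 - x)) \<le> 3 / 20 * (1 + (ln (20 / 3) + - x))"
    by (intro mult_left_mono) (use l015 in auto)
  also have "\<dots> \<le> 3 / 20 * exp (ln (20 / 3) + - x)"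
    by (intro mult_left_mono exp_ge_add_one_self) auto
  also have "\<dots> = w" by (rule w_eq)
  finally have 3: "w \<ge> 3 / 20 * (1 + (1897 / 1000 - x))" .
  have x: "x = 159 / 400 * \<mu>" by (simp add: x_def)
  have "\<mu> * ln (\<mu> / (1.06 * \<mu>)) - \<mu> + 371 / 400 * \<mu> + ln (2 - w) \<le> - (1 / 1000)"
  proof -
    have "r - \<mu> + 371 / 400 * \<mu> + l \<le> - (1 / 1000)"
      if "r \<le> \<mu> * (- (582 / 10000))" "l \<le> 6153 / 10000 + ((2 - w) / (37 / 20) - 1)" for r l :: real
    proof -
      have "\<mu> \<ge> 237 / 50" using assms by simp
      then show ?thesis using that 3 unfolding x by (simp add: field_simps)
    qed
    from this[OF 1 2] show ?thesis .
  qed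
  moreover have "7 / 8 * (1.06 * \<mu>) = 371 / 400 * \<mu>" by simp
  ultimately show ?thesis by (simp only: w_def x_def)
qed

section \<open>Absence of non-trivial cores\<close>

lemma prob_le_card_div:
  assumes "n \<ge> 3" "finite F" "samples (clauses n) m \<inter> {\<phi>. P \<phi>} \<subseteq> F"
  shows "measure_pmf.prob (random_formula n m) {\<phi>. P \<phi>} \<le> real (card F) / real (8 * (n choose 3)) ^ m"
proof -
  have "card (clauses n) > 0" using assms(1) by (simp add: card_clauses zero_less_binomial_iff)
  then have "clauses n \<noteq> {}" by auto
  then have "measure_pmf.prob (random_formula n m) {\<phi>. P \<phi>}
      = real (card (samples (clauses n) m \<inter> {\<phi>. P \<phi>})) / real (8 * (n choose 3)) ^ m"
    unfolding random_formula_def using prob_samples[OF finite_clauses] by (simp add: card_clauses)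
  also have "\<dots> \<le> real (card F) / real (8 * (n choose 3)) ^ m"
    using card_mono[OF assms(2,3)] by (intro divide_right_mono) auto
  finally show ?thesis .
qed

lemma finite_core_event: "finite (core_event n m s)"
  by (rule finite_subset[OF _ finite_samples[OF finite_clauses]]) (auto simp: core_event_def)

lemma prob_core_le_sum:
  assumes "n \<ge> 3"
  shows "measure_pmf.prob (random_formula n m) {\<phi>. has_nontrivial_core n \<phi>}
     \<le> (\<Sum>s\<in>{1..n}. real (card (core_event n m s)) / real (8 * (n choose 3)) ^ m)"
proof -
  have "measure_pmf.prob (random_formula n m) {\<phi>. has_nontrivial_core n \<phi>}
     \<le> real (card (\<Union>s\<in>{1..n}. core_event n m s)) / real (8 * (n choose 3)) ^ m"
  proof (rule prob_le_card_div[OF assms])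
    show "finite (\<Union>s\<in>{1..n}. core_event n m s)" using finite_core_event by blast
    show "samples (clauses n) m \<inter> {\<phi>. has_nontrivial_core n \<phi>} \<subseteq> (\<Union>s\<in>{1..n}. core_event n m s)"
    proof
      fix \<phi> assume \<phi>: "\<phi> \<in> samples (clauses n) m \<inter> {\<phi>. has_nontrivial_core n \<phi>}"
      then obtain \<sigma> S where *: "dom \<sigma> = {..<n}" "valid n \<phi> \<sigma>" "S \<subseteq> {..<n}" "S \<noteq> {}" "minimal n \<phi> (\<sigma> |` S)"
        using has_nontrivial_coreD by (metis IntD2 mem_Collect_eq)
      have "card S \<le> n" using card_mono[OF finite_lessThan *(3)] by simp
      moreover have "card S \<noteq> 0" using *(4) finite_subset[OF *(3)] by simp
      moreover have "\<phi> \<in> core_event n m (card S)" using * \<phi> unfolding core_event_def by blast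
      ultimately show "\<phi> \<in> (\<Union>s\<in>{1..n}. core_event n m s)" by (intro UN_I[of "card S"]) auto
    qed
  qed
  also have "\<dots> \<le> real (\<Sum>s\<in>{1..n}. card (core_event n m s)) / real (8 * (n choose 3)) ^ m"
    by (intro divide_right_mono of_nat_mono card_UN_le) auto
  also have "\<dots> = (\<Sum>s\<in>{1..n}. real (card (core_event n m s)) / real (8 * (n choose 3)) ^ m)"
    by (simp add: sum_divide_distrib)
  finally show ?thesis .
qed

lemma prob_core_le_sat:
  assumes "n \<ge> 3"
  shows "measure_pmf.prob (random_formula n m) {\<phi>. has_nontrivial_core n \<phi>}
     \<le> real (card (sat_event n m)) / real (8 * (n choose 3)) ^ m"
proof (rule prob_le_card_div[OF assms])
  show "finite (sat_event n m)"
    by (rule finite_subset[OF _ finite_samples[OF finite_clauses]]) (auto simp: sat_event_def)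
qed (auto simp: sat_event_def has_nontrivial_core_def core_of_def)

lemma core_event_plain_le:
  assumes "m \<ge> 1" "n \<ge> 6" "y > 0" "s \<ge> 1" "s \<le> n"
  shows "real (card (core_event n m s)) / real (8 * (n choose 3)) ^ m
    \<le> sqrt m * exp (1 + 6 * (m / n) + y) * exp (n * pair_exponent y (m / n) 0 (s / n) 0)"
proof -
  have "real (card (core_event n m s)) / real (8 * (n choose 3)) ^ m
      \<le> real (n choose s) * 2 ^ s * pair_bound n m y 0 s 0 / real (8 * (n choose 3)) ^ m"
    using assms by (intro divide_right_mono card_core_event_le_plain) auto
  also have "\<dots> = real (n choose (s + 0)) * real ((s + 0) choose s) * 2 ^ (s + 0) * (1 - 0) ^ (n - (s + 0))
      * pair_bound n m y 0 s 0 / real (8 * (n choose 3)) ^ m" by simp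
  also have "\<dots> \<le> sqrt m * exp (1 + 6 * (m / n) + y) * exp (n * pair_exponent y (m / n) 0 (s / n) (real 0 / n))"
    by (rule pair_term_le) (use assms in auto)
  finally show ?thesis by simp
qed

lemma summable_weighted_geometric: "summable (\<lambda>s. real s * exp (- (1 / 20)) ^ (s - 1) :: real)"
proof -
  have "summable (\<lambda>s. of_nat (Suc s) * exp (- (1 / 20)) ^ s :: real)"
    using geometric_deriv_sums[of "exp (- (1 / 20)) :: real"] by (intro sums_summable) simp
  then show ?thesis by (subst summable_Suc_iff[symmetric]) simp
qed

context
  fixes n m :: nat
  assumes m: "m \<ge> 1" and n: "n \<ge> 6" and \<mu>: "4.453 \<le> real m / n" "real m / n \<le> 19 / 4"
begin

text \<open>At the extreme values the exponent is
  \<open>1 + 6 * 19 / 4 + 19 / 4 = 34.25\<close>.\<close>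

lemma exp_prefactor_le: "y \<le> 19 / 4 \<Longrightarrow> exp (1 + 6 * (real m / n) + y) \<le> exp 35"
  using \<mu>(2) by simp

lemma core_event_small_le:
  assumes s: "s \<ge> 1" "real s / n \<le> 1 / 5"
  shows "real (card (core_event n m s)) / real (8 * (n choose 3)) ^ m
    \<le> sqrt m * exp 35 * (10 / n * (s * exp (- (1 / 20)) ^ (s - 1)))"
proof -
  have n0: "real n > 0" using n by simp
  have mu0: "real m / n > 0" using m n by simp
  have a0: "real s / n > 0" using s(1) n0 by simp
  have "real s \<le> 1 / 5 * n" using s(2) n0 by (simp add: pos_divide_le_eq)
  then have sn: "s \<le> n" by linarith
  define E where "E = pair_exponent (m / n) (m / n) 0 (s / n) 0"
  define g where "g = ln (10 * (s / n))"
  have E: "n * E \<le> s * (- (1 / 20))" "n * E \<le> s * g"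
    using mult_left_mono[OF pair_exponent_small(1)[OF mu0 \<mu>(2) a0 s(2)], of n]
      mult_left_mono[OF pair_exponent_small(2)[OF mu0 \<mu>(2) a0 s(2)], of n] n0
    by (simp_all add: E_def g_def)
  \<comment> \<open>Average of the two bounds with weights \<open>1 / s\<close> and
    \<open>(s - 1) / s\<close>: one factor \<open>10 * s / n\<close> makes the total vanish, and
    geometric decay makes the sum over \<open>s\<close> converge.\<close>
  have "n * E \<le> g + (real s - 1) * (- (1 / 20))"
  proof -
    have "real s * (n * E) = n * E + (real s - 1) * (n * E)" by (simp add: algebra_simps)
    also have "\<dots> \<le> s * g + (real s - 1) * (s * (- (1 / 20)))"
      using E s(1) by (intro add_mono mult_left_mono) auto
    also have "\<dots> = real s * (g + (real s - 1) * (- (1 / 20)))" by (simp add: algebra_simps)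
    finally show ?thesis using s(1) by simp
  qed
  then have "exp (n * E) \<le> exp (g + real (s - 1) * (- (1 / 20)))" using s(1) by (simp add: of_nat_diff)
  also have "\<dots> = 10 / n * (s * exp (- (1 / 20)) ^ (s - 1))"
    using a0 n0 s(1) by (simp only: exp_add exp_of_nat_mult) (simp add: g_def)
  finally have "sqrt m * exp (1 + 6 * (m / n) + m / n) * exp (n * E)
      \<le> sqrt m * exp 35 * (10 / n * (s * exp (- (1 / 20)) ^ (s - 1)))"
    using exp_prefactor_le[OF \<mu>(2)] by (intro mult_mono mult_left_mono) auto
  then show ?thesis
    using core_event_plain_le[OF m n mu0 s(1) sn] by (simp add: E_def)
qed

lemma core_event_big_le:
  assumes s: "s \<le> n" "1 / 5 \<le> real s / n"
  shows "real (card (core_event n m s)) / real (8 * (n choose 3)) ^ m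
    \<le> real (n + 1) * (sqrt m * exp 35 * exp (n * (- (6 / 2 ^ 20))))"
proof -
  let ?c = "sqrt m * exp 35 * exp (n * (- (6 / 2 ^ 20)))"
  have n0: "real n > 0" using n by simp
  have s1: "s \<ge> 1" using s(2) by (cases s) auto
  have c: "sqrt m * exp (1 + 6 * (m / n) + 19 / 4) * exp (n * E) \<le> ?c" if "E \<le> - (6 / 2 ^ 20)" for E :: real
  proof (intro mult_mono exp_prefactor_le)
    show "exp (n * E) \<le> exp (n * (- (6 / 2 ^ 20)))" using that n0 by (simp only: exp_le_cancel_iff) (rule mult_left_mono, simp_all)
  qed auto
  show ?thesis
  proof (cases "380 / 512 \<le> real s / n")
    case True
    have "real (card (core_event n m s)) / real (8 * (n choose 3)) ^ m
        \<le> sqrt m * exp (1 + 6 * (m / n) + 19 / 4) * exp (n * pair_exponent (19 / 4) (m / n) 0 (s / n) 0)"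
      by (rule core_event_plain_le[OF m n _ s1 s(1)]) simp
    also have "\<dots> \<le> ?c"
      by (intro c pair_exponent_large \<mu>) (use True s(1) n0 in auto)
    also have "?c = 1 * ?c" by simp
    also have "\<dots> \<le> real (n + 1) * ?c" by (intro mult_right_mono) auto
    finally show ?thesis .
  next
    case False
    then obtain \<rho> where \<rho>: "0 < \<rho>" "\<rho> < 1" and
      *: "\<And>\<mu> d. 4.453 \<le> \<mu> \<Longrightarrow> \<mu> \<le> 19 / 4 \<Longrightarrow> 0 \<le> d \<Longrightarrow> real s / n + d \<le> 1 \<Longrightarrow>
         pair_exponent (19 / 4) \<mu> \<rho> (real s / n) d \<le> - (6 / 2 ^ 20)"
      using slices_ok_sound[OF slices_ok_slices, of "real s / n"] s(2) by (auto simp del: minus_divide_left)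
    let ?t = "\<lambda>b. real (n choose b) * real (b choose s) * 2 ^ b * (1 - \<rho>) ^ (n - b) * pair_bound n m (19 / 4) \<rho> s (b - s)"
    have "real (card (core_event n m s)) / real (8 * (n choose 3)) ^ m
        \<le> (\<Sum>b\<in>{s..n}. ?t b) / real (8 * (n choose 3)) ^ m"
      using n \<rho> by (intro divide_right_mono card_core_event_le) auto
    also have "\<dots> = (\<Sum>b\<in>{s..n}. ?t b / real (8 * (n choose 3)) ^ m)" by (rule sum_divide_distrib)
    also have "\<dots> \<le> (\<Sum>b\<in>{s..n}. ?c)"
    proof (rule sum_mono)
      fix b assume b: "b \<in> {s..n}"
      then have b': "b = s + (b - s)" by simp
      have "?t (s + (b - s)) / real (8 * (n choose 3)) ^ m
          \<le> sqrt m * exp (1 + 6 * (m / n) + 19 / 4) * exp (n * pair_exponent (19 / 4) (m / n) \<rho> (s / n) (real (b - s) / n))"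
        using pair_term_le[OF m n, of "19 / 4" \<rho> s "b - s"] \<rho> s1 b by simp
      also have "\<dots> \<le> ?c"
      proof (intro c * \<mu>)
        have "real s / n + real (b - s) / n = real b / n" using b by (simp add: of_nat_diff add_divide_distrib[symmetric])
        then show "real s / n + real (b - s) / n \<le> 1" using b n0 by simp
      qed simp
      finally show "?t b / real (8 * (n choose 3)) ^ m \<le> ?c" using b' by simp
    qed
    also have "\<dots> = real (card {s..n}) * ?c" by simp
    also have "\<dots> \<le> real (n + 1) * ?c" by (intro mult_right_mono) auto
    finally show ?thesis .
  qed
qed

text \<open>The small sizes contribute a constant over \<open>n\<close>, which beats the prefactor
  \<open>sqrt m\<close>; the larger sizes are exponentially small, with \<open>n * (n + 1)\<close>
  bounding the number of terms.\<close>

lemma prob_core_le: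
  "measure_pmf.prob (random_formula n m) {\<phi>. has_nontrivial_core n \<phi>}
    \<le> sqrt m * exp 35 * (10 / n * (\<Sum>s. real s * exp (- (1 / 20)) ^ (s - 1)) + n * (n + 1) * exp (n * (- (6 / 2 ^ 20))))"
proof -
  let ?q = "exp (- (1 / 20)) :: real"
  let ?N = "real (8 * (n choose 3)) ^ m"
  have "measure_pmf.prob (random_formula n m) {\<phi>. has_nontrivial_core n \<phi>}
      \<le> (\<Sum>s\<in>{1..n}. real (card (core_event n m s)) / ?N)"
    by (rule prob_core_le_sum) (use n in simp)
  also have "\<dots> \<le> (\<Sum>s\<in>{1..n}. sqrt m * exp 35 * (10 / n * (s * ?q ^ (s - 1)))
      + real (n + 1) * (sqrt m * exp 35 * exp (n * (- (6 / 2 ^ 20)))))"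
  proof (rule sum_mono)
    fix s assume s: "s \<in> {1..n}"
    show "real (card (core_event n m s)) / ?N \<le> sqrt m * exp 35 * (10 / n * (s * ?q ^ (s - 1)))
      + real (n + 1) * (sqrt m * exp 35 * exp (n * (- (6 / 2 ^ 20))))"
    proof (cases "real s / n \<le> 1 / 5")
      case True
      have "0 \<le> real (n + 1) * (sqrt m * exp 35 * exp (n * (- (6 / 2 ^ 20))))" by (intro mult_nonneg_nonneg) auto
      then show ?thesis using core_event_small_le[OF _ True] s by (simp add: add_increasing2)
    next
      case False
      have "0 \<le> sqrt m * exp 35 * (10 / n * (s * ?q ^ (s - 1)))" by (intro mult_nonneg_nonneg) auto
      then show ?thesis using core_event_big_le[of s] False s by (simp add: add_increasing)
    qed
  qed
  also have "\<dots> = sqrt m * exp 35 * (10 / n * (\<Sum>s\<in>{1..n}. real s * ?q ^ (s - 1)) + n * (n + 1) * exp (n * (- (6 / 2 ^ 20))))"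
    by (simp add: sum.distrib sum_distrib_left algebra_simps)
  also have "\<dots> \<le> sqrt m * exp 35 * (10 / n * (\<Sum>s. real s * ?q ^ (s - 1)) + n * (n + 1) * exp (n * (- (6 / 2 ^ 20))))"
    by (intro mult_left_mono add_right_mono sum_le_suminf summable_weighted_geometric) auto
  finally show ?thesis .
qed

end

theorem theorem1:
  fixes \<alpha> :: real
  assumes "\<alpha> > 4.453"
  shows "(\<lambda>n. measure_pmf.prob (random_formula n (nat \<lfloor>\<alpha> * real n\<rfloor>))
            {\<phi>. \<not> has_nontrivial_core n \<phi>}) \<longlonglongrightarrow> 1"
proof -
  define m where "m = (\<lambda>n. nat \<lfloor>\<alpha> * real n\<rfloor>)"
  define p where "p = (\<lambda>n. measure_pmf.prob (random_formula n (m n)) {\<phi>. has_nontrivial_core n \<phi>})"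
  have m_le: "real (m n) \<le> \<alpha> * n" for n using assms by (simp add: m_def)
  have m_ge: "\<alpha> * n - 1 \<le> real (m n)" for n using assms by (simp add: m_def)
  have dens: "\<alpha> - 1 / n \<le> m n / n" "m n / n \<le> \<alpha>" if "n > 0" for n
  proof -
    have "(\<alpha> * n - 1) / n \<le> m n / n" "m n / n \<le> \<alpha> * n / n"
      using m_le[of n] m_ge[of n] by (intro divide_right_mono; simp)+
    then show "\<alpha> - 1 / n \<le> m n / n" "m n / n \<le> \<alpha>" using that by (simp_all add: diff_divide_distrib)
  qed
  have "\<alpha> - 4.453 > 0" using assms by simp
  \<comment> \<open>The strict inequality on \<open>\<alpha>\<close> absorbs the loss of at most
    \<open>1 / n\<close> from rounding the number of clauses down.\<close>
  then have ev1: "eventually (\<lambda>n. 4.453 \<le> \<alpha> - 1 / real n) sequentially" by real_asymp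
  have sqrt_le: "sqrt (m n) \<le> sqrt (\<alpha> * n)" for n using m_le by simp
  have "p \<longlonglongrightarrow> 0"
  proof (cases "\<alpha> \<le> 19 / 4")
    case True
    define B where "B = (\<Sum>s. real s * exp (- (1 / 20)) ^ (s - 1) :: real)"
    define u where "u = (\<lambda>n. sqrt (\<alpha> * real n) * exp 35 * (10 / n * B + real (n * (n + 1)) * exp (n * (- (6 / 2 ^ 20)))))"
    have B0: "0 \<le> B" unfolding B_def by (intro suminf_nonneg summable_weighted_geometric) auto
    have "(\<lambda>n. sqrt \<alpha> * exp 35 * (B * 10 * (sqrt (real n) / n) + sqrt (real n) * (n * (n + 1) * exp (n * (- (6 / 2 ^ 20)))))) \<longlonglongrightarrow> sqrt \<alpha> * exp 35 * (B * 10 * 0 + 0)"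
      by (intro tendsto_intros; real_asymp)
    then have "u \<longlonglongrightarrow> 0" unfolding u_def by (simp add: real_sqrt_mult algebra_simps)
    moreover have "eventually (\<lambda>n. p n \<le> u n) sequentially"
      using ev1 eventually_ge_at_top[of 6]
    proof eventually_elim
      case (elim n)
      then have "n > 0" by simp
      have dn: "4.453 \<le> m n / n" "m n / n \<le> 19 / 4"
        by (rule order_trans[OF elim(1) dens(1)[OF \<open>n > 0\<close>]]) (rule order_trans[OF dens(2)[OF \<open>n > 0\<close>] True])
      moreover have "m n \<ge> 1" using dn(1) by (cases "m n") auto
      ultimately have "p n \<le> sqrt (m n) * exp 35 * (10 / n * B + n * (n + 1) * exp (n * (- (6 / 2 ^ 20))))"
        unfolding p_def B_def by (intro prob_core_le) (use elim in auto)
      also have "\<dots> \<le> u n"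
        unfolding u_def using B0 sqrt_le by (intro mult_right_mono add_nonneg_nonneg mult_nonneg_nonneg) auto
      finally show ?case .
    qed
    ultimately show ?thesis
      by (intro tendsto_sandwich[of "\<lambda>_. 0" p sequentially u]) (auto simp: p_def)
  next
    case False
    define u where "u = (\<lambda>n. sqrt (\<alpha> * real n) * exp (1 + 6 * \<alpha> + 1.06 * \<alpha>) * exp (n * (- (1 / 1000))))"
    have "(\<lambda>n. sqrt \<alpha> * exp (1 + 6 * \<alpha> + 1.06 * \<alpha>) * (sqrt (real n) * exp (n * (- (1 / 1000))))) \<longlonglongrightarrow> sqrt \<alpha> * exp (1 + 6 * \<alpha> + 1.06 * \<alpha>) * 0"
      by (intro tendsto_intros; real_asymp)
    then have "u \<longlonglongrightarrow> 0" unfolding u_def by (simp add: real_sqrt_mult mult_ac)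
    moreover have "eventually (\<lambda>n. p n \<le> u n) sequentially"
      using eventually_ge_at_top[of 100]
    proof eventually_elim
      case (elim n)
      then have "n > 0" "n \<ge> 6" by auto
      define \<mu> where "\<mu> = m n / n"
      \<comment> \<open>Rounding costs at most 0.01 in density for \<open>n \<ge> 100\<close>, which
        takes 4.75 to the 4.74 of \<open>sat_exponent_neg\<close>.\<close>
      have "1 / real n \<le> 1 / 100" using elim by (intro divide_left_mono) auto
      then have "4.74 \<le> \<alpha> - 1 / n" using False by simp
      then have \<mu>: "4.74 \<le> \<mu>" "\<mu> \<le> \<alpha>"
        unfolding \<mu>_def using dens[OF \<open>n > 0\<close>] by (blast intro: order_trans)+
      have "m n \<ge> 1" using \<mu>(1) by (cases "m n") (auto simp: \<mu>_def)
      have "p n \<le> real (card (sat_event n (m n))) / real (8 * (n choose 3)) ^ m n"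
        unfolding p_def by (rule prob_core_le_sat) (use elim in simp)
      also have "\<dots> \<le> sqrt (m n) * exp (1 + 6 * \<mu> + 1.06 * \<mu>) * exp (n * (\<mu> * ln (\<mu> / (1.06 * \<mu>)) - \<mu> + 7 / 8 * (1.06 * \<mu>)
          + ln (2 - exp (- (3 / 8 * (1.06 * \<mu>))))))"
        unfolding \<mu>_def by (rule sat_prob_le) (use \<open>m n \<ge> 1\<close> \<open>n \<ge> 6\<close> in auto)
      also have "\<dots> \<le> u n"
        unfolding u_def
      proof (intro mult_mono)
        show "exp (1 + 6 * \<mu> + 1.06 * \<mu>) \<le> exp (1 + 6 * \<alpha> + 1.06 * \<alpha>)" using \<mu> by simp
        show "exp (n * (\<mu> * ln (\<mu> / (1.06 * \<mu>)) - \<mu> + 7 / 8 * (1.06 * \<mu>) + ln (2 - exp (- (3 / 8 * (1.06 * \<mu>))))))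
            \<le> exp (n * (- (1 / 1000)))"
          using sat_exponent_neg[OF \<mu>(1)] by (simp only: exp_le_cancel_iff) (intro mult_left_mono, auto)
      qed (use sqrt_le assms in \<open>auto intro!: mult_nonneg_nonneg\<close>)
      finally show ?case .
    qed
    ultimately show ?thesis
      by (intro tendsto_sandwich[of "\<lambda>_. 0" p sequentially u]) (auto simp: p_def)
  qed
  then have "(\<lambda>n. 1 - p n) \<longlonglongrightarrow> 1 - 0" by (intro tendsto_intros)
  moreover have "measure_pmf.prob (random_formula n (m n)) {\<phi>. \<not> has_nontrivial_core n \<phi>} = 1 - p n" for n
    unfolding p_def
    using measure_pmf.prob_compl[of "{\<phi>. has_nontrivial_core n \<phi>}" "random_formula n (m n)"]
    by (simp add: Compl_eq_Diff_UNIV[symmetric] Collect_neg_eq)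
  ultimately show ?thesis by (simp add: m_def)
qed

end
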